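(* Let $k\ge 2$ and $m\ge 1$ be integers and $b\in\mathbb{Z}$ with $\gcd(b,m)=1$. For all $Q\ge 1$, \[D\!\left(\mathscr{F}_{Q,k}^{(m)}\right)\asymp \frac{1}{Q},\] where the implied constants depend on $m$.
   Context: A positive integer $n$ is $k$-free if $p^k\nmid n$ for every prime $p$. For a positive integer $Q$, \[\mathscr{F}_{Q,k}^{(m)}=\left\{\tfrac{a}{q} : 1\le a\le q\le Q,\ \gcd(a,q)=1,\ q \text{ is } k\text{-free},\ q\equiv b \pmod m\right\},\] and $N=\#\mathscr{F}_{Q,k}^{(m)}$. For $\alpha\in[0,1]$ let $A(\alpha)$ be the number of elements of $\mathscr{F}_{Q,k}^{(m)}$ (taken modulo one) not exceeding $\alpha$. The discrepancy is $D\!\left(\mathscr{F}_{Q,k}^{(m)}\right)=\sup_{0\le\alpha\le1}\left|\frac{A(\alpha)}{N}-\alpha\right|$. $f\asymp g$ means $C_1 g\le f\le C_2 g$ for positive constants $C_1,C_2$. *)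

theory Defs
  imports Complex_Main "HOL-Number_Theory.Cong"
begin

definition k_free :: "nat \<Rightarrow> nat \<Rightarrow> bool" where
  "k_free k n \<longleftrightarrow> n > 0 \<and> (\<forall>p. prime p \<longrightarrow> \<not> p ^ k dvd n)"

definition farey_kfree :: "nat \<Rightarrow> nat \<Rightarrow> int \<Rightarrow> nat \<Rightarrow> real set" where
  "farey_kfree k m b Q = {real a / real q | a q :: nat.
     1 \<le> a \<and> a \<le> q \<and> q \<le> Q \<and> coprime a q \<and> k_free k q \<and> [int q = b] (mod int m)}"

text \<open>Elements are reduced modulo one by \<^const>\<open>frac\<close>, so that the fraction 1 is counted as 0.\<close>

definition count_upto :: "real set \<Rightarrow> real \<Rightarrow> nat" where
  "count_upto F \<alpha> = card {x \<in> F. frac x \<le> \<alpha>}"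

text \<open>
  Intended for finite \<open>F\<close>; the quantity under the supremum then lies between 0 and 1. When
  \<open>F\<close> is empty the quotient is \<open>0 / 0 = 0\<close>, so the discrepancy is 1. The set
  \<^const>\<open>farey_kfree\<close> is empty if \<open>Q\<close> is smaller than every admissible denominator.
\<close>

definition discrepancy :: "real set \<Rightarrow> real" where
  "discrepancy F = (SUP \<alpha>\<in>{0..1}. \<bar>real (count_upto F \<alpha>) / real (card F) - \<alpha>\<bar>)"

end

theory Submission
  imports Defs "HOL-Analysis.Kronecker_Approximation_Theorem"
    "HOL-Computational_Algebra.Squarefree" "HOL-Number_Theory.Totient"
begin

text \<open>
  The lower bound holds because no fraction other than 0 is closer than \<open>1 / Q\<close> to 0. For the upper bound there
  are \<open>N\<close> fractions with \<open>N\<close> at least a constant times \<open>Q ^ 2\<close>, so one has to bound \<open>A(\<alpha>) - \<alpha> N\<close> by a constant times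
  \<open>Q\<close>. Up to a bounded term it is minus the sum of \<open>\<mu>(d) frac (\<alpha> n / d)\<close> over the denominators \<open>n\<close> and the \<open>d\<close>
  dividing \<open>n\<close>.

  Removing the primes of the \<open>k\<close>-free condition one at a time reduces the problem to all \<open>n \<equiv> b (mod m)\<close>, and Dirichlet
  approximation reduces it to \<open>\<alpha> = p / q\<close> with \<open>q \<le> Q\<close>. Such a fraction is compared with a neighbour \<open>p' / q'\<close>,
  where \<open>p q' - p' q = \<plusminus>1\<close> and \<open>q' \<le> q / 2\<close>. Between the two, for each \<open>d\<close> the sum over \<open>n / d \<le> Q / d\<close> is a linear
  function of \<open>Q / d\<close> up to a small error, and its slope is a combination of values
  \<open>frac (a c / (d g)) - 1 / 2\<close> with \<open>g\<close> dividing \<open>m\<close>, the division by \<open>d\<close> being modulo \<open>g\<close>. The sum over \<open>d\<close> of these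
  values, weighted by \<open>\<mu>(d) / d\<close>, stays bounded; hence a step costs a constant times \<open>Q / sqrt q'\<close>, which is
  summable along the chain of neighbours.
\<close>

subsection \<open>Moebius sums over divisors\<close>

text \<open>Bounding every \<open>frac\<close> by 1 leaves the number of pairs of an
  \<open>n <= Q\<close> in the class and a squarefree divisor of \<open>n\<close>, which is of order
  \<open>Q * log Q\<close>. The difficulty is to lose this logarithm, and it threatens three times:
  in the slopes, whose weights \<open>1 / d\<close> must cancel through the signs of
  \<open>moebius\<close>; in the errors, which are summed over \<open>d\<close> in absolute value;
  and in the chain of neighbours, which may have about \<open>log Q\<close> members. The residue
  class adds an obstacle of its own. From \<open>d * e \<equiv> b\<close> one gets
  \<open>e \<equiv> b / d\<close>, so the slopes involve the inverse of \<open>d\<close> modulo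
  \<open>m\<close>, whereas Moebius inversion of a Fourier series handles only sawtooths at
  multiples \<open>d * x\<close>. An average over all units modulo \<open>m\<close> exchanges one
  for the other, which is why all bounds are uniform in the class. The sieve must not depend on
  \<open>k\<close>. It works with divisor sums from which the divisors divisible by \<open>p\<close>
  are left out: for these, multiplying \<open>n\<close> by a power of \<open>p\<close> merely
  dilates the argument of \<open>frac\<close>.\<close>

lemmas cong_iff_mod_eq = Cong.unique_euclidean_semiring_class.cong_def

definition moebius :: "nat \<Rightarrow> real" where
  "moebius n = (if squarefree n then (-1) ^ card (prime_factors n) else 0)"

lemma moebius_1 [simp]: "moebius 1 = 1" "moebius (Suc 0) = 1"
  by (simp_all add: moebius_def)

lemma abs_moebius_le: "\<bar>moebius n\<bar> \<le> 1"
  by (simp add: moebius_def power_abs)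

lemma moebius_prime_mult:
  assumes "prime p" "\<not> p dvd d"
  shows "moebius (p * d) = - moebius d"
proof (cases "d = 0")
  case False
  have cop: "coprime p d" using assms by (simp add: prime_imp_coprime)
  have "squarefree (p * d) \<longleftrightarrow> squarefree d"
    using cop assms(1) squarefree_multD(2) squarefree_mult_coprime squarefree_prime by blast
  moreover have "prime_factors (p * d) = insert p (prime_factors d)"
    using assms False by (auto simp: prime_factors_product prime_factorization_prime prime_gt_0_nat)
  moreover have "p \<notin> prime_factors d" using assms by auto
  ultimately show ?thesis by (simp add: moebius_def)
qed (use assms in auto)

lemma moebius_prime_mult_dvd:
  assumes "prime p" "p dvd d"
  shows "moebius (p * d) = 0"
proof -
  have "p\<^sup>2 dvd p * d" using assms by (simp add: power2_eq_square)
  then have "\<not> squarefree (p * d)"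
    using assms(1) by (meson not_prime_unit squarefree_def)
  then show ?thesis by (simp add: moebius_def)
qed

text \<open>A multiple \<open>p * d\<close> contributes nothing when \<open>p\<close> divides
  \<open>d\<close>, and the weight of \<open>d\<close> with opposite sign otherwise. This one
  recursion is used for the divisor sum, for sifted Moebius sums and for splitting
  \<open>rho\<close>.\<close>

lemma sum_moebius_split_prime:
  fixes F :: "nat \<Rightarrow> real"
  assumes "prime p" "finite A"
  shows "(\<Sum>d\<in>A. moebius d * F d) =
    (\<Sum>d\<in>{d\<in>A. \<not> p dvd d}. moebius d * F d) - (\<Sum>d\<in>{d. p * d \<in> A \<and> \<not> p dvd d}. moebius d * F (p * d))"
proof -
  have p: "p > 0" using assms(1) prime_gt_0_nat by blast
  have fin: "finite {d. p * d \<in> A}"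
    using finite_vimageI[OF assms(2), of "\<lambda>d. p * d"] p by (simp add: vimage_def inj_on_def)
  have "(\<Sum>d\<in>A. moebius d * F d) = (\<Sum>d\<in>{d\<in>A. \<not> p dvd d}. moebius d * F d) + (\<Sum>d\<in>{d\<in>A. p dvd d}. moebius d * F d)"
    using assms(2) by (subst sum.union_disjoint[symmetric]) (auto intro!: sum.cong)
  also have "(\<Sum>d\<in>{d\<in>A. p dvd d}. moebius d * F d) = (\<Sum>d\<in>{d. p * d \<in> A}. moebius (p * d) * F (p * d))"
    by (rule sum.reindex_bij_witness[of _ "\<lambda>d. p * d" "\<lambda>d. d div p"]) (use p in auto)
  also have "\<dots> = (\<Sum>d\<in>{d. p * d \<in> A \<and> \<not> p dvd d}. moebius (p * d) * F (p * d))"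
    by (rule sum.mono_neutral_right) (use fin assms moebius_prime_mult_dvd in auto)
  also have "\<dots> = - (\<Sum>d\<in>{d. p * d \<in> A \<and> \<not> p dvd d}. moebius d * F (p * d))"
    unfolding sum_negf[symmetric] by (rule sum.cong) (use assms moebius_prime_mult in auto)
  finally show ?thesis by simp
qed

lemma sum_moebius_divisors:
  assumes "n > 0"
  shows "(\<Sum>d | d dvd n. moebius d) = (if n = 1 then 1 else 0)"
proof (cases "n = 1")
  case False
  then obtain p where p: "prime p" "p dvd n" using prime_factor_nat by blast
  \<comment> \<open>Both sums of the splitting run over the same \<open>d\<close>, so they
    cancel.\<close>
  have "{d. p * d \<in> {d. d dvd n} \<and> \<not> p dvd d} = {d \<in> {d. d dvd n}. \<not> p dvd d}"
    using p by (auto intro: divides_mult prime_imp_coprime dvd_mult_right)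
  then show ?thesis
    using sum_moebius_split_prime[OF p(1), of "{d. d dvd n}" "\<lambda>_. 1"] False assms by simp
qed auto

lemma sum_moebius_hyperbola:
  fixes F :: "nat \<Rightarrow> nat \<Rightarrow> real"
  shows "(\<Sum>n\<in>{n\<in>{1..Q}. P n}. \<Sum>d | d dvd n. F d (n div d)) =
    (\<Sum>d\<in>{1..Q}. \<Sum>e\<in>{e\<in>{1..Q div d}. P (d * e)}. F d e)"
proof -
  have "(\<Sum>n\<in>{n\<in>{1..Q}. P n}. \<Sum>d | d dvd n. F d (n div d)) =
     (\<Sum>(n, d)\<in>(SIGMA n:{n\<in>{1..Q}. P n}. {d. d dvd n}). F d (n div d))"
    by (rule sum.Sigma) auto
  also have "\<dots> = (\<Sum>(d, e)\<in>(SIGMA d:{1..Q}. {e\<in>{1..Q div d}. P (d * e)}). F d e)"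
  proof -
    have "0 < d" "d \<le> Q" if "d dvd n" "0 < n" "n \<le> Q" for d n
      using that dvd_imp_le[of d n] by (auto intro: dvd_pos_nat)
    then show ?thesis
      by (intro sum.reindex_bij_witness[of _ "\<lambda>(d, e). (d * e, d)" "\<lambda>(n, d). (d, n div d)"])
         (auto simp: div_le_mono less_eq_div_iff_mult_less_eq mult.commute Suc_le_eq)
  qed
  also have "\<dots> = (\<Sum>d\<in>{1..Q}. \<Sum>e\<in>{e\<in>{1..Q div d}. P (d * e)}. F d e)"
    by (rule sum.Sigma[symmetric]) auto
  finally show ?thesis .
qed

subsection \<open>The Fourier series of the sawtooth function\<close>

lemma sum_cos_Dirichlet_kernel:
  "2 * sin (t / 2) * (\<Sum>n=1..N. cos (real n * t)) = sin ((real N + 1 / 2) * t) - sin (t / 2)"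
proof (induction N)
  case (Suc N)
  have "2 * sin (t / 2) * cos (real (Suc N) * t) =
      sin ((real (Suc N) + 1 / 2) * t) - sin ((real N + 1 / 2) * t)"
    using sin_times_cos[of "t / 2" "real (Suc N) * t"]
      sin_minus[of "(real N + 1 / 2) * t"]
    by (simp add: algebra_simps add_divide_distrib)
  with Suc show ?case by (simp add: algebra_simps)
qed (simp add: algebra_simps)

text \<open>
  The function \<open>F\<close> in the proof is the error of the partial sum plus the main term of its expansion, which is
  found by integrating the Dirichlet kernel by parts from \<open>pi\<close>; its derivative is of order \<open>1 / N\<close> and \<open>F pi = 0\<close>.
\<close>

lemma sin_series_bound_aux:
  assumes t: "0 < t" "t \<le> pi" and N: "N \<ge> 1"
  shows "\<bar>(\<Sum>n=1..N. sin (real n * t) / real n) - (pi - t) / 2\<bar> \<le> 2 / (real N * (sin (t / 2))\<^sup>2)"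
proof -
  define s where "s = sin (t / 2)"
  define F where "F u = (\<Sum>n=1..N. sin (real n * u) / real n) - (pi - u) / 2
      + cos ((real N + 1 / 2) * u) / ((2 * real N + 1) * sin (u / 2))" for u
  define F' where "F' u = - cos ((real N + 1 / 2) * u) * cos (u / 2) / (2 * (2 * real N + 1) * (sin (u / 2))\<^sup>2)" for u
  have s: "0 < s" "s \<le> 1" using t by (auto simp: s_def intro!: sin_gt_zero)
  have sge: "s \<le> sin (u / 2)" if "t \<le> u" "u \<le> pi" for u
    unfolding s_def using that t by (intro sin_monotone_2pi_le) auto
  have deriv: "(F has_real_derivative F' u) (at u)" if u: "t \<le> u" "u \<le> pi" for u
  proof -
    have su: "sin (u / 2) > 0" using sge[OF u] s by linarith
    have "(F has_real_derivative ((\<Sum>n=1..N. cos (real n * u)) + 1 / 2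
       + (- sin ((real N + 1 / 2) * u) * (real N + 1 / 2) * ((2 * real N + 1) * sin (u / 2))
          - cos ((real N + 1 / 2) * u) * ((2 * real N + 1) * (cos (u / 2) / 2))) / ((2 * real N + 1) * sin (u / 2))\<^sup>2)) (at u)"
      unfolding F_def using su
      by (auto intro!: derivative_eq_intros sum.cong simp: power2_eq_square)
    moreover have "(\<Sum>n=1..N. cos (real n * u)) = (sin ((real N + 1 / 2) * u) - sin (u / 2)) / (2 * sin (u / 2))"
      using sum_cos_Dirichlet_kernel[of u N] su by (simp add: field_simps)
    moreover have "(A - S) / (2 * S) + 1 / 2 + (- A * (real N + 1 / 2) * ((2 * real N + 1) * S)
          - B * ((2 * real N + 1) * (C / 2))) / ((2 * real N + 1) * S)\<^sup>2 = - B * C / (2 * (2 * real N + 1) * S\<^sup>2)"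
      if "S > 0" for A B C S :: real
    proof -
      define M where "M = 2 * real N + 1"
      have M: "M > 0" "real N + 1 / 2 = M / 2" by (auto simp: M_def)
      show ?thesis unfolding M_def[symmetric] M(2) using that M(1)
        by (simp add: divide_simps power2_eq_square)
    qed
    ultimately show ?thesis unfolding F'_def using su by simp
  qed
  have F'_bound: "\<bar>F' u\<bar> \<le> 1 / (4 * real N * s\<^sup>2)" if u: "t \<le> u" "u \<le> pi" for u
  proof -
    have "\<bar>F' u\<bar> = \<bar>cos ((real N + 1 / 2) * u)\<bar> * \<bar>cos (u / 2)\<bar> / (2 * (2 * real N + 1) * (sin (u / 2))\<^sup>2)"
      by (simp add: F'_def abs_mult)
    also have "\<dots> \<le> 1 * 1 / (4 * real N * s\<^sup>2)"
    proof (rule frac_le)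
      have "s\<^sup>2 \<le> (sin (u / 2))\<^sup>2" using sge[OF u] s by (intro power_mono) auto
      then show "4 * real N * s\<^sup>2 \<le> 2 * (2 * real N + 1) * (sin (u / 2))\<^sup>2"
        by - (rule mult_mono, auto)
    qed (use s N in \<open>auto intro!: mult_le_one\<close>)
    finally show ?thesis by simp
  qed
  have "cos ((real N + 1 / 2) * pi) = 0"
  proof -
    have "(real N + 1 / 2) * pi = real N * pi + pi / 2" by (simp add: algebra_simps)
    then show ?thesis by (simp add: cos_add)
  qed
  then have Fpi: "F pi = 0" by (simp add: F_def sin_npi)
  have "\<bar>F t\<bar> \<le> pi / (4 * real N * s\<^sup>2)"
  proof (cases "t = pi")
    case True
    then show ?thesis using Fpi by simp
  next
    case False
    then obtain z where z: "t < z" "z < pi" "F pi - F t = (pi - t) * F' z"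
      using MVT2[of t pi F F'] deriv t by auto
    then have "F t = - ((pi - t) * F' z)" using Fpi by simp
    then have "\<bar>F t\<bar> = (pi - t) * \<bar>F' z\<bar>" using t by (simp add: abs_mult)
    also have "\<dots> \<le> pi * (1 / (4 * real N * s\<^sup>2))"
      using F'_bound[of z] z t by (intro mult_mono) auto
    finally show ?thesis by simp
  qed
  moreover have "\<bar>cos ((real N + 1 / 2) * t) / ((2 * real N + 1) * s)\<bar> \<le> 1 / (2 * real N * s\<^sup>2)"
  proof -
    have "s\<^sup>2 \<le> s" using s by (simp add: power2_eq_square mult_left_le)
    moreover have "\<bar>cos ((real N + 1 / 2) * t) / ((2 * real N + 1) * s)\<bar> = \<bar>cos ((real N + 1 / 2) * t)\<bar> / ((2 * real N + 1) * s)"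
      using s by (simp add: abs_mult)
    ultimately show ?thesis using s N by (auto intro!: frac_le mult_mono mult_pos_pos)
  qed
  moreover have "F t = (\<Sum>n=1..N. sin (real n * t) / real n) - (pi - t) / 2 + cos ((real N + 1 / 2) * t) / ((2 * real N + 1) * s)"
    by (simp add: F_def s_def)
  ultimately have "\<bar>(\<Sum>n=1..N. sin (real n * t) / real n) - (pi - t) / 2\<bar> \<le> pi / (4 * real N * s\<^sup>2) + 1 / (2 * real N * s\<^sup>2)"
    by linarith
  also have "\<dots> \<le> 4 / (4 * real N * s\<^sup>2) + 2 / (2 * real N * s\<^sup>2)"
    using pi_less_4 s N by (intro add_mono divide_right_mono) auto
  also have "\<dots> = 2 / (real N * s\<^sup>2)" by simp
  finally show ?thesis by (simp add: s_def)
qed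

text \<open>The reflection of \<open>t\<close> to \<open>2 * pi - t\<close> changes the sign of the
  partial sum and of \<open>(pi - t) / 2\<close> and preserves \<open>sin (t / 2)\<close>, which
  leaves the case \<open>t <= pi\<close>.\<close>

lemma sin_series_bound:
  assumes t: "0 < t" "t < 2 * pi" and N: "N \<ge> 1"
  shows "\<bar>(\<Sum>n=1..N. sin (real n * t) / real n) - (pi - t) / 2\<bar> \<le> 2 / (real N * (sin (t / 2))\<^sup>2)"
proof (cases "t \<le> pi")
  case True
  then show ?thesis using sin_series_bound_aux assms by blast
next
  case False
  have "sin (real n * (2 * pi - t)) = - sin (real n * t)" for n :: nat
  proof -
    have "sin (real n * (2 * pi - t)) = sin (- (real n * t) + 2 * real n * pi)" by (simp add: algebra_simps)
    also have "\<dots> = sin (- (real n * t))" 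
      using sin_add[of "- (real n * t)" "2 * real n * pi"] sin_2npi[of n] cos_2npi[of n] by (simp add: mult.assoc)
    finally show ?thesis by simp
  qed
  moreover have "sin ((2 * pi - t) / 2) = sin (t / 2)"
    using sin_pi_minus[of "t / 2"] by (simp add: diff_divide_distrib)
  ultimately have "\<bar>- (\<Sum>n=1..N. sin (real n * t) / real n) - - ((pi - t) / 2)\<bar> \<le> 2 / (real N * (sin (t / 2))\<^sup>2)"
    using sin_series_bound_aux[of "2 * pi - t" N] False t N by (simp add: sum_negf diff_divide_distrib)
  then show ?thesis by linarith
qed

lemma frac_int_div:
  assumes "g > 0"
  shows "frac (of_int a / real g) = of_int (a mod int g) / real g"
proof -
  have "real_of_int a = real_of_int (a div int g) * real g + of_int (a mod int g)"
    by (metis div_mult_mod_eq of_int_add of_int_mult of_int_of_nat_eq)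
  then have "of_int a / real g - of_int (a mod int g) / real g = of_int (a div int g)"
    using assms by (simp add: field_simps)
  moreover have "0 \<le> real_of_int (a mod int g)" "real_of_int (a mod int g) < real_of_int (int g)"
    using assms by (simp, simp only: of_int_less_iff) simp
  then have "0 \<le> of_int (a mod int g) / real g" "of_int (a mod int g) / real g < 1"
    using assms by auto
  ultimately show ?thesis by (simp add: frac_unique_iff)
qed

text \<open>The value 0 at integers is the one to which the sine series converges there.\<close>

definition saw0 :: "real \<Rightarrow> real" where
  "saw0 x = (if x \<in> \<int> then 0 else frac x - 1 / 2)"

text \<open>The series converges uniformly only away from the integers. For a fixed denominator
  \<open>g\<close>, a nonintegral \<open>a / g\<close> stays at distance at least
  \<open>1 / g\<close> from them, so \<open>sin (pi / g)\<close> is a lower bound for the sine that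
  is independent of \<open>a\<close>.\<close>

lemma saw0_Fourier_series:
  assumes "g \<ge> 1"
  shows "\<exists>C\<ge>0. \<forall>a::int. \<forall>N\<ge>1.
    \<bar>(\<Sum>n=1..N. sin (2 * pi * (real n * (of_int a / real g))) / real n) + pi * saw0 (of_int a / real g)\<bar> \<le> C / real N"
\<comment> \<open>For \<open>g = 1\<close> this witness is \<open>2 / 0 = 0\<close>, which is right:
  every \<open>a / g\<close> is then an integer and both terms vanish.\<close>
proof (intro exI[of _ "2 / (sin (pi / real g))\<^sup>2"] conjI allI impI)
  fix a :: int and N :: nat assume N: "N \<ge> 1"
  define x where "x = of_int a / real g"
  show "\<bar>(\<Sum>n=1..N. sin (2 * pi * (real n * (of_int a / real g))) / real n) + pi * saw0 (of_int a / real g)\<bar>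
      \<le> 2 / (sin (pi / real g))\<^sup>2 / real N"
  proof (cases "x \<in> \<int>")
    case True
    then have "sin (2 * pi * (real n * x)) = 0" for n
      using sin_integer_2pi[of "real n * x"] by simp
    then show ?thesis using True by (simp add: x_def[symmetric] saw0_def)
  next
    case False
    define t where "t = 2 * pi * frac x"
    have "frac x > 0" "frac x < 1" using False frac_gt_0_iff frac_lt_1 by auto
    have frx: "frac x = of_int (a mod int g) / real g"
      unfolding x_def using assms by (intro frac_int_div) auto
    have "a mod int g \<noteq> 0" using \<open>frac x > 0\<close> frx by auto
    moreover have "0 \<le> a mod int g" "a mod int g < int g" using assms by auto
    ultimately have ag: "1 \<le> a mod int g" "a mod int g \<le> int g - 1" by auto
    have t: "0 < t" "t < 2 * pi" using \<open>frac x > 0\<close> \<open>frac x < 1\<close> by (auto simp: t_def)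
    have sinn: "sin (2 * pi * (real n * x)) = sin (real n * t)" for n
    proof -
      have "2 * pi * (real n * x) = real n * t + 2 * pi * of_int (int n * floor x)"
        by (simp add: t_def frac_def algebra_simps)
      then show ?thesis using sin_integer_2pi[of "of_int (int n * floor x)"] cos_integer_2pi[of "of_int (int n * floor x)"]
        by (simp only: sin_add) simp
    qed
    have "sin (pi / real g) \<le> sin (t / 2)"
    proof (cases "t / 2 \<le> pi / 2")
      case True
      have "pi / real g \<le> t / 2" unfolding t_def frx using ag assms by (simp add: divide_simps)
      then show ?thesis using True assms by (intro sin_monotone_2pi_le) (auto intro: order_trans[of _ 0])
    next
      case False
      have "pi - t / 2 = pi * (1 - frac x)" by (simp add: t_def algebra_simps)
      also have "1 - frac x = of_int (int g - a mod int g) / real g" unfolding frx using assms by (simp add: field_simps)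
      finally have "pi - t / 2 = pi * (of_int (int g - a mod int g) / real g)" .
      moreover have "1 \<le> real_of_int (int g - a mod int g)" using ag by linarith
      ultimately have "pi * (1 / real g) \<le> pi - t / 2"
        by (simp only:) (intro mult_left_mono divide_right_mono; simp)
      then have "pi / real g \<le> pi - t / 2" by simp
      then have "sin (pi / real g) \<le> sin (pi - t / 2)"
        using False assms by (intro sin_monotone_2pi_le) (auto intro: order_trans[of _ 0])
      then show ?thesis by simp
    qed
    moreover have "sin (pi / real g) > 0"
    proof -
      have "g > 1" using ag by linarith
      then show ?thesis by (intro sin_gt_zero) (auto simp: divide_simps)
    qed
    ultimately have "2 / (real N * (sin (t / 2))\<^sup>2) \<le> 2 / (real N * (sin (pi / real g))\<^sup>2)"
      using N by (intro divide_left_mono mult_left_mono power_mono mult_pos_pos zero_less_power) auto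
    moreover have "(pi - t) / 2 = - (pi * saw0 x)" using False by (simp add: saw0_def t_def field_simps)
    ultimately show ?thesis using sin_series_bound[OF t N] unfolding x_def[symmetric] sinn by (simp add: mult.commute)
  qed
qed auto

subsection \<open>Bounded sums of the Moebius function\<close>

lemma sum_moebius_hyperbola_all:
  fixes F :: "nat \<Rightarrow> nat \<Rightarrow> real"
  shows "(\<Sum>n\<in>{1..Q}. \<Sum>d | d dvd n. F d (n div d)) = (\<Sum>d\<in>{1..Q}. \<Sum>e\<in>{1..Q div d}. F d e)"
  using sum_moebius_hyperbola[where P = "\<lambda>_. True"] by (simp only: simp_thms Collect_mem_eq)

text \<open>Inversion gives 1 for the sum of \<open>moebius d * real (Y div d)\<close>. Replacing
  \<open>Y div d\<close> by \<open>Y / d\<close> costs at most 1 for each \<open>d\<close>, so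
  \<open>Y\<close> times the sum is at most \<open>Y + 1\<close>.\<close>

lemma moebius_sum_bounded: "\<bar>\<Sum>d=1..Y. moebius d / real d\<bar> \<le> 2"
proof (cases "Y = 0")
  case False
  have "(\<Sum>d=1..Y. moebius d * real (Y div d)) = (\<Sum>d\<in>{1..Y}. \<Sum>e\<in>{1..Y div d}. moebius d)"
    by (simp add: mult.commute)
  also have "\<dots> = (\<Sum>n\<in>{1..Y}. \<Sum>d | d dvd n. moebius d)"
    by (rule sum_moebius_hyperbola_all[symmetric])
  also have "\<dots> = (\<Sum>n=1..Y. if n = 1 then 1 else 0)"
    by (intro sum.cong) (auto simp: sum_moebius_divisors simp del: One_nat_def)
  also have "\<dots> = 1" using False by simp
  finally have 1: "(\<Sum>d=1..Y. moebius d * real (Y div d)) = 1" .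
  have "real Y * (\<Sum>d=1..Y. moebius d / real d) = (\<Sum>d=1..Y. moebius d * (real Y / real d - real (Y div d))) + 1"
    unfolding 1[symmetric] sum_distrib_left sum.distrib[symmetric]
    by (intro sum.cong) (auto simp: field_simps)
  also have "\<bar>\<dots>\<bar> \<le> (\<Sum>d=1..Y. 1) + 1"
  proof -
    have "\<bar>moebius d * (real Y / real d - real (Y div d))\<bar> \<le> 1" for d
    proof -
      have "0 \<le> real Y / real d - real (Y div d)" "real Y / real d - real (Y div d) \<le> 1"
        using floor_divide_of_nat_eq[of Y d, where 'a = real] of_int_floor_le[of "real Y / real d"] 
          real_of_int_floor_add_one_ge[of "real Y / real d"] by auto
      then show ?thesis using abs_moebius_le[of d] by (auto simp: abs_mult intro: mult_le_one)
    qed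
    then have "\<bar>\<Sum>d=1..Y. moebius d * (real Y / real d - real (Y div d))\<bar> \<le> (\<Sum>d=1..Y. 1)"
      by (intro order_trans[OF sum_abs] sum_mono) auto
    then show ?thesis by linarith
  qed
  also have "\<dots> \<le> real Y * 2" using False by simp
  finally show ?thesis using False by (simp add: abs_mult)
qed simp

text \<open>
  The sawtooth at \<open>d * x\<close> is a sine series in the multiples of \<open>d * x\<close>, so that Moebius inversion collapses
  the truncated double sum to its first term \<open>sin (2 * pi * x)\<close>.
\<close>

lemma moebius_saw0_bounded:
  assumes "g \<ge> 1"
  shows "\<exists>K. \<forall>(a::int) Y. \<bar>\<Sum>d=1..Y. moebius d / real d * saw0 (real d * (of_int a / real g))\<bar> \<le> K"
proof -
  obtain C where C: "C \<ge> 0" "\<And>a N. N \<ge> 1 \<Longrightarrow>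
    \<bar>(\<Sum>n=1..N. sin (2 * pi * (real n * (of_int a / real g))) / real n) + pi * saw0 (of_int a / real g)\<bar> \<le> C / real N"
    using saw0_Fourier_series[OF assms] by blast
  show ?thesis
  proof (intro exI[of _ "2 * C + 1"] allI)
    fix a :: int and Y :: nat
    define x where "x = real_of_int a / real g"
    \<comment> \<open>The error of the series at \<open>d * x\<close>, cut off at
      \<open>Y div d\<close> so that the products \<open>d * n\<close> are exactly the numbers up to
      \<open>Y\<close> and inversion applies without remainder.\<close>
    define E where "E d = (\<Sum>n=1..Y div d. sin (2 * pi * (real (d * n) * x)) / real n) + pi * saw0 (real d * x)" for d
    \<comment> \<open>Cutting off at \<open>Y div d >= Y / (2 * d)\<close> leaves an error of at
      most \<open>2 * C * d / Y\<close>. The weight \<open>1 / d\<close> removes the factor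
      \<open>d\<close>, and the \<open>Y\<close> terms together stay below
      \<open>2 * C\<close>.\<close>
    have E: "\<bar>moebius d / real d * E d\<bar> \<le> 2 * C / real Y" if d: "d \<in> {1..Y}" for d
    proof -
      have d': "Y div d \<ge> 1" "d > 0" using d by (auto simp: Suc_le_eq div_greater_zero_iff)
      have "Y < d * (Y div d) + d" using d' dividend_less_times_div[of d Y] by simp
      also have "\<dots> \<le> d * (Y div d) + d * (Y div d)" using d' by simp
      finally have "real Y \<le> real (2 * d * (Y div d))" by linarith
      then have Y: "real Y \<le> 2 * real d * real (Y div d)" by simp
      have "\<bar>E d\<bar> \<le> C / real (Y div d)"
        using C(2)[of "Y div d" "int d * a"] d' by (simp add: E_def x_def mult_ac)
      also have "\<dots> \<le> real d * (2 * C / real Y)"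
        using Y d' d C(1) mult_left_mono[OF Y C(1)] by (simp add: field_simps)
      finally have "\<bar>E d\<bar> \<le> real d * (2 * C / real Y)" .
      then have "\<bar>moebius d\<bar> * \<bar>E d\<bar> \<le> 1 * (real d * (2 * C / real Y))"
        using abs_moebius_le by (intro mult_mono) auto
      then show ?thesis using d' by (simp add: abs_mult field_simps)
    qed
    have "(\<Sum>d=1..Y. moebius d / real d * (\<Sum>n=1..Y div d. sin (2 * pi * (real (d * n) * x)) / real n)) =
       (\<Sum>d\<in>{1..Y}. \<Sum>n\<in>{1..Y div d}. moebius d * (sin (2 * pi * (real (d * n) * x)) / real (d * n)))"
      by (simp add: sum_distrib_left)
    also have "\<dots> = (\<Sum>N\<in>{1..Y}. \<Sum>d | d dvd N. moebius d * (sin (2 * pi * (real (d * (N div d)) * x)) / real (d * (N div d))))"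
      by (rule sum_moebius_hyperbola_all[symmetric])
    also have "\<dots> = (\<Sum>N=1..Y. (if N = 1 then sin (2 * pi * x) else 0))"
    proof (intro sum.cong refl)
      fix N assume N: "N \<in> {1..Y}"
      have "(\<Sum>d | d dvd N. moebius d * (sin (2 * pi * (real (d * (N div d)) * x)) / real (d * (N div d)))) =
        (\<Sum>d | d dvd N. moebius d) * (sin (2 * pi * (real N * x)) / real N)"
        unfolding sum_distrib_right by (intro sum.cong) auto
      then show "(\<Sum>d | d dvd N. moebius d * (sin (2 * pi * (real (d * (N div d)) * x)) / real (d * (N div d)))) =
        (if N = 1 then sin (2 * pi * x) else 0)"
        using N sum_moebius_divisors[of N] by simp
    qed
    also have "\<bar>\<dots>\<bar> \<le> 1" by (cases "Y = 0") (auto simp: abs_sin_le_one)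
    finally have 1: "\<bar>\<Sum>d=1..Y. moebius d / real d * (\<Sum>n=1..Y div d. sin (2 * pi * (real (d * n) * x)) / real n)\<bar> \<le> 1" .
    have "\<bar>\<Sum>d=1..Y. moebius d / real d * E d\<bar> \<le> (\<Sum>d=1..Y. 2 * C / real Y)"
      using E by (intro order_trans[OF sum_abs] sum_mono) auto
    also have "\<dots> \<le> 2 * C" using C by (cases "Y = 0") auto
    finally have 2: "\<bar>\<Sum>d=1..Y. moebius d / real d * E d\<bar> \<le> 2 * C" .
    have "(\<Sum>d=1..Y. moebius d / real d * E d) = 
      (\<Sum>d=1..Y. moebius d / real d * (\<Sum>n=1..Y div d. sin (2 * pi * (real (d * n) * x)) / real n))
      + pi * (\<Sum>d=1..Y. moebius d / real d * saw0 (real d * x))"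
      by (simp add: E_def distrib_left sum.distrib sum_distrib_left mult_ac)
    then have "pi * \<bar>\<Sum>d=1..Y. moebius d / real d * saw0 (real d * x)\<bar> \<le> 2 * C + 1"
      using 1 2 by (simp add: abs_mult[symmetric, of pi, simplified])
    moreover have "1 * \<bar>\<Sum>d=1..Y. moebius d / real d * saw0 (real d * x)\<bar> \<le> pi * \<bar>\<Sum>d=1..Y. moebius d / real d * saw0 (real d * x)\<bar>"
      using pi_gt3 by (intro mult_right_mono) auto
    ultimately show "\<bar>\<Sum>d=1..Y. moebius d / real d * saw0 (real d * (real_of_int a / real g))\<bar> \<le> 2 * C + 1"
      by (simp add: x_def)
  qed
qed

text \<open>
  Writing \<open>T\<close> for the sifted sum, splitting off the multiples of a new prime \<open>p\<close> gives
  \<open>T (insert p S) Y h = T S Y h + T (insert p S) (Y div p) (\<lambda>d. h (p * d)) / p\<close>, which costs a factor 2 per prime.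
\<close>

lemma moebius_sum_sifted_bounded:
  assumes "finite S" "\<And>p. p \<in> S \<Longrightarrow> prime p"
    and closed: "\<And>h p. h \<in> H \<Longrightarrow> p \<in> S \<Longrightarrow> (\<lambda>d. h (p * d)) \<in> H"
    and bound: "\<And>h Y. h \<in> H \<Longrightarrow> \<bar>\<Sum>d=1..Y. moebius d / real d * h d\<bar> \<le> K"
    and "h \<in> H"
  shows "\<bar>\<Sum>d | d \<in> {1..Y} \<and> (\<forall>p\<in>S. \<not> p dvd d). moebius d / real d * h d\<bar> \<le> 2 ^ card S * K"
  using assms(1,2,3,5)
proof (induction S arbitrary: h Y rule: finite_induct)
  case empty
  have "{d. d \<in> {1..Y} \<and> (\<forall>p\<in>{}. \<not> p dvd d)} = {1..Y}" by auto
  then show ?case using bound[OF empty.prems(3)] by (simp only: card.empty power_0 mult_1)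
next
  case (insert p S)
  define T where "T S' Y h = (\<Sum>d | d \<in> {1..Y} \<and> (\<forall>p\<in>S'. \<not> p dvd d). moebius d / real d * h d)" 
    for S' and Y :: nat and h :: "nat \<Rightarrow> real"
  have p: "prime p" "p \<ge> 2" using insert by (auto simp: prime_ge_2_nat)
  have IH: "\<bar>T S Y h\<bar> \<le> 2 ^ card S * K" if "h \<in> H" for Y h
    unfolding T_def using insert that by auto
  have rec: "T (insert p S) Y h = T S Y h + T (insert p S) (Y div p) (\<lambda>d. h (p * d)) / real p" for Y h
  proof -
    let ?A = "{d. d \<in> {1..Y} \<and> (\<forall>p\<in>S. \<not> p dvd d)}"
    have eq1: "{d \<in> ?A. \<not> p dvd d} = {d. d \<in> {1..Y} \<and> (\<forall>p\<in>insert p S. \<not> p dvd d)}" by auto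
    have *: "r dvd p * d \<longleftrightarrow> r dvd d" if "r \<in> S" for r d
    proof -
      have "prime r" "r \<noteq> p" using that insert by auto
      then show ?thesis using p primes_dvd_imp_eq prime_dvd_mult_iff by metis
    qed
    have eq2: "{d. p * d \<in> ?A \<and> \<not> p dvd d} = {d. d \<in> {1..Y div p} \<and> (\<forall>p\<in>insert p S. \<not> p dvd d)}"
      using p * by (auto simp: less_eq_div_iff_mult_less_eq mult.commute Suc_le_eq)
    have "T S Y h = (\<Sum>d\<in>?A. moebius d * (h d / real d))" by (simp add: T_def)
    also have "\<dots> = (\<Sum>d\<in>{d \<in> ?A. \<not> p dvd d}. moebius d * (h d / real d))
       - (\<Sum>d\<in>{d. p * d \<in> ?A \<and> \<not> p dvd d}. moebius d * (h (p * d) / real (p * d)))"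
      by (rule sum_moebius_split_prime) (use p in auto)
    also have "\<dots> = T (insert p S) Y h - T (insert p S) (Y div p) (\<lambda>d. h (p * d)) / real p"
      unfolding eq1 eq2 T_def by (simp add: sum_divide_distrib mult_ac)
    finally show ?thesis by simp
  qed
  \<comment> \<open>The recursive term is divided by \<open>p >= 2\<close>, so with
    \<open>B = 2 ^ card S * K\<close> the bound reproduces itself:
    \<open>B + 2 * B / 2 = 2 * B\<close>.\<close>
  have "\<bar>T (insert p S) Y h\<bar> \<le> 2 * (2 ^ card S * K)" if "h \<in> H" for Y h
    using that
  proof (induction Y arbitrary: h rule: less_induct)
    case (less Y)
    show ?case
    proof (cases "Y = 0")
      case True
      then show ?thesis using IH[OF less.prems, of Y] by (simp add: T_def)
    next
      case False
      then have "Y div p < Y" using p by simp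
      then have "\<bar>T (insert p S) (Y div p) (\<lambda>d. h (p * d))\<bar> \<le> 2 * (2 ^ card S * K)"
        using less insert by simp
      then have "\<bar>T (insert p S) (Y div p) (\<lambda>d. h (p * d))\<bar> / real p \<le> 2 * (2 ^ card S * K) / 2"
        using p by (intro frac_le) auto
      moreover have "\<bar>T (insert p S) (Y div p) (\<lambda>d. h (p * d)) / real p\<bar> = \<bar>T (insert p S) (Y div p) (\<lambda>d. h (p * d))\<bar> / real p"
        by simp
      ultimately show ?thesis unfolding rec[of Y h] using IH[OF less.prems, of Y] by linarith
    qed
  qed
  moreover have "card (insert p S) = Suc (card S)" using insert by simp
  ultimately show ?case using insert.prems(3) by (simp only: T_def power_Suc mult.assoc)
qed

lemma coprime_iff_prime_factors:
  assumes "m > (0::nat)"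
  shows "coprime d m \<longleftrightarrow> (\<forall>p\<in>prime_factors m. \<not> p dvd d)"
proof
  assume cop: "coprime d m"
  show "\<forall>p\<in>prime_factors m. \<not> p dvd d"
  proof (intro ballI notI)
    fix p assume "p \<in> prime_factors m" "p dvd d"
    then have "prime p" "p dvd m" by (auto simp: in_prime_factors_iff)
    moreover have "is_unit p" by (rule coprime_common_divisor[OF cop]) fact+
    ultimately show False using not_prime_unit by blast
  qed
next
  assume *: "\<forall>p\<in>prime_factors m. \<not> p dvd d"
  show "coprime d m"
  proof (rule ccontr)
    assume "\<not> coprime d m"
    then have "gcd d m \<noteq> 1" unfolding coprime_iff_gcd_eq_1 .
    then obtain p where "prime p" "p dvd gcd d m" using prime_factor_nat by blast
    then have "prime p" "p dvd d" "p dvd m" by auto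
    then show False using * assms by (auto simp: in_prime_factors_iff)
  qed
qed

section \<open>Exchanging \<open>d\<close> for its inverse modulo \<open>m\<close>\<close>

lemma sum_units_mult:
  fixes m :: nat and h :: "int \<Rightarrow> real"
  assumes "m \<ge> 1" "coprime u (int m)" and per: "\<And>x y. [x = y] (mod int m) \<Longrightarrow> h x = h y"
  shows "(\<Sum>b | b \<in> {0..<int m} \<and> coprime b (int m). h (b * u)) = (\<Sum>b | b \<in> {0..<int m} \<and> coprime b (int m). h b)"
proof -
  let ?U = "{b. b \<in> {0..<int m} \<and> coprime b (int m)}"
  have fin: "finite ?U" by (rule finite_subset[of _ "{0..<int m}"]) auto
  have inj: "inj_on (\<lambda>b. b * u mod int m) ?U"
  proof (rule inj_onI)
    fix x y assume xy: "x \<in> ?U" "y \<in> ?U" "x * u mod int m = y * u mod int m"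
    then have "[x * u = y * u] (mod int m)" by (simp add: cong_iff_mod_eq)
    then have "[x = y] (mod int m)" using assms(2) cong_mult_rcancel[of u "int m" x y] by (simp add: coprime_commute)
    then show "x = y" using xy by (simp add: cong_iff_mod_eq)
  qed
  have "(\<lambda>b. b * u mod int m) ` ?U \<subseteq> ?U" using assms by (auto simp: coprime_mult_left_iff)
  then have "(\<lambda>b. b * u mod int m) ` ?U = ?U"
    using fin inj by (meson card_image card_subset_eq)
  then have "(\<Sum>b\<in>?U. h b) = (\<Sum>b\<in>?U. h (b * u mod int m))"
    using sum.reindex[OF inj, of h] by (simp add: o_def)
  also have "\<dots> = (\<Sum>b\<in>?U. h (b * u))" by (intro sum.cong refl per) (simp add: cong_iff_mod_eq)
  finally show ?thesis by simp
qed

text \<open>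
  Expand the square of either sum and shift \<open>b\<close> by \<open>d * d'\<close>: the mean square over the units \<open>b\<close> of the sums
  with \<open>b * d\<close> equals that of the sums with \<open>b\<close> times the inverse of \<open>d\<close>. This replaces a proof that
  \<open>L(1, \<chi>) \<noteq> 0\<close>.
\<close>

lemma sum_inverse_twist_bound:
  fixes m :: nat and f :: "int \<Rightarrow> real" and w :: "nat \<Rightarrow> real"
  assumes m: "m \<ge> 1" and D: "finite D" "\<And>d. d \<in> D \<Longrightarrow> [int d * iv d = 1] (mod int m)"
    and per: "\<And>x y. [x = y] (mod int m) \<Longrightarrow> f x = f y"
    and bound: "\<And>b. coprime b (int m) \<Longrightarrow> \<bar>\<Sum>d\<in>D. w d * f (b * int d)\<bar> \<le> K"
    and c: "coprime c (int m)"
  shows "\<bar>\<Sum>d\<in>D. w d * f (c * iv d)\<bar> \<le> real m * K"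
proof -
  define U where "U = {b. b \<in> {0..<int m} \<and> coprime b (int m)}"
  define A where "A b = (\<Sum>d\<in>D. w d * f (b * int d))" for b
  define B where "B b = (\<Sum>d\<in>D. w d * f (b * iv d))" for b
  have Dc: "coprime (int d) (int m)" if "d \<in> D" for d
    using D(2)[OF that] coprime_iff_invertible_int by blast
  have finU: "finite U" unfolding U_def by (rule finite_subset[of _ "{0..<int m}"]) auto
  have sq: "(\<Sum>b\<in>U. (\<Sum>d\<in>D. w d * f (b * v d))\<^sup>2) = 
     (\<Sum>d\<in>D. \<Sum>d'\<in>D. w d * w d' * (\<Sum>b\<in>U. f (b * v d) * f (b * v d')))" for v
  proof -
    have "(\<Sum>b\<in>U. (\<Sum>d\<in>D. w d * f (b * v d))\<^sup>2) = (\<Sum>b\<in>U. \<Sum>d\<in>D. \<Sum>d'\<in>D. w d * w d' * (f (b * v d) * f (b * v d')))"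
      by (simp add: power2_eq_square sum_product mult_ac)
    also have "\<dots> = (\<Sum>d\<in>D. \<Sum>b\<in>U. \<Sum>d'\<in>D. w d * w d' * (f (b * v d) * f (b * v d')))"
      by (rule sum.swap)
    also have "\<dots> = (\<Sum>d\<in>D. \<Sum>d'\<in>D. \<Sum>b\<in>U. w d * w d' * (f (b * v d) * f (b * v d')))"
      by (intro sum.cong refl sum.swap)
    finally show ?thesis by (simp add: sum_distrib_left)
  qed
  have "(\<Sum>b\<in>U. f (b * iv d) * f (b * iv d')) = (\<Sum>b\<in>U. f (b * int d) * f (b * int d'))"
    if d: "d \<in> D" "d' \<in> D" for d d'
  proof -
    have "(\<Sum>b\<in>U. f (b * iv d) * f (b * iv d')) = (\<Sum>b\<in>U. f (b * (int d * int d') * iv d) * f (b * (int d * int d') * iv d'))"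
      unfolding U_def
      by (rule sum_units_mult[symmetric, where h = "\<lambda>b. f (b * iv d) * f (b * iv d')"])
         (use m Dc d in \<open>auto intro!: arg_cong2[of _ _ _ _ "(*)"] per cong_mult\<close>)
    also have "\<dots> = (\<Sum>b\<in>U. f (b * int d') * f (b * int d))"
    proof (intro sum.cong refl arg_cong2[of _ _ _ _ "(*)"] per)
      fix b
      have "[b * int d' * (int d * iv d) = b * int d' * 1] (mod int m)" 
        using D(2)[OF d(1)] by (intro cong_mult) auto
      then show "[b * (int d * int d') * iv d = b * int d'] (mod int m)" by (simp add: mult_ac)
      have "[b * int d * (int d' * iv d') = b * int d * 1] (mod int m)" 
        using D(2)[OF d(2)] by (intro cong_mult) auto
      then show "[b * (int d * int d') * iv d' = b * int d] (mod int m)" by (simp add: mult_ac)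
    qed
    finally show ?thesis by (simp add: mult.commute)
  qed
  then have AB: "(\<Sum>b\<in>U. (B b)\<^sup>2) = (\<Sum>b\<in>U. (A b)\<^sup>2)"
    unfolding A_def B_def sq by simp
  have K: "K \<ge> 0" using bound[OF c] by linarith
  have cm: "c mod int m \<in> U" using c m by (auto simp: U_def)
  have Bc: "B (c mod int m) = B c" unfolding B_def
    by (intro sum.cong refl arg_cong2[of _ _ _ _ "(*)"] per cong_mult) (auto simp: cong_iff_mod_eq)
  \<comment> \<open>A single square is at most the sum over all units, which has at most
    \<open>m\<close> terms. Enlarging \<open>m\<close> to \<open>m ^ 2\<close> makes the right side
    a square.\<close>
  have "(B c)\<^sup>2 \<le> (\<Sum>b\<in>U. (B b)\<^sup>2)"
    using member_le_sum[OF cm, of "\<lambda>b. (B b)\<^sup>2"] finU Bc by simp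
  also have "\<dots> = (\<Sum>b\<in>U. (A b)\<^sup>2)" by (rule AB)
  also have "\<dots> \<le> (\<Sum>b\<in>U. K\<^sup>2)"
  proof (intro sum_mono)
    fix b assume "b \<in> U"
    then have "\<bar>A b\<bar> \<le> \<bar>K\<bar>" using bound[of b] K by (auto simp: A_def U_def)
    then show "(A b)\<^sup>2 \<le> K\<^sup>2" by (simp add: abs_le_square_iff)
  qed
  also have "\<dots> \<le> (\<Sum>b\<in>{0..<int m}. K\<^sup>2)" unfolding U_def by (intro sum_mono2) auto
  also have "\<dots> = real m * K\<^sup>2" by simp
  also have "\<dots> \<le> (real m)\<^sup>2 * K\<^sup>2" using m by (intro mult_right_mono) (auto simp: power2_eq_square)
  also have "\<dots> = (real m * K)\<^sup>2" by (simp add: power_mult_distrib)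
  finally have "\<bar>B c\<bar> \<le> \<bar>real m * K\<bar>" by (simp only: abs_le_square_iff)
  then show ?thesis using K by (simp add: B_def)
qed

definition modinv :: "nat \<Rightarrow> nat \<Rightarrow> int" where
  "modinv m d = (SOME x. [int d * x = 1] (mod int m))"

lemma modinv:
  assumes "coprime d m"
  shows "[int d * modinv m d = 1] (mod int m)"
proof -
  have "\<exists>x. [int d * x = 1] (mod int m)" using assms coprime_iff_invertible_int[of "int d" "int m"] by simp
  then show ?thesis unfolding modinv_def by (rule someI_ex)
qed

lemma frac_int_cong:
  assumes "g dvd m" "[x = y] (mod int m)" "g > 0"
  shows "frac (of_int (a * x) / real g) = frac (of_int (a * y) / real g)"
proof -
  have "[a * x = a * y] (mod int g)"
    by (rule cong_scalar_left, rule cong_dvd_modulus[OF assms(2)]) (use assms(1) in simp)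
  then show ?thesis unfolding frac_int_div[OF assms(3)] by (simp add: cong_iff_mod_eq)
qed

text \<open>The Fourier argument bounds the sums of \<open>saw0\<close> at multiples
  \<open>d * x\<close>, sifting by the primes of \<open>m\<close> restricts \<open>d\<close> to
  units, and \<open>sum_inverse_twist_bound\<close> then replaces \<open>d\<close> by its
  inverse.\<close>

lemma moebius_frac_inv_bounded:
  assumes m: "m \<ge> 1"
  shows "\<exists>K\<ge>0. \<forall>Y g (a::int) c. g dvd m \<longrightarrow> coprime a (int g) \<longrightarrow> coprime c (int m) \<longrightarrow>
    \<bar>\<Sum>d | d \<in> {1..Y} \<and> coprime d m. moebius d / real d * (frac (of_int (a * (c * modinv m d)) / real g) - 1 / 2)\<bar> \<le> K"
proof -
  have "\<exists>K. \<forall>a::int. \<forall>Y. \<bar>\<Sum>d=1..Y. moebius d / real d * saw0 (real d * (of_int a / real g))\<bar> \<le> K" if "g dvd m" for g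
    using that m by (intro moebius_saw0_bounded) (auto intro: Nat.gr0I)
  then obtain KK where KK: "\<And>g a Y. g dvd m \<Longrightarrow> \<bar>\<Sum>d=1..Y. moebius d / real d * saw0 (real d * (of_int a / real g))\<bar> \<le> KK g"
    by metis
  have KK0: "KK g \<ge> 0" if "g dvd m" for g using KK[OF that, of 0 0] by simp
  \<comment> \<open>Summing over the divisors of \<open>m\<close> makes the bound uniform in
    \<open>g\<close>; the 2 is the bound of \<open>moebius_sum_bounded\<close>, used when
    \<open>g = 1\<close>.\<close>
  define K0 where "K0 = 2 + (\<Sum>g | g dvd m. KK g)"
  have K0: "KK g \<le> K0" if "g dvd m" for g
    using member_le_sum[of g "{g. g dvd m}" KK] that KK0 m unfolding K0_def by auto
  have K02: "2 \<le> K0" unfolding K0_def using sum_nonneg[of "{g. g dvd m}" KK] KK0 by simp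
  define n where "n = card (prime_factors m)"
  have cf: "coprime d m \<longleftrightarrow> (\<forall>p\<in>prime_factors m. \<not> p dvd d)" for d
    using m by (intro coprime_iff_prime_factors) auto
  have coprime_bound: "\<bar>\<Sum>d | d \<in> {1..Y} \<and> coprime d m. moebius d / real d * (frac (of_int (a * (b * int d)) / real g) - 1 / 2)\<bar> \<le> 2 ^ n * K0"
    if g: "g dvd m" "coprime a (int g)" and b: "coprime b (int m)" for Y g a b
  \<comment> \<open>For \<open>g = 1\<close> the fractional parts are 0 and the summand is the
    constant -1/2, where \<open>saw0\<close> would give 0. For \<open>g > 1\<close> coprimality
    keeps the arguments off the integers, and there \<open>saw0\<close> is \<open>frac\<close> minus
    1/2.\<close>
  proof (cases "g = 1")
    case True
    have "\<bar>\<Sum>d | d \<in> {1..Y} \<and> (\<forall>p\<in>prime_factors m. \<not> p dvd d). moebius d / real d * (-1/2)\<bar> \<le> 2 ^ n * K0"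
      unfolding n_def
    proof (rule moebius_sum_sifted_bounded[where H = "{\<lambda>_. -1/2}"])
      show "\<bar>\<Sum>d = 1..Y. moebius d / real d * h d\<bar> \<le> K0" if "h \<in> {\<lambda>_. -1/2}" for h Y
      proof -
        have "(\<Sum>d = 1..Y. moebius d / real d * h d) = (\<Sum>d = 1..Y. moebius d / real d) * (-1/2)"
          using that by (simp only: sum_distrib_right singleton_iff)
        then show ?thesis using moebius_sum_bounded[of Y] K02 by linarith
      qed
    qed auto
    moreover have "frac (of_int (a * (b * int d)) / real g) - 1 / 2 = -1/2" for d
      using True by (simp only: of_nat_1 div_by_1 frac_of_int)
    ultimately show ?thesis by (simp only: cf)
  next
    case False
    have g0: "g > 0" using g m by (auto intro: Nat.gr0I)
    have "\<bar>\<Sum>d | d \<in> {1..Y} \<and> (\<forall>p\<in>prime_factors m. \<not> p dvd d). moebius d / real d * saw0 (real d * (of_int (a * b) / real g))\<bar> \<le> 2 ^ n * K0"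
      unfolding n_def
    proof (rule moebius_sum_sifted_bounded[where H = "range (\<lambda>(a::int) d. saw0 (real d * (of_int a / real g)))"])
      show "(\<lambda>d. h (p * d)) \<in> range (\<lambda>(a::int) d. saw0 (real d * (of_int a / real g)))"
        if "h \<in> range (\<lambda>(a::int) d. saw0 (real d * (of_int a / real g)))" for h p
      proof -
        obtain a :: int where "h = (\<lambda>d. saw0 (real d * (of_int a / real g)))" using \<open>h \<in> _\<close> by blast
        then have "(\<lambda>d. h (p * d)) = (\<lambda>d. saw0 (real d * (of_int (int p * a) / real g)))"
          by (simp add: mult_ac)
        then show ?thesis by blast
      qed
      show "\<bar>\<Sum>d = 1..Y. moebius d / real d * h d\<bar> \<le> K0"
        if "h \<in> range (\<lambda>(a::int) d. saw0 (real d * (of_int a / real g)))" for h Y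
      proof -
        obtain a :: int where "h = (\<lambda>d. saw0 (real d * (of_int a / real g)))" using \<open>h \<in> _\<close> by blast
        then show ?thesis using KK[OF g(1), of a Y] K0[OF g(1)] by (simp only:)
      qed
      show "(\<lambda>d. saw0 (real d * (of_int (a * b) / real g))) \<in> range (\<lambda>(a::int) d. saw0 (real d * (of_int a / real g)))"
        by (rule rangeI)
    qed auto
    moreover have "saw0 (real d * (of_int (a * b) / real g)) = frac (of_int (a * (b * int d)) / real g) - 1 / 2"
      if "coprime d m" for d
    proof -
      have "coprime (a * (b * int d)) (int g)"
      proof -
        have "coprime b (int g)"
          by (rule coprime_divisors[OF dvd_refl _ b]) (use g(1) in simp)
        moreover have "coprime (int d) (int g)"
          by (rule coprime_divisors[OF dvd_refl, of "int g" "int m"]) (use g(1) that in simp_all)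
        ultimately show ?thesis using g(2) by simp
      qed
      moreover have "\<not> is_unit (int g)" using False by simp
      ultimately have nd: "\<not> int g dvd a * (b * int d)" using coprime_common_divisor dvd_refl by blast
      have "of_int (a * (b * int d)) / real g \<notin> \<int>"
      proof
        assume "of_int (a * (b * int d)) / real g \<in> \<int>"
        then have "frac (of_int (a * (b * int d)) / real g) = 0" by (simp add: frac_eq_0_iff)
        then have "real_of_int ((a * (b * int d)) mod int g) / real g = 0" by (simp only: frac_int_div[OF g0])
        then have "(a * (b * int d)) mod int g = 0" using g0 by simp
        then show False using nd by auto
      qed
      then show ?thesis by (simp add: saw0_def mult_ac)
    qed
    then have "(\<Sum>d | d \<in> {1..Y} \<and> coprime d m. moebius d / real d * (frac (of_int (a * (b * int d)) / real g) - 1 / 2)) =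
      (\<Sum>d | d \<in> {1..Y} \<and> coprime d m. moebius d / real d * saw0 (real d * (of_int (a * b) / real g)))"
      by (intro sum.cong refl) simp
    ultimately show ?thesis by (simp only: cf)
  qed
  show ?thesis
  proof (intro exI[of _ "real m * (2 ^ n * K0)"] conjI allI impI)
    show "0 \<le> real m * (2 ^ n * K0)" using K02 by simp
    fix Y g :: nat and a c :: int
    assume g: "g dvd m" "coprime a (int g)" and c: "coprime c (int m)"
    have g0: "g > 0" using g m by (auto intro: Nat.gr0I)
    show "\<bar>\<Sum>d | d \<in> {1..Y} \<and> coprime d m. moebius d / real d * (frac (of_int (a * (c * modinv m d)) / real g) - 1 / 2)\<bar> \<le> real m * (2 ^ n * K0)"
      by (rule sum_inverse_twist_bound[where f = "\<lambda>x. frac (of_int (a * x) / real g) - 1 / 2"])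
         (use m c modinv frac_int_cong[OF g(1) _ g0] coprime_bound[OF g] in auto)
  qed
qed

subsection \<open>Sums over arithmetic progressions\<close>

lemma int_div_less_iff: 
  assumes L: "L > 0"
  shows "a div L < k \<longleftrightarrow> a < k * (L::int)"
proof -
  have 1: "L * (a div L) \<le> a" "a < L * (a div L + 1)"
    using mult_div_mod_eq[of L a] pos_mod_sign[OF L, of a] pos_mod_bound[OF L, of a]
    unfolding distrib_left by linarith+
  { assume "a div L < k"
    then have "L * (a div L + 1) \<le> L * k" using L by (intro mult_left_mono) auto
    then have "a < k * L" using 1 by (simp add: mult.commute) }
  moreover { assume "a < k * L"
    have "a div L < k"
    proof (rule ccontr)
      assume "\<not> a div L < k"
      then have "L * k \<le> L * (a div L)" using L by (intro mult_left_mono) auto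
      then show False using 1 \<open>a < k * L\<close> by (simp add: mult.commute)
    qed }
  ultimately show ?thesis by blast
qed

lemma card_cong_Ioc:
  fixes L r A B :: int
  assumes "L > 0" "A \<le> B"
  shows "int (card {e. e \<in> {A<..B} \<and> [e = r] (mod L)}) = (B - r) div L - (A - r) div L"
proof -
  have "bij_betw (\<lambda>k. r + L * k) {(A - r) div L<..(B - r) div L} {e. e \<in> {A<..B} \<and> [e = r] (mod L)}"
  proof (rule bij_betwI[where g = "\<lambda>e. (e - r) div L"])
    show "(\<lambda>k. r + L * k) \<in> {(A - r) div L<..(B - r) div L} \<rightarrow> {e. e \<in> {A<..B} \<and> [e = r] (mod L)}"
      using assms(1) by (auto simp: int_div_less_iff not_less[symmetric] algebra_simps cong_iff_dvd_diff)
    show "(\<lambda>e. (e - r) div L) \<in> {e. e \<in> {A<..B} \<and> [e = r] (mod L)} \<rightarrow> {(A - r) div L<..(B - r) div L}"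
      using assms(1) by (auto simp: int_div_less_iff cong_iff_dvd_diff intro!: zdiv_mono1)
  qed (use assms in \<open>auto simp: cong_iff_dvd_diff\<close>)
  then have "card {e. e \<in> {A<..B} \<and> [e = r] (mod L)} = card {(A - r) div L<..(B - r) div L}"
    by (metis bij_betw_same_card)
  moreover have "(A - r) div L \<le> (B - r) div L" using assms by (intro zdiv_mono1) auto
  ultimately show ?thesis by simp
qed

lemma card_cong_Ioc_bound:
  fixes L r A B :: int
  assumes "L > 0" "A \<le> B"
  shows "\<bar>real (card {e. e \<in> {A<..B} \<and> [e = r] (mod L)}) - of_int (B - A) / of_int L\<bar> \<le> 1"
proof -
  have fl: "real_of_int (a div L) = of_int a / of_int L - frac (of_int a / of_int L)" for a
    by (simp add: frac_def floor_divide_of_int_eq)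
  have "real (card {e. e \<in> {A<..B} \<and> [e = r] (mod L)}) = of_int ((B - r) div L - (A - r) div L)"
    using card_cong_Ioc[OF assms, of r] by (metis of_int_of_nat_eq)
  also have "\<dots> = of_int (B - A) / of_int L + (frac (of_int (A - r) / of_int L) - frac (of_int (B - r) / of_int L))"
    by (simp add: fl diff_divide_distrib)
  finally show ?thesis
    using frac_ge_0[of "real_of_int (A - r) / real_of_int L"] frac_lt_1[of "real_of_int (A - r) / real_of_int L"]
       frac_ge_0[of "real_of_int (B - r) / real_of_int L"] frac_lt_1[of "real_of_int (B - r) / real_of_int L"]
    by linarith
qed

lemma frac_int_int_div:
  assumes "(g::int) > 0"
  shows "frac (of_int a / of_int g) = real_of_int (a mod g) / of_int g"
  using frac_int_div[of "nat g" a] assms by simp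

text \<open>The weight \<open>y - v\<close> vanishes at the upper end, so rounding there costs only
  a bounded amount. The linear term in \<open>y\<close> therefore comes from the lower end alone,
  from the position of the first positive member \<open>r0\<close> of the class.\<close>

lemma sum_ap_triangle:
  fixes L r :: int and y :: real
  assumes L: "L > 0" and y: "y \<ge> 0"
  shows "\<bar>(\<Sum>v | v \<in> {0<..\<lfloor>y\<rfloor>} \<and> [v = r] (mod L). y - of_int v)
     - (y\<^sup>2 / (2 * of_int L) + y * (frac (of_int (- r) / of_int L) - 1 / 2))\<bar> \<le> of_int L"
proof -
  define r0 where "r0 = L - (- r) mod L"
  have r0: "1 \<le> r0" "r0 \<le> L" using pos_mod_bound[OF L, of "- r"] pos_mod_sign[OF L, of "- r"] unfolding r0_def by linarith+
  have r0r: "[r0 = r] (mod L)"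
  proof -
    have "[L = 0] (mod L)" "[(- r) mod L = - r] (mod L)" by (simp_all add: cong_iff_mod_eq)
    then have "[L - (- r) mod L = 0 - (- r)] (mod L)" by (rule cong_diff)
    then show ?thesis by (simp add: r0_def)
  qed
  define T where "T = nat ((\<lfloor>y\<rfloor> - r0) div L + 1)"
  have "(\<lfloor>y\<rfloor> - r0) div L \<ge> -1"
  proof -
    have "(-1 * L) div L \<le> (\<lfloor>y\<rfloor> - r0) div L" using zero_le_floor[of y] y r0 L by (intro zdiv_mono1; linarith)
    moreover have "(-1 * L) div L = -1" using L by (intro nonzero_mult_div_cancel_right) auto
    ultimately show ?thesis by linarith
  qed
  then have T: "int T = (\<lfloor>y\<rfloor> - r0) div L + 1" by (simp add: T_def)
  have iff: "int t < int T \<longleftrightarrow> r0 + L * int t \<le> \<lfloor>y\<rfloor>" for t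
  proof -
    have "int t < int T \<longleftrightarrow> \<not> ((\<lfloor>y\<rfloor> - r0) div L < int t)" unfolding T by linarith
    also have "\<dots> \<longleftrightarrow> r0 + L * int t \<le> \<lfloor>y\<rfloor>" using L by (auto simp: int_div_less_iff algebra_simps not_less)
    finally show ?thesis .
  qed
  have "(\<Sum>v | v \<in> {0<..\<lfloor>y\<rfloor>} \<and> [v = r] (mod L). y - of_int v) = (\<Sum>t\<in>{..<T}. y - of_int (r0 + L * int t))"
  proof (rule sum.reindex_bij_witness[of _ "\<lambda>t. r0 + L * int t" "\<lambda>v. nat ((v - r0) div L)"])
    fix v assume v: "v \<in> {v. v \<in> {0<..\<lfloor>y\<rfloor>} \<and> [v = r] (mod L)}"
    then have "[v = r0] (mod L)" using r0r cong_sym cong_trans by blast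
    then obtain k where k: "v = r0 + L * k" by (metis cong_iff_lin mult.commute cong_sym)
    have "0 < L * (k + 1)" using v k r0 by (auto simp: algebra_simps)
    then have "k \<ge> 0" using L by (simp add: zero_less_mult_iff)
    then obtain t where t: "k = int t" using nonneg_int_cases by blast
    show "r0 + L * int (nat ((v - r0) div L)) = v" using k t L by simp
    show "nat ((v - r0) div L) \<in> {..<T}" using k t L iff[of t] v by simp
    show "y - of_int (r0 + L * int (nat ((v - r0) div L))) = y - of_int v" using k t L by simp
  next
    fix t assume t: "t \<in> {..<T}"
    show "nat ((r0 + L * int t - r0) div L) = t" using L by simp
    have "[r0 + L * int t = r] (mod L)" using r0r by (simp add: cong_iff_mod_eq)
    moreover have "0 \<le> L * int t" using L by simp
    then have "0 < r0 + L * int t" using r0 by linarith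
    ultimately show "r0 + L * int t \<in> {v. v \<in> {0<..\<lfloor>y\<rfloor>} \<and> [v = r] (mod L)}"
      using t iff[of t] by auto
  qed
  also have "\<dots> = of_nat T * (y - of_int r0) - of_int L * (real T * (real T - 1) / 2)"
    by (induction T) (auto simp: field_simps)
  finally have S: "(\<Sum>v | v \<in> {0<..\<lfloor>y\<rfloor>} \<and> [v = r] (mod L). y - of_int v) =
     real T * (y - of_int r0) - of_int L * (real T * (real T - 1) / 2)" .
  define l where "l = real_of_int L"
  define \<rho> where "\<rho> = real_of_int r0"
  have l: "l > 0" "1 \<le> \<rho>" "\<rho> \<le> l" using L r0 by (auto simp: l_def \<rho>_def)
  define s where "s = (y - \<rho>) / l"
  \<comment> \<open>The real number of terms \<open>s + 1\<close> exceeds the actual number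
    \<open>T\<close> by \<open>\<delta>\<close>, which lies between 0 and 1; the sum depends on it
    only through \<open>\<delta> * (1 - \<delta>)\<close>.\<close>
  define \<delta> where "\<delta> = s + 1 - real T"
  have fr: "frac (of_int (- r) / of_int L) = 1 - \<rho> / l"
    using L frac_int_int_div[of L "- r"] by (simp add: \<rho>_def r0_def l_def field_simps)
  have \<delta>: "0 \<le> \<delta>" "\<delta> \<le> 1"
  proof -
    have "\<not> int T < int T" by simp
    then have "\<lfloor>y\<rfloor> < r0 + L * int T" using iff[of T] by linarith
    then have "y < of_int (r0 + L * int T)" by (simp add: floor_less_iff)
    then have "y < \<rho> + l * real T" by (simp add: \<rho>_def l_def)
    then show "\<delta> \<le> 1" using l by (simp add: \<delta>_def s_def field_simps)
    show "0 \<le> \<delta>"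
    proof (cases T)
      case 0
      then show ?thesis using y l by (simp add: \<delta>_def s_def field_simps)
    next
      case (Suc t)
      then have "r0 + L * int t \<le> \<lfloor>y\<rfloor>" using iff[of t] by simp
      then have "of_int (r0 + L * int t) \<le> y" by (simp add: le_floor_iff)
      then have "\<rho> + l * (real T - 1) \<le> y" using Suc by (simp add: \<rho>_def l_def)
      then show ?thesis using l by (simp add: \<delta>_def s_def field_simps)
    qed
  qed
  have "real T * (y - \<rho>) - l * (real T * (real T - 1) / 2) = y\<^sup>2 / (2 * l) + y * ((1 - \<rho> / l) - 1 / 2)
     + (\<rho>\<^sup>2 / (2 * l) - \<rho> / 2 + l * (\<delta> * (1 - \<delta>)) / 2)"
  proof -
    have T': "real T = s + 1 - \<delta>" by (simp add: \<delta>_def)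
    have y': "y = \<rho> + l * s" using l by (simp add: s_def)
    show ?thesis unfolding T' y' using l by (simp add: field_simps power2_eq_square)
  qed
  moreover have "0 \<le> \<delta> * (1 - \<delta>)" "\<delta> * (1 - \<delta>) \<le> 1" using \<delta> by (auto intro: mult_le_one)
  then have "0 \<le> l * (\<delta> * (1 - \<delta>)) / 2" "l * (\<delta> * (1 - \<delta>)) / 2 \<le> l / 2"
    using l by (auto simp: mult_left_le)
  moreover have "\<rho>\<^sup>2 / (2 * l) - \<rho> / 2 \<le> 0"
    using l by (simp add: field_simps power2_eq_square)
  moreover have "0 \<le> \<rho>\<^sup>2 / (2 * l)" using l by simp
  ultimately show ?thesis unfolding S fr using l unfolding l_def[symmetric] \<rho>_def[symmetric] by linarith
qed

definition apsum :: "int \<Rightarrow> (int \<Rightarrow> real) \<Rightarrow> int \<Rightarrow> int \<Rightarrow> real" where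
  "apsum m F x c = (\<Sum>e | e \<in> {0<..x} \<and> [e = c] (mod m). F e)"

text \<open>Writing \<open>e = x - (x - e)\<close> gives \<open>x\<close> times a count, about
  \<open>x ^ 2 / m\<close>, minus a triangle sum, about \<open>x ^ 2 / (2 * m)\<close>.\<close>

lemma apsum_ident:
  assumes m: "m > 0" and x: "x \<ge> 0"
  shows "\<bar>apsum m of_int x c - of_int x ^ 2 / (2 * of_int m)\<bar> \<le> 2 * of_int x + of_int m"
proof -
  let ?S = "{e. e \<in> {0<..x} \<and> [e = c] (mod m)}"
  define B where "B = frac (of_int (- c) / real_of_int m)"
  have B: "0 \<le> B" "B < 1" by (auto simp: B_def frac_lt_1)
  have "apsum m of_int x c = of_int x * real (card ?S) - (\<Sum>e\<in>?S. of_int x - of_int e)"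
    by (simp add: apsum_def sum_subtractf)
  moreover have "\<bar>(\<Sum>e\<in>?S. of_int x - of_int e) - ((of_int x)\<^sup>2 / (2 * of_int m) + of_int x * (B - 1 / 2))\<bar> \<le> of_int m"
    using sum_ap_triangle[OF m, of "of_int x" c] x by (simp add: B_def)
  moreover have "\<bar>of_int x * (real (card ?S) - of_int x / of_int m)\<bar> \<le> of_int x"
    using card_cong_Ioc_bound[OF m x, of c] x by (simp add: abs_mult mult_left_le)
  then have "\<bar>of_int x * real (card ?S) - (of_int x)\<^sup>2 / of_int m\<bar> \<le> of_int x"
    by (simp add: right_diff_distrib power2_eq_square)
  moreover have "\<bar>of_int x * (B - 1 / 2)\<bar> \<le> real_of_int x"
    using B x by (simp add: abs_mult mult_left_le)
  moreover have "(of_int x)\<^sup>2 / of_int m = (of_int x)\<^sup>2 / (2 * of_int m) + (real_of_int x)\<^sup>2 / (2 * of_int m)"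
    by simp
  ultimately show ?thesis by linarith
qed

subsection \<open>Neighbouring fractions\<close>

text \<open>The Chinese remainder theorem for moduli that may have a common factor, as a case rule.
  The solution \<open>e0\<close> comes from a Bezout identity for \<open>gcd q m\<close>.\<close>

lemma cong_gcd_cases:
  fixes a c q m :: int
  obtains (none) "\<not> [a = c] (mod gcd q m)" "\<And>e. \<not> ([e = a] (mod q) \<and> [e = c] (mod m))"
  | (one) e0 where "[a = c] (mod gcd q m)" "\<And>e. [e = a] (mod q) \<and> [e = c] (mod m) \<longleftrightarrow> [e = e0] (mod lcm q m)"
proof (cases "[a = c] (mod gcd q m)")
  case False
  have "[a = c] (mod gcd q m)" if "[e = a] (mod q)" "[e = c] (mod m)" for e
    using cong_dvd_modulus[OF that(1), of "gcd q m"] cong_dvd_modulus[OF that(2), of "gcd q m"]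
    by (meson cong_sym cong_trans gcd_dvd1 gcd_dvd2)
  then show ?thesis using none False by blast
next
  case True
  then obtain k where k: "c - a = gcd q m * k"
    by (metis cong_iff_dvd_diff cong_sym dvdE)
  obtain u v where uv: "u * q + v * m = gcd q m" using bezout_int by blast
  define e0 where "e0 = a + q * (u * k)"
  have "e0 - c = - (v * k) * m"
  proof -
    have "e0 - c = u * q * k - (u * q + v * m) * k" unfolding e0_def uv using k by (simp add: algebra_simps)
    then show ?thesis by (simp add: algebra_simps)
  qed
  then have e0c: "[e0 = c] (mod m)" by (simp add: cong_iff_dvd_diff)
  have e0a: "[e0 = a] (mod q)" by (simp add: cong_iff_dvd_diff e0_def)
  have "[e = a] (mod q) \<and> [e = c] (mod m) \<longleftrightarrow> [e = e0] (mod lcm q m)" for e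
  proof -
    have "[e = a] (mod q) \<longleftrightarrow> [e = e0] (mod q)" "[e = c] (mod m) \<longleftrightarrow> [e = e0] (mod m)"
      using e0a e0c by (meson cong_sym cong_trans)+
    then show ?thesis by (simp add: cong_iff_dvd_diff lcm_least_iff)
  qed
  then show ?thesis using one True by blast
qed

text \<open>Unlike \<open>saw0\<close> this is -1/2 at integers, matching the fractional parts that
  are really counted.\<close>

definition saw :: "real \<Rightarrow> real" where "saw x = frac x - 1 / 2"

lemma abs_saw_le: "\<bar>saw x\<bar> \<le> 1 / 2"
  using frac_ge_0[of x] frac_lt_1[of x] unfolding saw_def by linarith

lemma sum_residue_class:
  fixes g q s :: int
  assumes g: "g > 0" "g dvd q" and q: "q > 0"
  shows "(\<Sum>r | r \<in> {0..<q} \<and> [r = s] (mod g). real_of_int r) = 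
     of_int q * (of_int (s mod g) / of_int g) + of_int q * (of_int q / of_int g - 1) / 2"
proof -
  define q1 where "q1 = nat (q div g)"
  have q1: "q = g * int q1" using g q by (simp add: q1_def pos_imp_zdiv_nonneg_iff)
  have "(\<Sum>r | r \<in> {0..<q} \<and> [r = s] (mod g). real_of_int r) = (\<Sum>j<q1. real_of_int (s mod g + g * int j))"
  proof (rule sum.reindex_bij_witness[of _ "\<lambda>j. s mod g + g * int j" "\<lambda>r. nat (r div g)"])
    fix r assume r: "r \<in> {r. r \<in> {0..<q} \<and> [r = s] (mod g)}"
    then have rs: "r mod g = s mod g" by (simp add: cong_iff_mod_eq)
    have nn: "r div g \<ge> 0" using r g by (simp add: pos_imp_zdiv_nonneg_iff)
    then show 1: "s mod g + g * int (nat (r div g)) = r" by (simp flip: rs)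
    show "nat (r div g) \<in> {..<q1}" using r g q1 nn by (auto simp: nat_less_iff int_div_less_iff mult.commute)
    show "real_of_int (s mod g + g * int (nat (r div g))) = real_of_int r" using 1 by simp
  next
    fix j assume j: "j \<in> {..<q1}"
    show "nat ((s mod g + g * int j) div g) = j" using g by simp
    have "s mod g + g * int j < g + g * int j" using g by simp
    also have "\<dots> = g * (int j + 1)" by (simp add: algebra_simps)
    also have "\<dots> \<le> q" using j g unfolding q1 by (intro mult_left_mono) auto
    finally show "s mod g + g * int j \<in> {r. r \<in> {0..<q} \<and> [r = s] (mod g)}"
      using g by (auto simp: cong_iff_mod_eq)
  qed
  also have "\<dots> = real q1 * of_int (s mod g) + of_int g * (real q1 * (real q1 - 1) / 2)"
    by (induction q1) (auto simp: field_simps)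
  finally show ?thesis using g unfolding q1 by (simp add: field_simps)
qed

text \<open>Over a period, \<open>p * e mod q\<close> takes exactly the residues congruent to
  \<open>p * c\<close> modulo \<open>g\<close>, each of them \<open>g\<close> times because
  \<open>q * m = g * lcm q m\<close>. The bias of these residues towards one side is the term with
  \<open>saw\<close>, the source of the slopes.\<close>

lemma sum_frac_period:
  fixes p q m c x :: int
  assumes q: "q > 0" and m: "m > 0" and pq: "coprime p q"
  defines "g \<equiv> gcd q m"
  shows "(\<Sum>e | e \<in> {x<..x + q * m} \<and> [e = c] (mod m). frac (of_int (p * e) / real_of_int q)) =
     of_int g * saw (of_int (p * c) / of_int g) + of_int q / 2"
proof -
  let ?S = "{e. e \<in> {x<..x + q * m} \<and> [e = c] (mod m)}"
  have g: "g > 0" "g dvd q" "g dvd m" using q by (auto simp: g_def)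
  have fin: "finite ?S" by (rule finite_subset[of _ "{x<..x + q * m}"]) auto
  obtain pi where pi: "[p * pi = 1] (mod q)" using pq coprime_iff_invertible_int by blast
  have piff: "(p * e) mod q = r \<longleftrightarrow> [e = pi * r] (mod q)" if "r \<in> {0..<q}" for e r
  proof -
    have "(p * e) mod q = r \<longleftrightarrow> [p * e = r] (mod q)" using that by (simp add: cong_iff_mod_eq)
    also have "\<dots> \<longleftrightarrow> [e = pi * r] (mod q)"
    proof
      assume "[p * e = r] (mod q)"
      then have "[pi * (p * e) = pi * r] (mod q)" by (rule cong_scalar_left)
      moreover have "[p * pi * e = 1 * e] (mod q)" using pi by (rule cong_scalar_right)
      ultimately show "[e = pi * r] (mod q)" by (metis cong_sym cong_trans mult.assoc mult.commute mult_1)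
    next
      assume "[e = pi * r] (mod q)"
      then have "[p * e = p * (pi * r)] (mod q)" by (rule cong_scalar_left)
      moreover have "[p * pi * r = 1 * r] (mod q)" using pi by (rule cong_scalar_right)
      ultimately show "[p * e = r] (mod q)" by (metis cong_trans mult.assoc mult_1)
    qed
    finally show ?thesis .
  qed
  have pig: "[pi * r = c] (mod g) \<longleftrightarrow> [r = p * c] (mod g)" for r
  proof -
    have 1: "[p * pi = 1] (mod g)" using pi g(2) by (rule cong_dvd_modulus)
    show ?thesis
    proof
      assume "[pi * r = c] (mod g)"
      then have "[p * (pi * r) = p * c] (mod g)" by (rule cong_scalar_left)
      moreover have "[p * pi * r = 1 * r] (mod g)" using 1 by (rule cong_scalar_right)
      ultimately show "[r = p * c] (mod g)" by (metis cong_sym cong_trans mult.assoc mult_1)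
    next
      assume "[r = p * c] (mod g)"
      then have "[pi * r = pi * (p * c)] (mod g)" by (rule cong_scalar_left)
      moreover have "[p * pi * c = 1 * c] (mod g)" using 1 by (rule cong_scalar_right)
      ultimately show "[pi * r = c] (mod g)" by (metis cong_trans mult.assoc mult.commute mult_1)
    qed
  qed
  have cnt: "real (card {e \<in> ?S. (p * e) mod q = r}) = (if [r = p * c] (mod g) then of_int g else 0)"
    if r: "r \<in> {0..<q}" for r
  proof -
    have set: "{e \<in> ?S. (p * e) mod q = r} = {e \<in> {x<..x + q * m}. [e = pi * r] (mod q) \<and> [e = c] (mod m)}"
      using piff[OF r] by auto
    show ?thesis
    proof (cases rule: cong_gcd_cases[of "pi * r" c q m])
      case none
      then have "{e \<in> ?S. (p * e) mod q = r} = {}" unfolding set by blast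
      moreover have "\<not> [r = p * c] (mod g)" using none(1) pig[of r] unfolding g_def by blast
      ultimately show ?thesis by (simp only: card.empty of_nat_0 if_False)
    next
      case (one e0)
      define l where "l = lcm q m"
      have l: "l > 0" using q m by (simp add: l_def lcm_pos_int)
      have gl: "q * m = g * l" using q m prod_gcd_lcm_int[of q m] by (simp add: g_def l_def)
      have "{e \<in> ?S. (p * e) mod q = r} = {e. e \<in> {x<..x + g * l} \<and> [e = e0] (mod l)}"
        unfolding set one(2) unfolding gl l_def by auto
      then have "int (card {e \<in> ?S. (p * e) mod q = r}) = (x + g * l - e0) div l - (x - e0) div l"
        using card_cong_Ioc[OF l, of x "x + g * l" e0] g l by simp
      also have "x + g * l - e0 = (x - e0) + g * l" by simp
      also have "\<dots> div l = (x - e0) div l + g" using l by simp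
      finally have "int (card {e \<in> ?S. (p * e) mod q = r}) = g" by simp
      then have "real_of_int (int (card {e \<in> ?S. (p * e) mod q = r})) = of_int g" by (rule arg_cong)
      then have "real (card {e \<in> ?S. (p * e) mod q = r}) = of_int g" by (simp only: of_int_of_nat_eq)
      moreover have "[r = p * c] (mod g)" using one(1) pig[of r] unfolding g_def by blast
      ultimately show ?thesis by (simp only: if_True)
    qed
  qed
  have "(\<Sum>e\<in>?S. frac (of_int (p * e) / real_of_int q)) = (\<Sum>e\<in>?S. of_int ((p * e) mod q) / of_int q)"
    by (intro sum.cong refl frac_int_int_div q)
  also have "\<dots> = (\<Sum>r\<in>{0..<q}. \<Sum>e\<in>{e \<in> ?S. (p * e) mod q = r}. of_int ((p * e) mod q) / of_int q)"
    by (rule sum.group[symmetric]) (use fin q in auto)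
  also have "\<dots> = (\<Sum>r\<in>{0..<q}. \<Sum>e\<in>{e \<in> ?S. (p * e) mod q = r}. of_int r / of_int q)"
    by (intro sum.cong refl) auto
  also have "\<dots> = (\<Sum>r\<in>{0..<q}. real (card {e \<in> ?S. (p * e) mod q = r}) * (of_int r / of_int q))"
    by (simp only: sum_constant)
  also have "\<dots> = (\<Sum>r\<in>{0..<q}. if [r = p * c] (mod g) then of_int g / of_int q * of_int r else 0)"
    by (intro sum.cong refl) (simp only: cnt, simp)
  also have "\<dots> = (\<Sum>r\<in>{r \<in> {0..<q}. [r = p * c] (mod g)}. of_int g / of_int q * of_int r)"
    by (rule sum.inter_filter[symmetric]) simp
  also have "\<dots> = of_int g / of_int q * (\<Sum>r | r \<in> {0..<q} \<and> [r = p * c] (mod g). real_of_int r)"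
    by (simp only: sum_distrib_left)
  also have "\<dots> = of_int g * saw (of_int (p * c) / of_int g) + of_int q / 2"
    unfolding sum_residue_class[OF g(1,2) q] saw_def frac_int_int_div[OF g(1)]
    using g q by (simp add: field_simps)
  finally show ?thesis .
qed

lemma apsum_add_period:
  fixes p q m c x :: int
  assumes "q > 0" "m > 0" "coprime p q" "x \<ge> 0"
  shows "apsum m (\<lambda>e. frac (of_int (p * e) / real_of_int q)) (x + int t * (q * m)) c =
     apsum m (\<lambda>e. frac (of_int (p * e) / real_of_int q)) x c
     + real t * (of_int (gcd q m) * saw (of_int (p * c) / of_int (gcd q m)) + of_int q / 2)"
proof (induction t)
  case (Suc t)
  let ?x = "x + int t * (q * m)"
  let ?F = "\<lambda>e. frac (of_int (p * e) / real_of_int q)"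
  have x: "?x \<ge> 0" "q * m > 0" using assms by auto
  have eq: "x + int (Suc t) * (q * m) = ?x + q * m" by (simp add: algebra_simps)
  have "apsum m ?F (?x + q * m) c = (\<Sum>e\<in>{e. e \<in> {0<..?x} \<and> [e = c] (mod m)} \<union> {e. e \<in> {?x<..?x + q * m} \<and> [e = c] (mod m)}. ?F e)"
    unfolding apsum_def using x by (intro sum.cong) auto
  also have "\<dots> = apsum m ?F ?x c + (\<Sum>e | e \<in> {?x<..?x + q * m} \<and> [e = c] (mod m). ?F e)"
    unfolding apsum_def
    by (rule sum.union_disjoint) (auto intro: finite_subset[of _ "{0<..?x}"] finite_subset[of _ "{?x<..?x + q * m}"])
  finally show ?case unfolding eq
    using Suc sum_frac_period[OF assms(1-3), of ?x c] by (simp add: algebra_simps)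
qed simp


text \<open>
  The points counted between \<open>p' / q'\<close> and \<open>p / q\<close> are the combinations of these two fractions. In \<open>w_eq\<close> they
  enter through the coefficient \<open>v\<close> of \<open>p / q\<close>.
\<close>

locale farey_neighbours =
  fixes m p q p' q' :: int
  assumes m: "m > 0" and q': "0 < q'" "q' \<le> q" and det: "p * q' - p' * q = 1"
begin

definition w :: "int \<Rightarrow> real" where
  "w e = frac (of_int (p * e) / of_int q) - frac (of_int (p' * e) / of_int q')"

lemma q: "0 < q" using q' by linarith

lemma coprimes: "coprime p q" "coprime p' q'"
proof -
  have "is_unit d" if "d dvd p" "d dvd q" for d
    using that det by (metis dvd_diff dvd_mult dvd_mult2)
  then show "coprime p q" by (rule coprimeI)
  have "is_unit d" if "d dvd p'" "d dvd q'" for d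
    using that det by (metis dvd_diff dvd_mult dvd_mult2)
  then show "coprime p' q'" by (rule coprimeI)
qed

text \<open>The determinant gives \<open>p * e * q' = e + p' * e * q\<close>, hence
  \<open>(p * e) div q = (e div q + p' * e) div q'\<close>. Subtracting
  \<open>(p' * e) div q'\<close> leaves a difference of two quotients by \<open>q'\<close>, which
  counts a residue class in an interval of length \<open>e div q\<close>.\<close>

lemma w_eq:
  "w e = of_int e / (of_int q * of_int q') - real (card {v. v \<in> {0<..e div q} \<and> [v = - p' * e] (mod q')})"
  if e: "e \<ge> 0"
proof -
  have "0 \<le> e div q" using e q by (simp add: pos_imp_zdiv_nonneg_iff)
  then have "int (card {v. v \<in> {0<..e div q} \<and> [v = - p' * e] (mod q')}) = (e div q + p' * e) div q' - (p' * e) div q'"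
    using card_cong_Ioc[OF q'(1), of 0 "e div q" "- p' * e"] by simp
  also have "e div q + p' * e = (e + p' * e * q) div q" using q by simp
  also have "e + p' * e * q = (p * e) * q'"
  proof -
    have "e * (p * q' - p' * q) = e" using det by simp
    then show ?thesis by (simp add: algebra_simps)
  qed
  also have "(p * e) * q' div q div q' = (p * e) * q' div (q * q')" using q' by (simp add: zdiv_zmult2_eq)
  also have "\<dots> = (p * e) div q" using q' by simp
  finally have "real (card {v. v \<in> {0<..e div q} \<and> [v = - p' * e] (mod q')}) = of_int ((p * e) div q - (p' * e) div q')"
    by (metis of_int_of_nat_eq)
  moreover have "of_int (p * e) / of_int q - of_int (p' * e) / real_of_int q' = of_int e / (of_int q * of_int q')"
  proof -
    have "real_of_int p * of_int q' - of_int p' * of_int q = 1" using det by (metis of_int_1 of_int_diff of_int_mult)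
    then have "real_of_int p * of_int q' = 1 + of_int p' * of_int q" by linarith
    then have "real_of_int e * (of_int p * of_int q') = of_int e * (1 + of_int p' * of_int q)" by simp
    then show ?thesis using q q' by (simp add: field_simps)
  qed
  moreover have fl: "frac (of_int a / of_int b) = of_int a / real_of_int b - of_int (a div b)" for a b
    by (simp add: frac_def floor_divide_of_int_eq)
  ultimately show ?thesis unfolding w_def fl of_int_diff by linarith
qed

lemma w_small: "0 \<le> e \<Longrightarrow> e < q \<Longrightarrow> w e = of_int e / (of_int q * of_int q')"
  by (simp add: w_eq)

text \<open>The mean growth of \<open>apsum m w x c\<close> per unit of \<open>x\<close>: the period
  sum of each of the two fractions divided by the length of its period. The contributions of mean
  value 1/2 cancel.\<close>

definition rate :: "int \<Rightarrow> real" where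
  "rate c = (of_int (gcd q m) / of_int q * saw (of_int (p * c) / of_int (gcd q m))
     - of_int (gcd q' m) / of_int q' * saw (of_int (p' * c) / of_int (gcd q' m))) / of_int m"

lemma abs_rate_le: "\<bar>rate c\<bar> \<le> 1 / of_int q'"
proof -
  have *: "\<bar>of_int (gcd r m) / real_of_int r * saw z\<bar> \<le> of_int m / of_int q' / 2" if "r > 0" "q' \<le> r" for r z
  proof -
    have "gcd r m \<le> m" using m by (auto simp: zdvd_imp_le)
    then have "real_of_int (gcd r m) / of_int r \<le> of_int m / of_int q'"
      using m q' that by (intro frac_le) auto
    then have "of_int (gcd r m) / real_of_int r * \<bar>saw z\<bar> \<le> of_int m / of_int q' * (1 / 2)"
      by (rule mult_mono) (use abs_saw_le m q' in auto)
    then show ?thesis using that by (simp add: abs_mult)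
  qed
  have "\<bar>of_int (gcd q m) / of_int q * saw (of_int (p * c) / of_int (gcd q m))
     - of_int (gcd q' m) / of_int q' * saw (of_int (p' * c) / of_int (gcd q' m))\<bar> \<le> of_int m / of_int q'"
  proof -
    have "\<bar>a - b\<bar> \<le> t" if "\<bar>a\<bar> \<le> t / 2" "\<bar>b\<bar> \<le> t / 2" for a b t :: real
      using that by linarith
    from this[OF *[OF q q'(2)] *[OF q'(1) order_refl]] show ?thesis .
  qed
  then show ?thesis unfolding rate_def using m q' by (simp add: field_simps)
qed

lemma apsum_w_period:
  assumes x: "x \<ge> 0"
  shows "apsum m w (x + int t * (q * q' * m)) c = apsum m w x c + real t * (of_int (q * q' * m) * rate c)"
proof -
  have split: "apsum m w y c = apsum m (\<lambda>e. frac (of_int (p * e) / real_of_int q)) y c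
      - apsum m (\<lambda>e. frac (of_int (p' * e) / real_of_int q')) y c" for y
    by (simp add: apsum_def w_def sum_subtractf)
  obtain n n' where n: "q = int n" "q' = int n'" using q q' by (metis nonneg_int_cases less_imp_le)
  have 1: "int t * (q * q' * m) = int (t * n') * (q * m)" "int t * (q * q' * m) = int (t * n) * (q' * m)"
    using n by simp_all
  have e1: "apsum m (\<lambda>e. frac (of_int (p * e) / real_of_int q)) (x + int t * (q * q' * m)) c =
      apsum m (\<lambda>e. frac (of_int (p * e) / real_of_int q)) x c
      + real (t * n') * (of_int (gcd q m) * saw (of_int (p * c) / of_int (gcd q m)) + of_int q / 2)"
    unfolding 1(1) by (rule apsum_add_period) (use q m coprimes x in auto)
  have e2: "apsum m (\<lambda>e. frac (of_int (p' * e) / real_of_int q')) (x + int t * (q * q' * m)) c =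
      apsum m (\<lambda>e. frac (of_int (p' * e) / real_of_int q')) x c
      + real (t * n) * (of_int (gcd q' m) * saw (of_int (p' * c) / of_int (gcd q' m)) + of_int q' / 2)"
    unfolding 1(2) by (rule apsum_add_period) (use q' m coprimes x in auto)
  have e3: "real_of_int (q * q' * m) * rate c = real n' * (of_int (gcd q m) * saw (of_int (p * c) / of_int (gcd q m)))
      - real n * (of_int (gcd q' m) * saw (of_int (p' * c) / of_int (gcd q' m)))"
  proof -
    have "real_of_int (q * q' * m) * ((G / of_int q * s - G' / of_int q' * s') / of_int m)
      = real n' * (G * s) - real n * (G' * s')" for G G' s s'
      using q q' m n by (simp add: field_simps)
    then show ?thesis unfolding rate_def .
  qed
  show ?thesis unfolding split e1 e2 e3 using n by (simp add: algebra_simps)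
qed

text \<open>After summing \<open>w_eq\<close> and interchanging, each \<open>v\<close> counts the
  \<open>e >= v * q\<close> in one class modulo \<open>lcm q' m\<close> if \<open>v\<close> lies in
  a certain class modulo \<open>gcd q' m\<close>, and nothing otherwise. These counts, about
  \<open>(x - v * q) / lcm q' m\<close>, form a triangle sum in \<open>v\<close>: its quadratic term
  cancels the sum of \<open>e / (q * q')\<close>, and its linear term gives the \<open>q'\<close>
  part of \<open>rate\<close>. Rounding costs a bounded amount for each of the
  \<open>x div q\<close> values of \<open>v\<close>.\<close>

lemma apsum_w_asymp:
  assumes x: "x \<ge> 0"
  shows "\<bar>apsum m w x c - rate c * of_int x\<bar> \<le> 5 * of_int x / of_int q + 2 * of_int m * (of_int q / of_int q')"
proof -
  define g where "g = gcd q' m"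
  define l where "l = lcm q' m"
  define y where "y = of_int x / real_of_int q"
  define B where "B = saw (of_int (p' * c) / of_int g)"
  have g: "g > 0" "g dvd q'" "g \<le> m" using q' m by (auto simp: g_def zdvd_imp_le)
  have l: "l > 0" "g * l = q' * m" using q' m prod_gcd_lcm_int[of q' m] by (simp_all add: g_def l_def lcm_pos_int)
  have fy: "\<lfloor>y\<rfloor> = x div q" by (simp add: y_def floor_divide_of_int_eq)
  have y: "y \<ge> 0" using x q by (simp add: y_def)
  have p'q: "[- p' * q = 1] (mod q')"
  proof -
    have "- p' * q - 1 = q' * (- p)" using det by (simp add: algebra_simps)
    then show ?thesis by (simp add: cong_iff_dvd_diff)
  qed
  define N where "N e = {v. v \<in> {0<..e div q} \<and> [v = - p' * e] (mod q')}" for e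
  define M where "M v = {e. e \<in> {0<..x} \<and> [e = c] (mod m) \<and> v \<le> e div q \<and> [v = - p' * e] (mod q')}" for v
  have swap: "(\<Sum>e | e \<in> {0<..x} \<and> [e = c] (mod m). real (card (N e))) = (\<Sum>v\<in>{0<..x div q}. real (card (M v)))"
  proof -
    let ?S = "{e. e \<in> {0<..x} \<and> [e = c] (mod m)}"
    have fin: "finite ?S" by (rule finite_subset[of _ "{0<..x}"]) auto
    have "e div q \<le> x div q" if "e \<in> ?S" for e using that q by (auto intro!: zdiv_mono1)
    then have 1: "N e = {v \<in> {0<..x div q}. v \<le> e div q \<and> [v = - p' * e] (mod q')}" if "e \<in> ?S" for e
      using that unfolding N_def by fastforce
    have "(\<Sum>e\<in>?S. real (card (N e))) = (\<Sum>e\<in>?S. \<Sum>v\<in>{0<..x div q}. if v \<le> e div q \<and> [v = - p' * e] (mod q') then 1 else 0)"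
      by (intro sum.cong refl) (simp add: 1 sum.inter_filter[symmetric])
    also have "\<dots> = (\<Sum>v\<in>{0<..x div q}. \<Sum>e\<in>?S. if v \<le> e div q \<and> [v = - p' * e] (mod q') then 1 else 0)"
      by (rule sum.swap)
    also have "\<dots> = (\<Sum>v\<in>{0<..x div q}. real (card (M v)))"
      using fin by (intro sum.cong refl) (simp add: sum.inter_filter[symmetric] M_def conj_assoc)
    finally show ?thesis .
  qed
  have M: "\<bar>real (card (M v)) - (if [v = - p' * c] (mod g) then (of_int x - of_int v * of_int q) / of_int l else 0)\<bar> \<le> 2"
    if v: "v \<in> {0<..x div q}" for v
  proof -
    have vq: "v * q \<le> x"
    proof -
      have "\<not> x div q < v" using v by simp
      then show ?thesis unfolding int_div_less_iff[OF q] by simp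
    qed
    have vq0: "0 < v * q" using v q by simp
    have iff1: "[v = - p' * e] (mod q') \<longleftrightarrow> [e = v * q] (mod q')" for e
    proof
      assume "[v = - p' * e] (mod q')"
      then have "[v * q = - p' * e * q] (mod q')" by (rule cong_scalar_right)
      moreover have "[- p' * q * e = 1 * e] (mod q')" using p'q by (rule cong_scalar_right)
      moreover have "- p' * e * q = - p' * q * e" by simp
      ultimately show "[e = v * q] (mod q')" by (metis cong_sym cong_trans mult_1)
    next
      assume "[e = v * q] (mod q')"
      then have "[- p' * e = - p' * (v * q)] (mod q')" by (rule cong_scalar_left)
      moreover have "[- p' * q * v = 1 * v] (mod q')" using p'q by (rule cong_scalar_right)
      moreover have "- p' * (v * q) = - p' * q * v" by simp
      ultimately show "[v = - p' * e] (mod q')" by (metis cong_sym cong_trans mult_1)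
    qed
    have p'qg: "[- p' * q = 1] (mod g)" using p'q g(2) by (rule cong_dvd_modulus)
    have iff2: "[v * q = c] (mod g) \<longleftrightarrow> [v = - p' * c] (mod g)"
    proof
      assume "[v * q = c] (mod g)"
      then have "[- p' * (v * q) = - p' * c] (mod g)" by (rule cong_scalar_left)
      moreover have "[- p' * q * v = 1 * v] (mod g)" using p'qg by (rule cong_scalar_right)
      moreover have "- p' * (v * q) = - p' * q * v" by simp
      ultimately show "[v = - p' * c] (mod g)" by (metis cong_sym cong_trans mult_1)
    next
      assume "[v = - p' * c] (mod g)"
      then have "[v * q = - p' * c * q] (mod g)" by (rule cong_scalar_right)
      moreover have "[- p' * q * c = 1 * c] (mod g)" using p'qg by (rule cong_scalar_right)
      moreover have "- p' * c * q = - p' * q * c" by simp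
      ultimately show "[v * q = c] (mod g)" by (metis cong_trans mult_1)
    qed
    have ledi: "v \<le> e div q \<longleftrightarrow> v * q \<le> e" for e
      using int_div_less_iff[OF q, of e v] by linarith
    \<comment> \<open>The end point \<open>e = v * q\<close> is included, so the interval has one
      integer more than its length \<open>x - v * q\<close>. That and the rounding of the count make
      up the error 2.\<close>
    have Mset: "M v = {e \<in> {v * q - 1<..x}. [e = v * q] (mod q') \<and> [e = c] (mod m)}"
      unfolding M_def iff1 ledi using vq0 by auto
    show ?thesis
    proof (cases rule: cong_gcd_cases[of "v * q" c q' m])
      case none
      then have "M v = {}" unfolding Mset by blast
      then show ?thesis using none(1) iff2 unfolding g_def by simp
    next
      case (one e0)
      have "M v = {e. e \<in> {v * q - 1<..x} \<and> [e = e0] (mod l)}" unfolding Mset one(2) l_def by auto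
      then have 1: "\<bar>real (card (M v)) - of_int (x - (v * q - 1)) / of_int l\<bar> \<le> 1"
        using card_cong_Ioc_bound[OF l(1), of "v * q - 1" x e0] vq by simp
      have "of_int (x - (v * q - 1)) / real_of_int l = (of_int x - of_int v * of_int q) / of_int l + 1 / of_int l"
        by (simp add: diff_divide_distrib add_divide_distrib)
      moreover have "0 \<le> 1 / real_of_int l" "1 / real_of_int l \<le> 1" using l(1) by (simp_all add: divide_simps)
      ultimately have "\<bar>real (card (M v)) - (of_int x - of_int v * of_int q) / of_int l\<bar> \<le> 2"
        using 1 by linarith
      moreover have "[v = - p' * c] (mod g)" using one(1) iff2 unfolding g_def by blast
      ultimately show ?thesis by (simp only: if_True)
    qed
  qed
  define Z where "Z = (\<Sum>v\<in>{0<..x div q}. real (card (M v)))"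
  have xdq: "0 \<le> x div q" "real_of_int (x div q) \<le> of_int x / of_int q"
    using x q fy[symmetric] by (simp_all add: pos_imp_zdiv_nonneg_iff y_def)
  have Z1: "\<bar>Z - (\<Sum>v\<in>{0<..x div q}. if [v = - p' * c] (mod g) then (of_int x - of_int v * of_int q) / of_int l else 0)\<bar> \<le> 2 * of_int x / of_int q"
  proof -
    have "\<bar>Z - (\<Sum>v\<in>{0<..x div q}. if [v = - p' * c] (mod g) then (of_int x - of_int v * of_int q) / of_int l else 0)\<bar> \<le> (\<Sum>v\<in>{0<..x div q}. 2)"
      unfolding Z_def sum_subtractf[symmetric] by (rule order_trans[OF sum_abs]) (rule sum_mono, rule M)
    also have "\<dots> = 2 * of_int (x div q)" using xdq by simp
    finally show ?thesis using xdq(2) by linarith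
  qed
  define A where "A = (\<Sum>v | v \<in> {0<..\<lfloor>y\<rfloor>} \<and> [v = - p' * c] (mod g). y - of_int v)"
  have Z2: "(\<Sum>v\<in>{0<..x div q}. if [v = - p' * c] (mod g) then (of_int x - of_int v * of_int q) / of_int l else 0) = of_int q / of_int l * A"
  proof -
    have "of_int q / of_int l * A = (\<Sum>v\<in>{v \<in> {0<..x div q}. [v = - p' * c] (mod g)}. (of_int x - of_int v * of_int q) / of_int l)"
      unfolding A_def fy sum_distrib_left
      by (intro sum.cong refl) (use q l in \<open>simp add: y_def field_simps\<close>)
    also have "\<dots> = (\<Sum>v\<in>{0<..x div q}. if [v = - p' * c] (mod g) then (of_int x - of_int v * of_int q) / of_int l else 0)"
      by (rule sum.inter_filter) simp
    finally show ?thesis by simp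
  qed
  have A: "\<bar>A - (y\<^sup>2 / (2 * of_int g) + y * B)\<bar> \<le> of_int g"
    using sum_ap_triangle[OF g(1) y, of "- p' * c"] unfolding A_def B_def saw_def by simp
  have Z3: "\<bar>of_int q / of_int l * A - (of_int x ^ 2 / (2 * of_int q * of_int q' * of_int m) + of_int x * B / of_int l)\<bar> \<le> of_int m * (of_int q / of_int q')"
  proof -
    have gl: "real_of_int g * of_int l = of_int q' * of_int m" using l(2) by (metis of_int_mult)
    have qT: "of_int q / of_int l * (y\<^sup>2 / (2 * of_int g) + y * B) = of_int x ^ 2 / (2 * of_int q * (real_of_int g * of_int l)) + of_int x * B / of_int l"
      using q l(1) g(1) unfolding y_def by (simp add: field_simps power2_eq_square)
    have "\<bar>of_int q / of_int l * A - (of_int x ^ 2 / (2 * of_int q * (real_of_int g * of_int l)) + of_int x * B / of_int l)\<bar>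
       = of_int q / of_int l * \<bar>A - (y\<^sup>2 / (2 * of_int g) + y * B)\<bar>"
      unfolding qT[symmetric] right_diff_distrib[symmetric] abs_mult using q l(1) by simp
    also have "\<dots> \<le> of_int q / of_int l * of_int g" using A q l(1) by (intro mult_left_mono) auto
    also have "\<dots> \<le> of_int m * (of_int q / of_int q')"
    proof -
      have "q' * g \<le> m * l"
      proof -
        have "q' * g \<le> l * m" 
          using l(1) m g q' by (intro mult_mono) (auto simp: l_def intro: zdvd_imp_le)
        then show ?thesis by (simp add: mult.commute)
      qed
      then have "real_of_int q' * of_int g \<le> of_int m * of_int l" by (simp flip: of_int_mult)
      then have "of_int q * (real_of_int q' * of_int g) \<le> of_int q * (of_int m * of_int l)" using q by (intro mult_left_mono) auto
      then show ?thesis using q' l(1) by (simp add: field_simps)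
    qed
    finally show ?thesis unfolding gl by (simp add: mult.assoc)
  qed
  have W: "apsum m w x c = apsum m of_int x c / (of_int q * of_int q') - Z"
  proof -
    have "apsum m w x c = (\<Sum>e | e \<in> {0<..x} \<and> [e = c] (mod m). of_int e / (of_int q * of_int q') - real (card (N e)))"
      unfolding apsum_def N_def by (intro sum.cong refl w_eq) auto
    then show ?thesis unfolding sum_subtractf swap Z_def apsum_def by (simp add: sum_divide_distrib)
  qed
  have q1: "1 \<le> real_of_int q'" "1 \<le> real_of_int q" using q q' by auto
  have I: "\<bar>apsum m of_int x c / (of_int q * of_int q') - of_int x ^ 2 / (2 * of_int q * of_int q' * of_int m)\<bar> \<le> 2 * of_int x / of_int q + of_int m * (of_int q / of_int q')"
  proof -
    have "\<bar>apsum m of_int x c / (of_int q * of_int q') - of_int x ^ 2 / (2 * of_int q * of_int q' * of_int m)\<bar>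
      = \<bar>apsum m of_int x c - of_int x ^ 2 / (2 * of_int m)\<bar> / (of_int q * of_int q')"
      using q q' m by (simp add: abs_mult field_simps abs_divide flip: diff_divide_distrib)
    also have "\<dots> \<le> (2 * of_int x + of_int m) / (of_int q * of_int q')"
      using apsum_ident[OF m x, of c] q q' by (intro divide_right_mono) auto
    also have "\<dots> = 2 * of_int x / of_int q / of_int q' + of_int m / of_int q' / of_int q"
      by (simp add: add_divide_distrib)
    also have "\<dots> \<le> 2 * of_int x / of_int q / 1 + of_int m / of_int q' * of_int q"
    proof (intro add_mono)
      show "2 * real_of_int x / of_int q / of_int q' \<le> 2 * of_int x / of_int q / 1"
        using x q1 by (intro divide_left_mono) auto
      have "of_int m / real_of_int q' / of_int q \<le> of_int m / of_int q' / 1"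
        using m q1 by (intro divide_left_mono) auto
      also have "\<dots> \<le> of_int m / of_int q' * of_int q"
        using mult_left_mono[OF q1(2), of "of_int m / of_int q'"] m q1 by simp
      finally show "of_int m / real_of_int q' / of_int q \<le> of_int m / of_int q' * of_int q" by simp
    qed
    finally show ?thesis by simp
  qed
  have R: "rate c * of_int x = of_int x * (of_int (gcd q m) / of_int q * saw (of_int (p * c) / of_int (gcd q m)) / of_int m) - of_int x * B / of_int l"
  proof -
    have "real_of_int g * of_int l = of_int q' * of_int m" using l(2) by (metis of_int_mult)
    then have "of_int g / of_int q' / of_int m = 1 / real_of_int l" using l(1) q' m by (simp add: field_simps)
    then have "of_int g / of_int q' * B / of_int m = B / real_of_int l" by (metis divide_divide_eq_left mult.commute times_divide_eq_left mult_1)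
    then show ?thesis unfolding rate_def B_def g_def by (simp add: diff_divide_distrib algebra_simps)
  qed
  \<comment> \<open>The \<open>q\<close> part of \<open>rate\<close> has size at most
    \<open>1 / q\<close> and disappears in the error.\<close>
  have S: "\<bar>of_int x * (of_int (gcd q m) / of_int q * saw (of_int (p * c) / of_int (gcd q m)) / of_int m)\<bar> \<le> of_int x / of_int q"
  proof -
    have "gcd q m \<le> m" "gcd q m > 0" using m q by (auto simp: zdvd_imp_le)
    then have 1: "0 < real_of_int (gcd q m)" "real_of_int (gcd q m) \<le> of_int m" by auto
    have "\<bar>of_int x * (of_int (gcd q m) / of_int q * saw (of_int (p * c) / of_int (gcd q m)) / of_int m)\<bar>
      = of_int x / of_int q * (of_int (gcd q m) / of_int m * \<bar>saw (of_int (p * c) / of_int (gcd q m))\<bar>)"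
      using x q m 1(1) by (simp add: abs_mult)
    also have "\<dots> \<le> of_int x / of_int q * (1 * (1 / 2))"
    proof (intro mult_left_mono)
      have "real_of_int (gcd q m) / of_int m \<le> 1" using 1 m by (simp only: divide_le_eq_1) simp
      then show "of_int (gcd q m) / of_int m * \<bar>saw (of_int (p * c) / of_int (gcd q m))\<bar> \<le> 1 * (1 / 2)"
        by (rule mult_mono) (use abs_saw_le in auto)
    qed (use x q in simp)
    also have "\<dots> \<le> of_int x / of_int q"
      by (rule mult_left_le) (use x q in auto)
    finally show ?thesis .
  qed
  have e: "5 * of_int x / real_of_int q = 5 * (of_int x / of_int q)" "2 * of_int x / real_of_int q = 2 * (of_int x / of_int q)"
    "2 * of_int m * (real_of_int q / of_int q') = 2 * (of_int m * (of_int q / of_int q'))"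
    by simp_all
  have "\<bar>I - Z - (s - B)\<bar> \<le> 5 * X + 2 * Y"
    if "\<bar>Z - A\<bar> \<le> 2 * X" "\<bar>A - (T + B)\<bar> \<le> Y" "\<bar>I - T\<bar> \<le> 2 * X + Y" "\<bar>s\<bar> \<le> X" for I Z s B X Y A T :: real
    using that by linarith
  from this[OF Z1[unfolded Z2 e] Z3 I[unfolded e] S] show ?thesis unfolding W R e .
qed

text \<open>
  The bound \<open>apsum_w_asymp\<close> is good for small \<open>x\<close>; for larger \<open>x\<close> the error is periodic with period \<open>q * q' * m\<close>.
  The minimum is what makes the sum over \<open>x = Q div d\<close> in \<open>farey_sum_step\<close> free of a logarithm.
\<close>

lemma apsum_w_bound:
  assumes x: "x \<ge> 0"
  shows "\<bar>apsum m w x c - rate c * of_int x\<bar> \<le> 5 * of_int m * min (of_int x / of_int q) (of_int q') + 2 * of_int m * (of_int q / of_int q')"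
proof -
  define P where "P = q * q' * m"
  have P: "P > 0" using q q' m by (simp add: P_def)
  have m1: "1 \<le> real_of_int m" using m by simp
  have le1: "5 * of_int x / of_int q \<le> 5 * of_int m * (of_int x / real_of_int q)" if "x \<ge> 0" for x
    using mult_right_mono[OF m1, of "5 * (of_int x / real_of_int q)"] that q by (simp add: algebra_simps)
  define x0 where "x0 = x mod P"
  have x0: "0 \<le> x0" "x0 < P" using P by (auto simp: x0_def)
  obtain t where t: "x div P = int t" using x P by (metis nonneg_int_cases pos_imp_zdiv_nonneg_iff)
  have xt: "x = x0 + int t * P" using t unfolding x0_def by (metis add.commute div_mult_mod_eq)
  have "apsum m w x c - rate c * of_int x = apsum m w x0 c - rate c * of_int x0"
    using apsum_w_period[OF x0(1), of t c] unfolding P_def[symmetric] xt by (simp add: algebra_simps)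
  also have "\<bar>\<dots>\<bar> \<le> 5 * of_int x0 / of_int q + 2 * of_int m * (of_int q / of_int q')"
    by (rule apsum_w_asymp[OF x0(1)])
  also have "5 * of_int x0 / real_of_int q \<le> 5 * of_int m * of_int q'"
  proof -
    have "real_of_int x0 \<le> of_int q * of_int q' * of_int m" using x0(2) unfolding P_def
      by (metis less_imp_le of_int_le_iff of_int_mult)
    then show ?thesis using q by (simp add: field_simps)
  qed
  finally show ?thesis using apsum_w_asymp[OF x, of c] le1[OF x] by (simp add: min_def)
qed

end

subsection \<open>Weighted sums over Farey denominators\<close>

text \<open>For \<open>F e = frac (\<alpha> * e)\<close> this is the error sum over all denominators
  in the class of \<open>c\<close>, before the \<open>k\<close>-free condition. It is linear in
  \<open>F\<close>, so that the sums at two neighbouring fractions can be subtracted.\<close>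

definition farey_sum :: "nat \<Rightarrow> (int \<Rightarrow> real) \<Rightarrow> nat \<Rightarrow> int \<Rightarrow> real" where
  "farey_sum m F Q c = (\<Sum>n | n \<in> {1..Q} \<and> [int n = c] (mod int m). \<Sum>d | d dvd n. moebius d * F (int (n div d)))"

lemma farey_sum_diff: "farey_sum m (\<lambda>e. F e - G e) Q c = farey_sum m F Q c - farey_sum m G Q c"
  by (simp add: farey_sum_def sum_subtractf right_diff_distrib)

lemma farey_sum_add: "farey_sum m (\<lambda>e. F e + G e) Q c = farey_sum m F Q c + farey_sum m G Q c"
  by (simp add: farey_sum_def sum.distrib distrib_left)

lemma farey_sum_scale: "farey_sum m (\<lambda>e. a * F e) Q c = a * farey_sum m F Q c"
  by (simp add: farey_sum_def sum_distrib_left mult.left_commute)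

lemma farey_sum_cong:
  assumes "\<And>e. 1 \<le> e \<Longrightarrow> e \<le> int Q \<Longrightarrow> F e = G e"
  shows "farey_sum m F Q c = farey_sum m G Q c"
proof -
  have "F (int (n div d)) = G (int (n div d))" if "n \<in> {1..Q}" "d dvd n" for n d
  proof (rule assms)
    have "n div d > 0" using that by (auto elim!: dvdE)
    then show "1 \<le> int (n div d)" by simp
    have "n div d \<le> Q" using that by (auto intro: order_trans[OF div_le_dividend])
    then show "int (n div d) \<le> int Q" by simp
  qed
  then show ?thesis unfolding farey_sum_def by (intro sum.cong refl) auto
qed

text \<open>With \<open>n = d * e\<close>, the unit class of \<open>n\<close> forces
  \<open>d\<close> to be a unit modulo \<open>m\<close> and puts \<open>e\<close> into the class of
  \<open>c\<close> times the inverse of \<open>d\<close>.\<close>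

lemma farey_sum_eq:
  assumes m: "m \<ge> 1" and c: "coprime c (int m)"
  shows "farey_sum m F Q c =
    (\<Sum>d | d \<in> {1..Q} \<and> coprime d m. moebius d * apsum (int m) F (int (Q div d)) (c * modinv m d))"
proof -
  have "farey_sum m F Q c =
      (\<Sum>n\<in>{n \<in> {1..Q}. [int n = c] (mod int m)}. \<Sum>d | d dvd n. (\<lambda>d e. moebius d * F (int e)) d (n div d))"
    by (simp only: farey_sum_def)
  also have "\<dots> = (\<Sum>d\<in>{1..Q}. \<Sum>e\<in>{e \<in> {1..Q div d}. [int (d * e) = c] (mod int m)}. moebius d * F (int e))"
    by (rule sum_moebius_hyperbola)
  also have "\<dots> = (\<Sum>d\<in>{1..Q}. if coprime d m then moebius d * apsum (int m) F (int (Q div d)) (c * modinv m d) else 0)"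
  proof (intro sum.cong refl)
    fix d assume "d \<in> {1..Q}"
    show "(\<Sum>e\<in>{e \<in> {1..Q div d}. [int (d * e) = c] (mod int m)}. moebius d * F (int e)) =
        (if coprime d m then moebius d * apsum (int m) F (int (Q div d)) (c * modinv m d) else 0)"
    proof (cases "coprime d m")
      case True
      note inv = modinv[OF True]
      have iff: "[int (d * e) = c] (mod int m) \<longleftrightarrow> [int e = c * modinv m d] (mod int m)" for e
      proof
        assume "[int (d * e) = c] (mod int m)"
        then have "[modinv m d * (int d * int e) = modinv m d * c] (mod int m)"
          by (intro cong_scalar_left) simp
        moreover have "[int d * modinv m d * int e = 1 * int e] (mod int m)" using inv by (rule cong_scalar_right)
        ultimately show "[int e = c * modinv m d] (mod int m)"
          by (metis cong_sym cong_trans mult.assoc mult.commute mult_1)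
      next
        assume "[int e = c * modinv m d] (mod int m)"
        then have "[int d * int e = int d * (c * modinv m d)] (mod int m)" by (rule cong_scalar_left)
        moreover have "[int d * modinv m d * c = 1 * c] (mod int m)" using inv by (rule cong_scalar_right)
        ultimately show "[int (d * e) = c] (mod int m)"
          by (metis cong_trans mult.assoc mult.commute mult_1 of_nat_mult)
      qed
      have "(\<Sum>e\<in>{e \<in> {1..Q div d}. [int (d * e) = c] (mod int m)}. moebius d * F (int e)) =
          (\<Sum>e | e \<in> {0<..int (Q div d)} \<and> [e = c * modinv m d] (mod int m). moebius d * F e)"
        unfolding iff
        by (rule sum.reindex_bij_witness[of _ nat int]) auto
      then show ?thesis using True by (simp add: apsum_def sum_distrib_left)
    next
      case False
      have "\<not> [int (d * e) = c] (mod int m)" for e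
      proof
        assume "[int (d * e) = c] (mod int m)"
        then have "coprime (int (d * e)) (int m)" using c cong_imp_coprime cong_sym by blast
        then show False using False by simp
      qed
      then show ?thesis using False by simp
    qed
  qed
  also have "\<dots> = (\<Sum>d\<in>{d \<in> {1..Q}. coprime d m}. moebius d * apsum (int m) F (int (Q div d)) (c * modinv m d))"
    by (rule sum.inter_filter[symmetric]) simp
  finally show ?thesis by simp
qed

lemma abs_apsum_le:
  assumes "x \<ge> 0" "\<And>e. 0 < e \<Longrightarrow> e \<le> x \<Longrightarrow> \<bar>F e\<bar> \<le> B" "B \<ge> 0"
  shows "\<bar>apsum m F x c\<bar> \<le> of_int x * B"
proof -
  let ?S = "{e. e \<in> {0<..x} \<and> [e = c] (mod m)}"
  have "\<bar>apsum m F x c\<bar> \<le> (\<Sum>e\<in>?S. B)"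
    unfolding apsum_def by (rule order_trans[OF sum_abs]) (intro sum_mono assms; auto)
  also have "\<dots> \<le> (\<Sum>e\<in>{0<..x}. B)" using assms(3) by (intro sum_mono2) auto
  also have "\<dots> = of_int x * B" using assms(1) by simp
  finally show ?thesis .
qed

text \<open>Telescoping against \<open>2 / (n + 1) - 2 / (n + 2)\<close>. The factor 2 makes the
  comparison valid from \<open>n = 0\<close> on, so \<open>k = 0\<close> bounds the whole sum by
  2.\<close>

lemma sum_inverse_squares_tail:
  "(\<Sum>d\<in>{k<..n}. 1 / real d ^ 2) \<le> 2 / (real k + 1)"
proof -
  have "(\<Sum>d\<in>{k<..n}. 1 / real d ^ 2) \<le> 2 / (real k + 1) - 2 / (real n + 1)" if "k \<le> n"
    using that
  proof (induction n rule: dec_induct)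
    case (step n)
    have "1 / (real n + 1) ^ 2 \<le> 2 / (real n + 1) - 2 / (real n + 2)"
      by (simp add: divide_simps power2_eq_square)
    moreover have "{k<..Suc n} = insert (Suc n) {k<..n}" using step by auto
    ultimately show ?case using step by (simp add: add.commute)
  qed simp
  moreover have "0 \<le> 2 / (real n + 1)" by simp
  ultimately show ?thesis
  proof (cases "k \<le> n")
    case True
    then show ?thesis using \<open>k \<le> n \<Longrightarrow> _\<close> \<open>0 \<le> 2 / (real n + 1)\<close> by linarith
  qed simp
qed

lemma sum_inverse_sqrt: "(\<Sum>d=1..n. 1 / sqrt (real d)) \<le> 2 * sqrt (real n)"
proof (induction n)
  case (Suc n)
  define a b where "a = sqrt (real n)" and "b = sqrt (real (Suc n))"
  have b: "b > 0" "a \<ge> 0" "b\<^sup>2 = a\<^sup>2 + 1" by (simp_all add: a_def b_def)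
  have "0 \<le> (b - a)\<^sup>2" by simp
  then have "1 \<le> (2 * b - 2 * a) * b" using b by (simp add: power2_eq_square algebra_simps)
  then have "1 / b \<le> 2 * b - 2 * a" using b by (simp add: pos_divide_le_eq)
  then show ?case using Suc by (simp add: a_def b_def)
qed simp

text \<open>The \<open>d\<close> with \<open>q dvd n div d\<close> are the divisors of
  \<open>n div q\<close>, so inversion leaves only \<open>n = q\<close>. Corrections at the jumps of
  \<open>frac\<close>, where \<open>q\<close> divides \<open>e\<close>, thus affect a single
  denominator.\<close>

lemma sum_moebius_dvd:
  assumes "n > 0" "q > 0"
  shows "(\<Sum>d | d dvd n. moebius d * (if q dvd int (n div d) then 1 else 0)) = (if int n = q then 1 else 0)"
proof (cases "q dvd int n")
  case True
  obtain r where r: "q = int r" "r > 0" using assms(2) by (metis zero_less_imp_eq_int)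
  then have rn: "r dvd n" using True by simp
  have "{d \<in> {d. d dvd n}. q dvd int (n div d)} = {d. d dvd n div r}"
    using r rn assms(1) by (auto simp: dvd_div_iff_mult elim!: dvdE[of _ n])
  then have "(\<Sum>d | d dvd n. moebius d * (if q dvd int (n div d) then 1 else 0)) = (\<Sum>d | d dvd n div r. moebius d)"
    using assms(1) by (simp add: if_distrib[of "(*) _"] sum.inter_filter[symmetric] cong: if_cong)
  also have "\<dots> = (if n div r = 1 then 1 else 0)"
    using rn assms(1) r by (intro sum_moebius_divisors) (auto elim!: dvdE)
  also have "n div r = 1 \<longleftrightarrow> int n = q" using rn r by (auto elim!: dvdE)
  finally show ?thesis .
next
  case False
  have "\<not> q dvd int (n div d)" if "d dvd n" for d
  proof
    assume "q dvd int (n div d)"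
    then have "q dvd int (n div d * d)" by simp
    then show False using False that by simp
  qed
  moreover have "int n \<noteq> q" using False by auto
  ultimately show ?thesis by simp
qed

lemma farey_sum_dvd_bound:
  assumes "q > 0"
  shows "\<bar>farey_sum m (\<lambda>e. if q dvd e then 1 else 0) Q c\<bar> \<le> 1"
proof -
  let ?S = "{n. n \<in> {1..Q} \<and> [int n = c] (mod int m)}"
  have fin: "finite ?S" by (rule finite_subset[of _ "{1..Q}"]) auto
  have "farey_sum m (\<lambda>e. if q dvd e then 1 else 0) Q c = (\<Sum>n\<in>?S. if n = nat q then 1 else 0)"
    unfolding farey_sum_def using assms by (intro sum.cong refl) (subst sum_moebius_dvd, auto)
  also have "\<dots> = (if nat q \<in> ?S then 1 else 0)" using fin by (rule sum.delta)
  finally show ?thesis by (simp del: One_nat_def)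
qed

lemma farey_sum_step:
  assumes m1: "m \<ge> 1"
  shows "\<exists>C\<ge>0. \<forall>Q c p q p' q'. coprime c (int m) \<longrightarrow> p * q' - p' * q = 1 \<longrightarrow> 0 < q' \<longrightarrow> q' \<le> q \<longrightarrow> q \<le> int Q \<longrightarrow>
    \<bar>farey_sum m (\<lambda>e. frac (of_int (p * e) / of_int q)) Q c - farey_sum m (\<lambda>e. frac (of_int (p' * e) / of_int q')) Q c\<bar>
      \<le> C * (real Q / sqrt (of_int q'))"
proof -
  obtain K where K: "K \<ge> 0" "\<And>Y g a c. g dvd m \<Longrightarrow> coprime a (int g) \<Longrightarrow> coprime c (int m) \<Longrightarrow>
    \<bar>\<Sum>d | d \<in> {1..Y} \<and> coprime d m. moebius d / real d * (frac (of_int (a * (c * modinv m d)) / real g) - 1 / 2)\<bar> \<le> K"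
    using moebius_frac_inv_bounded[OF m1] by blast
  show ?thesis
  \<comment> \<open>The slopes contribute \<open>2 * K\<close>, the errors for small
    \<open>d\<close> contribute \<open>12 * m + 1\<close>, and the large \<open>d\<close> contribute
    2.\<close>
  proof (intro exI[of _ "2 * K + 12 * real m + 3"] conjI allI impI)
    show "0 \<le> 2 * K + 12 * real m + 3" using K(1) by simp
    fix Q :: nat and c p q p' q' :: int
    assume c: "coprime c (int m)" and det: "p * q' - p' * q = 1" and q': "0 < q'" "q' \<le> q" and qQ: "q \<le> int Q"
    interpret farey_neighbours "int m" p q p' q'
      by unfold_locales (use m1 det q' in auto)
    define cd where "cd d = c * modinv m d" for d
    \<comment> \<open>For \<open>d <= D0\<close> the range of \<open>e\<close> reaches
      \<open>q\<close>. For \<open>d > D0\<close> one has \<open>Q div d < q\<close>, so no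
      \<open>v\<close> is counted and \<open>w\<close> is exactly linear.\<close>
    define D0 where "D0 = nat (int Q div q)"
    define s where "s = sqrt (of_int q')"
    define rq where "rq = real_of_int q"
    define rq' where "rq' = real_of_int q'"
    have r: "1 \<le> rq'" "rq' \<le> rq" "rq \<le> real Q" "rq' = s * s" "1 \<le> s"
      using q' qQ by (auto simp: rq_def rq'_def s_def)
    have s: "s \<le> rq'" using r by (simp add: mult_left_le)
    have D0: "int D0 = int Q div q" using q by (simp add: D0_def pos_imp_zdiv_nonneg_iff)
    have D0': "real D0 * rq \<le> real Q" "real Q < (real D0 + 1) * rq"
    proof -
      have "int D0 * q \<le> int Q" using int_div_less_iff[OF q, of "int Q" "int D0"] D0 by simp
      then show "real D0 * rq \<le> real Q" unfolding rq_def by (metis of_int_le_iff of_int_mult of_int_of_nat_eq)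
      have "int Q < (int D0 + 1) * q" using int_div_less_iff[OF q, of "int Q" "int D0 + 1"] D0 by simp
      then have "real_of_int (int Q) < of_int ((int D0 + 1) * q)" by (simp only: of_int_less_iff)
      then show "real Q < (real D0 + 1) * rq" unfolding rq_def by simp
    qed
    have D0q: "real D0 \<le> real Q / rq" using D0' r by (simp add: pos_le_divide_eq)
    have D0Q: "D0 \<le> Q" 
    proof -
      have "real D0 * 1 \<le> real D0 * rq" using r by (intro mult_left_mono) auto
      then show ?thesis using D0'(1) by linarith
    qed
    define E where "E d = moebius d * apsum (int m) w (int (Q div d)) (cd d)" for d
    define R where "R d = moebius d * (rate (cd d) * (real Q / real d))" for d
    let ?D1 = "{d. d \<in> {1..D0} \<and> coprime d m}"
    let ?D2 = "{d. d \<in> {D0<..Q} \<and> coprime d m}"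
    have fin: "finite ?D1" "finite ?D2"
      by (auto intro: finite_subset[of ?D1 "{1..D0}"] finite_subset[of ?D2 "{D0<..Q}"])
    have "farey_sum m (\<lambda>e. frac (of_int (p * e) / of_int q)) Q c - farey_sum m (\<lambda>e. frac (of_int (p' * e) / of_int q')) Q c
      = farey_sum m w Q c"
      unfolding farey_sum_diff[symmetric] by (rule farey_sum_cong) (simp only: w_def)
    also have "\<dots> = (\<Sum>d | d \<in> {1..Q} \<and> coprime d m. E d)"
      unfolding E_def cd_def by (rule farey_sum_eq[OF m1 c])
    also have "{d. d \<in> {1..Q} \<and> coprime d m} = ?D1 \<union> ?D2" using D0Q by auto
    also have "(\<Sum>d\<in>?D1 \<union> ?D2. E d) = (\<Sum>d\<in>?D1. E d) + (\<Sum>d\<in>?D2. E d)"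
      by (rule sum.union_disjoint) (use fin in auto)
    also have "(\<Sum>d\<in>?D1. E d) = (\<Sum>d\<in>?D1. R d) + (\<Sum>d\<in>?D1. E d - R d)"
      by (simp add: sum_subtractf)
    finally have total: "farey_sum m (\<lambda>e. frac (of_int (p * e) / of_int q)) Q c - farey_sum m (\<lambda>e. frac (of_int (p' * e) / of_int q')) Q c
      = (\<Sum>d\<in>?D1. R d) + (\<Sum>d\<in>?D1. E d - R d) + (\<Sum>d\<in>?D2. E d)" .
    \<comment> \<open>Here the cancellation over \<open>d\<close> enters: the Moebius sums are at
      most \<open>K\<close>, and the factors in front of them at most \<open>m / q'\<close>.\<close>
    have A: "\<bar>\<Sum>d\<in>?D1. R d\<bar> \<le> 2 * K * (real Q / s)"
    proof -
      have S: "\<bar>of_int (gcd r (int m)) / of_int r * (\<Sum>d\<in>?D1. moebius d / real d * saw (of_int (a * cd d) / of_int (gcd r (int m))))\<bar>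
          \<le> real m * (K / s)" if r0: "coprime a r" "q' \<le> r" for a r
      proof -
        define g where "g = nat (gcd r (int m))"
        have rp: "r > 0" using r0 q' by simp
        have g: "int g = gcd r (int m)" using rp by (simp add: g_def)
        have gm: "g dvd m" using g by (metis gcd_dvd2 int_dvd_int_iff)
        have "coprime a (int g)" unfolding g by (rule coprime_divisors[OF dvd_refl _ r0(1)]) simp
        then have 1: "\<bar>\<Sum>d\<in>?D1. moebius d / real d * saw (of_int (a * cd d) / of_int (gcd r (int m)))\<bar> \<le> K"
          using K(2)[OF gm _ c, of a D0] unfolding saw_def cd_def g[symmetric] by simp
        have "g \<le> m" using gm m by (auto intro: dvd_imp_le)
        then have "of_int (gcd r (int m)) / of_int r \<le> real m / rq'"
          unfolding g[symmetric] rq'_def using r0 q' by (intro frac_le) auto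
        also have "\<dots> \<le> real m / s" using r s by (intro divide_left_mono) auto
        finally have "of_int (gcd r (int m)) / of_int r * \<bar>\<Sum>d\<in>?D1. moebius d / real d * saw (of_int (a * cd d) / of_int (gcd r (int m)))\<bar> \<le> real m / s * K"
          by (rule mult_mono) (use 1 r in auto)
        then show ?thesis using rp by (simp add: abs_mult)
      qed
      have "(\<Sum>d\<in>?D1. R d) = real Q / real m * 
         (of_int (gcd q (int m)) / of_int q * (\<Sum>d\<in>?D1. moebius d / real d * saw (of_int (p * cd d) / of_int (gcd q (int m))))
         - of_int (gcd q' (int m)) / of_int q' * (\<Sum>d\<in>?D1. moebius d / real d * saw (of_int (p' * cd d) / of_int (gcd q' (int m)))))"
        unfolding R_def rate_def sum_distrib_left sum_subtractf[symmetric]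
        by (intro sum.cong refl) (simp add: diff_divide_distrib algebra_simps)
      also have "\<bar>\<dots>\<bar> \<le> real Q / real m * (real m * (K / s) + real m * (K / s))"
      proof -
        have tr: "\<bar>t * (a - b)\<bar> \<le> t * (u + u)" if "\<bar>a\<bar> \<le> u" "\<bar>b\<bar> \<le> u" "t \<ge> 0" for a b t u :: real
          using that by (simp add: abs_mult mult_left_mono)
        show ?thesis by (rule tr[OF S[OF coprimes(1) q'(2)] S[OF coprimes(2) order_refl]]) simp
      qed
      also have "\<dots> = 2 * K * (real Q / s)" using m by (simp add: field_simps)
      finally show ?thesis .
    qed
    have B: "\<bar>\<Sum>d\<in>?D1. E d - R d\<bar> \<le> (12 * real m + 1) * (real Q / s)"
    proof -
      have Bd: "\<bar>E d - R d\<bar> \<le> 5 * real m * (sqrt (real Q * rq' / rq) * (1 / sqrt (real d))) + (2 * real m * (rq / rq') + 1 / rq')"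
        if d: "d \<in> {1..D0}" for d
      proof -
        define x where "x = Q div d"
        have d0: "d > 0" using d by auto
        have x: "real x \<le> real Q / real d" "real Q / real d \<le> real x + 1"
          using floor_divide_of_nat_eq[of Q d, where 'a = real] of_int_floor_le[of "real Q / real d"] 
            real_of_int_floor_add_one_ge[of "real Q / real d"] by (auto simp: x_def)
        have "\<bar>apsum (int m) w (int x) (cd d) - rate (cd d) * real x\<bar> \<le> 5 * real m * min (real x / rq) rq' + 2 * real m * (rq / rq')"
          using apsum_w_bound[of "int x" "cd d"] unfolding rq_def rq'_def by simp
        \<comment> \<open>The minimum is at most the geometric mean. Summed over \<open>d\<close>,
          the first entry alone would give \<open>Q / q\<close> times a logarithm, and the second
          \<open>Q * q' / q\<close>, which need not decay along the chain; the mean gives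
          \<open>2 * Q * sqrt q' / q\<close>, at most \<open>2 * Q / sqrt q'\<close>.\<close>
        also have "min (real x / rq) rq' \<le> sqrt (real Q * rq' / rq) * (1 / sqrt (real d))"
        proof -
          have "min (real x / rq) rq' = sqrt (min (real x / rq) rq' * min (real x / rq) rq')" using r by simp
          also have "\<dots> \<le> sqrt (real x / rq * rq')" using r by (intro real_sqrt_le_mono mult_mono) auto
          also have "\<dots> \<le> sqrt ((real Q / real d) / rq * rq')"
            using x r by (intro real_sqrt_le_mono mult_right_mono divide_right_mono) auto
          also have "(real Q / real d) / rq * rq' = real Q * rq' / rq * (1 / real d)" by simp
          also have "sqrt \<dots> = sqrt (real Q * rq' / rq) * (1 / sqrt (real d))"
            by (simp only: real_sqrt_mult real_sqrt_divide real_sqrt_one)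
          finally show ?thesis .
        qed
        finally have 1: "\<bar>apsum (int m) w (int x) (cd d) - rate (cd d) * real x\<bar> \<le> 5 * real m * (sqrt (real Q * rq' / rq) * (1 / sqrt (real d))) + 2 * real m * (rq / rq')"
          by (simp add: mult_left_mono)
        have "\<bar>rate (cd d) * (real x - real Q / real d)\<bar> \<le> 1 / rq' * 1"
          unfolding abs_mult using abs_rate_le[of "cd d"] x r unfolding rq'_def by (intro mult_mono) auto
        then have 2: "\<bar>apsum (int m) w (int x) (cd d) - rate (cd d) * (real Q / real d)\<bar> \<le> 5 * real m * (sqrt (real Q * rq' / rq) * (1 / sqrt (real d))) + (2 * real m * (rq / rq') + 1 / rq')"
          using 1 unfolding right_diff_distrib by linarith
        have "\<bar>E d - R d\<bar> = \<bar>moebius d\<bar> * \<bar>apsum (int m) w (int x) (cd d) - rate (cd d) * (real Q / real d)\<bar>"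
          unfolding E_def R_def x_def[symmetric] by (simp only: right_diff_distrib[symmetric] abs_mult)
        also have "\<dots> \<le> 1 * \<bar>apsum (int m) w (int x) (cd d) - rate (cd d) * (real Q / real d)\<bar>"
          by (intro mult_right_mono abs_moebius_le) auto
        finally show ?thesis using 2 unfolding mult_1 by (rule order_trans)
      qed
      have nn: "0 \<le> sqrt (real Q * rq' / rq)" "0 \<le> rq / rq'" "0 \<le> 1 / rq'" using r by auto
      have "\<bar>\<Sum>d\<in>?D1. E d - R d\<bar> \<le> (\<Sum>d\<in>?D1. 5 * real m * (sqrt (real Q * rq' / rq) * (1 / sqrt (real d))) + (2 * real m * (rq / rq') + 1 / rq'))"
        by (rule order_trans[OF sum_abs], rule sum_mono, rule Bd) auto
      also have "\<dots> \<le> (\<Sum>d\<in>{1..D0}. 5 * real m * (sqrt (real Q * rq' / rq) * (1 / sqrt (real d))) + (2 * real m * (rq / rq') + 1 / rq'))"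
        using nn r(1,2) by (intro sum_mono2) (auto intro!: add_nonneg_nonneg mult_nonneg_nonneg divide_nonneg_nonneg)
      also have "\<dots> = 5 * real m * (sqrt (real Q * rq' / rq) * (\<Sum>d=1..D0. 1 / sqrt (real d))) + real D0 * (2 * real m * (rq / rq') + 1 / rq')"
        by (simp add: sum.distrib sum_distrib_left del: One_nat_def)
      also have "\<dots> \<le> 5 * real m * (2 * (real Q / s)) + (2 * real m * (real Q / s) + real Q / s)"
      proof (intro add_mono mult_left_mono)
        have "(\<Sum>d=1..D0. 1 / sqrt (real d)) \<le> 2 * sqrt (real Q / rq)"
          using sum_inverse_sqrt[of D0] real_sqrt_le_mono[OF D0q] by linarith
        then have "sqrt (real Q * rq' / rq) * (\<Sum>d=1..D0. 1 / sqrt (real d)) \<le> sqrt (real Q * rq' / rq) * (2 * sqrt (real Q / rq))"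
          using nn(1) by (rule mult_left_mono)
        also have "\<dots> = 2 * sqrt ((real Q * rq' / rq) * (real Q / rq))" by (simp only: real_sqrt_mult)
        also have "(real Q * rq' / rq) * (real Q / rq) = (real Q * s / rq)\<^sup>2"
          unfolding r(4) by (simp add: power2_eq_square)
        also have "sqrt \<dots> = real Q * s / rq" using r by simp
        also have "real Q * s / rq \<le> real Q * s / rq'" using r by (intro divide_left_mono) auto
        also have "\<dots> = real Q / s" using r by simp
        finally show "sqrt (real Q * rq' / rq) * (\<Sum>d=1..D0. 1 / sqrt (real d)) \<le> 2 * (real Q / s)" by simp
        have "real D0 * (2 * real m * (rq / rq') + 1 / rq') \<le> real Q / rq * (2 * real m * (rq / rq') + 1 / rq')"
          using nn by (intro mult_right_mono D0q add_nonneg_nonneg mult_nonneg_nonneg) auto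
        also have "\<dots> = 2 * real m * (real Q / rq') + real Q / rq / rq'" using r by (simp add: field_simps)
        also have "\<dots> \<le> 2 * real m * (real Q / s) + real Q / 1 / s"
          using r(1-3,5) s by (intro add_mono mult_left_mono divide_left_mono frac_le) auto
        finally show "real D0 * (2 * real m * (rq / rq') + 1 / rq') \<le> 2 * real m * (real Q / s) + real Q / s" by simp
      qed auto
      also have "\<dots> = (12 * real m + 1) * (real Q / s)" by (simp add: algebra_simps)
      finally show ?thesis .
    qed
    \<comment> \<open>Linearity of \<open>w\<close> bounds each term by
      \<open>(Q / d) ^ 2 / (q * q')\<close>, and the tail of the inverse squares beyond
      \<open>D0\<close> is at most \<open>2 * q / Q\<close>.\<close>
    have C: "\<bar>\<Sum>d\<in>?D2. E d\<bar> \<le> 2 * (real Q / s)"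
    proof -
      have Ed: "\<bar>E d\<bar> \<le> real Q ^ 2 / (rq * rq') * (1 / real d ^ 2)" if d: "d \<in> {D0<..Q}" for d
      proof -
        define x where "x = Q div d"
        have d0: "d > 0" using d by auto
        have x1: "real x \<le> real Q / real d"
          using floor_divide_of_nat_eq[of Q d, where 'a = real] of_int_floor_le[of "real Q / real d"] by (auto simp: x_def)
        have "real Q < real d * rq"
        proof -
          have "real D0 + 1 \<le> real d" using d by auto
          then have "(real D0 + 1) * rq \<le> real d * rq" using r by (intro mult_right_mono) auto
          then show ?thesis using D0' by linarith
        qed
        then have "real Q / real d < rq" using d0 by (simp add: pos_divide_less_eq mult.commute)
        then have "real_of_int (int x) < of_int q" using x1 unfolding rq_def by simp
        then have xq: "int x < q" by (simp only: of_int_less_iff)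
        have "\<bar>w e\<bar> \<le> real x / (rq * rq')" if e: "0 < e" "e \<le> int x" for e
        proof -
          have "w e = of_int e / (rq * rq')" unfolding rq_def rq'_def using e xq by (intro w_small) auto
          moreover have "real_of_int e \<le> real x" "0 \<le> real_of_int e" using e by linarith+
          ultimately show ?thesis using r by (simp add: divide_right_mono)
        qed
        then have "\<bar>apsum (int m) w (int x) (cd d)\<bar> \<le> of_int (int x) * (real x / (rq * rq'))"
          using r by (intro abs_apsum_le) auto
        also have "\<dots> = real x ^ 2 / (rq * rq')" by (simp add: power2_eq_square)
        also have "\<dots> \<le> (real Q / real d) ^ 2 / (rq * rq')" using x1 r by (intro divide_right_mono power_mono) auto
        finally have "\<bar>moebius d\<bar> * \<bar>apsum (int m) w (int x) (cd d)\<bar> \<le> 1 * ((real Q / real d) ^ 2 / (rq * rq'))"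
          using abs_moebius_le by (intro mult_mono) auto
        then show ?thesis unfolding E_def x_def by (simp add: abs_mult power_divide mult.commute)
      qed
      have nn: "0 \<le> real Q ^ 2 / (rq * rq')" using r by auto
      have "\<bar>\<Sum>d\<in>?D2. E d\<bar> \<le> (\<Sum>d\<in>?D2. real Q ^ 2 / (rq * rq') * (1 / real d ^ 2))"
        by (rule order_trans[OF sum_abs], rule sum_mono, rule Ed) auto
      also have "\<dots> \<le> (\<Sum>d\<in>{D0<..Q}. real Q ^ 2 / (rq * rq') * (1 / real d ^ 2))"
        by (intro sum_mono2 mult_nonneg_nonneg nn) auto
      also have "\<dots> = real Q ^ 2 / (rq * rq') * (\<Sum>d\<in>{D0<..Q}. 1 / real d ^ 2)" by (simp only: sum_distrib_left)
      also have "\<dots> \<le> real Q ^ 2 / (rq * rq') * (2 * (rq / real Q))"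
      proof (intro mult_left_mono nn)
        have "2 / (real D0 + 1) \<le> 2 / (real Q / rq)"
        proof (rule divide_left_mono)
          have "0 < real Q" "0 < rq" using r(1-3) by linarith+
          then show "real Q / rq \<le> real D0 + 1" "0 < (real D0 + 1) * (real Q / rq)"
            using D0'(2) by (simp_all add: pos_divide_le_eq)
        qed simp
        then show "(\<Sum>d\<in>{D0<..Q}. 1 / real d ^ 2) \<le> 2 * (rq / real Q)"
          using sum_inverse_squares_tail[of D0 Q] by simp
      qed
      also have "\<dots> = 2 * (real Q / rq')" using r by (simp add: field_simps power2_eq_square)
      also have "\<dots> \<le> 2 * (real Q / s)" using r s by (intro mult_left_mono divide_left_mono) auto
      finally show ?thesis .
    qed
    have "\<bar>(\<Sum>d\<in>?D1. R d) + (\<Sum>d\<in>?D1. E d - R d) + (\<Sum>d\<in>?D2. E d)\<bar>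
       \<le> 2 * K * (real Q / s) + (12 * real m + 1) * (real Q / s) + 2 * (real Q / s)"
      using A B C by (intro abs_triangle_ineq[THEN order_trans] add_mono)
    also have "\<dots> = (2 * K + 12 * real m + 3) * (real Q / s)" by (simp add: algebra_simps)
    finally show "\<bar>farey_sum m (\<lambda>e. frac (of_int (p * e) / of_int q)) Q c - farey_sum m (\<lambda>e. frac (of_int (p' * e) / of_int q')) Q c\<bar>
      \<le> (2 * K + 12 * real m + 3) * (real Q / sqrt (of_int q'))"
      unfolding total s_def .
  qed
qed

section \<open>From neighbouring fractions to arbitrary \<open>\<alpha>\<close>\<close>

text \<open>\<open>q'\<close> is the inverse of \<open>p\<close> modulo \<open>q\<close> or its
  negative, whichever is at most \<open>q / 2\<close>. This choice is what leaves the sign of the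
  determinant open.\<close>

lemma farey_parent:
  fixes p q :: int
  assumes "coprime p q" "q \<ge> 2"
  obtains p' q' where "0 < q'" "2 * q' \<le> q" "p * q' - p' * q = 1 \<or> p * q' - p' * q = -1"
proof -
  obtain u where u: "[p * u = 1] (mod q)" using assms coprime_iff_invertible_int by blast
  define r where "r = u mod q"
  have "[p * r = 1] (mod q)"
    unfolding r_def using u by (simp add: cong_iff_mod_eq mod_mult_right_eq)
  then obtain k where k: "p * r - 1 = q * k" by (auto simp: cong_iff_dvd_diff)
  have r: "0 \<le> r" "r < q" using assms by (auto simp: r_def)
  have "r \<noteq> 0"
  proof
    assume "r = 0"
    then have "q dvd 1" using k by (metis dvd_triv_left dvd_minus_iff diff_0 mult_zero_right)
    then show False using assms by auto
  qed
  show ?thesis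
  proof (cases "2 * r \<le> q")
    case True
    show ?thesis by (rule that[of r k]) (use True r \<open>r \<noteq> 0\<close> k in \<open>auto simp: algebra_simps\<close>)
  next
    case False
    show ?thesis by (rule that[of "q - r" "p - k"]) (use False r k in \<open>auto simp: algebra_simps\<close>)
  qed
qed

text \<open>Reflecting both fractions turns determinant -1 into 1; the indicator corrects the
  integers, where \<open>frac\<close> is not antisymmetric about 1/2.\<close>

lemma frac_uminus_int_div:
  fixes p q e :: int
  assumes "q > 0" "coprime p q"
  shows "frac (of_int (- p * e) / real_of_int q) = (1 - (if q dvd e then 1 else 0)) - frac (of_int (p * e) / of_int q)"
proof -
  have "of_int (p * e) / real_of_int q \<in> \<int> \<longleftrightarrow> q dvd e"
  proof -
    have "of_int (p * e) / real_of_int q \<in> \<int> \<longleftrightarrow> (p * e) mod q = 0"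
      unfolding frac_eq_0_iff[symmetric] frac_int_int_div[OF assms(1)] using assms(1) by simp
    also have "\<dots> \<longleftrightarrow> q dvd p * e" by (simp add: mod_eq_0_iff_dvd)
    also have "\<dots> \<longleftrightarrow> q dvd e" using assms(2) coprime_commute coprime_dvd_mult_right_iff by blast
    finally show ?thesis .
  qed
  then show ?thesis using frac_neg[of "of_int (p * e) / real_of_int q"] by simp
qed

lemma farey_sum_1_bound: "\<bar>farey_sum m (\<lambda>_. 1) Q c\<bar> \<le> 1"
  using farey_sum_dvd_bound[of 1 m Q c] by simp

text \<open>
  The bounds for the steps from \<open>q\<close> to a parent \<open>q' \<le> q / 2\<close> form a geometric series. The induction keeps track of
  it through the factor \<open>1 - 1 / sqrt q\<close>.
\<close>

lemma farey_sum_rational_bound: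
  assumes m: "m \<ge> 1"
  shows "\<exists>A\<ge>0. \<forall>Q c p q. coprime c (int m) \<longrightarrow> coprime p q \<longrightarrow> 0 < q \<longrightarrow> q \<le> int Q \<longrightarrow>
    \<bar>farey_sum m (\<lambda>e. frac (of_int (p * e) / of_int q)) Q c\<bar> \<le> A * real Q"
proof -
  obtain C where C: "C \<ge> 0" "\<And>Q c p q p' q'. coprime c (int m) \<Longrightarrow> p * q' - p' * q = 1 \<Longrightarrow> 0 < q' \<Longrightarrow> q' \<le> q \<Longrightarrow> q \<le> int Q \<Longrightarrow>
    \<bar>farey_sum m (\<lambda>e. frac (of_int (p * e) / of_int q)) Q c - farey_sum m (\<lambda>e. frac (of_int (p' * e) / of_int q')) Q c\<bar>
      \<le> C * (real Q / sqrt (of_int q'))"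
    using farey_sum_step[OF m] by blast
  \<comment> \<open>Since \<open>q >= 2 * q'\<close> and \<open>(4 / 3) ^ 2 <= 2\<close>, one has
    \<open>1 / sqrt q <= (3 / 4) / sqrt q'\<close>. A step thus gains
    \<open>A / 4 * Q / sqrt q'\<close>, which has to pay for \<open>C * Q / sqrt q'\<close> and for
    the 2 of the reflection, written as \<open>2 * Q / sqrt q'\<close>.\<close>
  define A where "A = 4 * (C + 2)"
  show ?thesis
  proof (intro exI[of _ A] conjI allI impI)
    show "0 \<le> A" using C(1) by (simp add: A_def)
    fix Q :: nat and c p q :: int
    assume c: "coprime c (int m)" and pq: "coprime p q" and q: "0 < q" and qQ: "q \<le> int Q"
    define \<Delta> where "\<Delta> p q = farey_sum m (\<lambda>e. frac (of_int (p * e) / of_int q)) Q c" for p q :: int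
    \<comment> \<open>The reflection costs 1 for the constant function and 1 for the indicator of
      multiples of \<open>q\<close>.\<close>
    have neg: "\<bar>\<Delta> (- p) q + \<Delta> p q\<bar> \<le> 2" if "q > 0" "coprime p q" for p q
    proof -
      have "\<Delta> (- p) q = farey_sum m (\<lambda>e. (1 - (if q dvd e then 1 else 0)) - frac (of_int (p * e) / of_int q)) Q c"
        unfolding \<Delta>_def by (intro farey_sum_cong frac_uminus_int_div that)
      also have "\<dots> = farey_sum m (\<lambda>_. 1) Q c - farey_sum m (\<lambda>e. if q dvd e then 1 else 0) Q c - \<Delta> p q"
        unfolding \<Delta>_def by (simp only: farey_sum_diff)
      finally show ?thesis using farey_sum_1_bound[of m Q c] farey_sum_dvd_bound[OF that(1), of m Q c] by linarith
    qed
    have "\<bar>\<Delta> p q\<bar> \<le> A * real Q * (1 - 1 / sqrt (of_int q))"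
      if "coprime p q" "0 < q" "q \<le> int Q" for p q
      using that
    proof (induction "nat q" arbitrary: p q rule: less_induct)
      case less
      show ?case
      proof (cases "q = 1")
        case True
        have "\<Delta> p q = farey_sum m (\<lambda>e. 0 * 0) Q c"
          unfolding \<Delta>_def True by (intro farey_sum_cong) simp
        then show ?thesis using True by (simp add: farey_sum_def)
      next
        case False
        with less.prems have "q \<ge> 2" by linarith
        then obtain p' q' where par: "0 < q'" "2 * q' \<le> q" "p * q' - p' * q = 1 \<or> p * q' - p' * q = -1"
          using farey_parent[OF less.prems(1)] by blast
        have cop': "coprime p' q'" "coprime (- p') q'"
        proof -
          have "is_unit d" if "d dvd p'" "d dvd q'" for d
          proof -
            have "d dvd p * q' - p' * q" using that by (intro dvd_diff) auto
            then show ?thesis using par(3) by auto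
          qed
          then show "coprime p' q'" by (rule coprimeI)
          then show "coprime (- p') q'" by simp
        qed
        define s where "s = sqrt (of_int q')"
        have s: "s \<ge> 1" using par by (simp add: s_def)
        have IH: "\<bar>\<Delta> r q'\<bar> \<le> A * real Q * (1 - 1 / s)" if "coprime r q'" for r
          unfolding s_def using par less.prems that by (intro less.hyps) auto
        have step: "\<bar>\<Delta> p q\<bar> \<le> A * real Q * (1 - 1 / s) + C * (real Q / s) + 2"
          using par(3)
        proof
          assume "p * q' - p' * q = 1"
          then have "\<bar>\<Delta> p q - \<Delta> p' q'\<bar> \<le> C * (real Q / s)"
            unfolding \<Delta>_def s_def using c par less.prems by (intro C(2)) auto
          then show ?thesis using IH[OF cop'(1)] by linarith
        next
          assume "p * q' - p' * q = -1"
          then have "\<bar>\<Delta> (- p) q - \<Delta> (- p') q'\<bar> \<le> C * (real Q / s)"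
            unfolding \<Delta>_def s_def using c par less.prems by (intro C(2)) (auto simp: algebra_simps)
          then show ?thesis using IH[OF cop'(2)] neg[of q p] less.prems by linarith
        qed
        have sQ: "s \<le> real Q"
        proof -
          have "s * 1 \<le> s * s" using s by (intro mult_left_mono) auto
          also have "s * s = of_int q'" using par by (simp add: s_def)
          also have "of_int q' \<le> real Q" using par less.prems by linarith
          finally show ?thesis by simp
        qed
        then have 2: "2 \<le> 2 * (real Q / s)" using s by (simp add: field_simps)
        have "1 / sqrt (of_int q) \<le> 3 / 4 / s"
        proof -
          have "4 / 3 * s = sqrt (16 / 9 * of_int q')" by (simp add: s_def real_sqrt_mult real_sqrt_divide)
          also have "\<dots> \<le> sqrt (of_int q)" using par by (intro real_sqrt_le_mono) linarith
          finally have "1 / sqrt (of_int q) \<le> 1 / (4 / 3 * s)"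
            using s less.prems by (intro divide_left_mono mult_pos_pos) auto
          then show ?thesis by simp
        qed
        then have "A * real Q * (1 - 3 / 4 / s) \<le> A * real Q * (1 - 1 / sqrt (of_int q))"
          using C(1) by (intro mult_left_mono) (auto simp: A_def)
        moreover have "A * real Q * (1 - 1 / s) + C * (real Q / s) + 2 * (real Q / s) = A * real Q * (1 - 3 / 4 / s)"
          using s by (simp add: A_def field_simps)
        ultimately show ?thesis using step 2 by linarith
      qed
    qed
    from this[OF pq q qQ] have "\<bar>\<Delta> p q\<bar> \<le> A * real Q * (1 - 1 / sqrt (of_int q))" .
    also have "\<dots> \<le> A * real Q * 1" using C(1) q by (intro mult_left_mono) (auto simp: A_def)
    finally show "\<bar>farey_sum m (\<lambda>e. frac (of_int (p * e) / of_int q)) Q c\<bar> \<le> A * real Q"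
      by (simp add: \<Delta>_def)
  qed
qed

text \<open>The fractional part of \<open>h * e / k\<close> is a multiple of \<open>1 / k\<close>,
  so a shift by less than \<open>1 / k\<close> crosses an integer only when it goes down from 0,
  that is for \<open>\<theta> < 0\<close> and \<open>k dvd e\<close>.\<close>

lemma frac_near_rational:
  fixes h k e :: int
  assumes k: "k > 0" "coprime h k" and e: "0 < e" and \<theta>: "\<bar>\<theta> * of_int e\<bar> < 1 / real_of_int k"
  shows "frac (of_int (h * e) / real_of_int k + \<theta> * of_int e) =
    frac (of_int (h * e) / of_int k) + \<theta> * of_int e + (if \<theta> < 0 then 1 else 0) * (if k dvd e then 1 else 0)"
proof -
  define r where "r = (h * e) mod k"
  have r: "0 \<le> r" "r < k" using k by (auto simp: r_def)
  have fr: "frac (of_int (h * e) / of_int k) = real_of_int r / of_int k"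
    unfolding r_def by (rule frac_int_int_div[OF k(1)])
  have k1: "1 / real_of_int k \<le> 1" using k by simp
  have r0: "r = 0 \<longleftrightarrow> k dvd e"
  proof -
    have "r = 0 \<longleftrightarrow> k dvd h * e" by (simp add: r_def mod_eq_0_iff_dvd)
    also have "\<dots> \<longleftrightarrow> k dvd e" using k(2) coprime_commute coprime_dvd_mult_right_iff by blast
    finally show ?thesis .
  qed
  define t where "t = frac (of_int (h * e) / of_int k) + \<theta> * of_int e + (if \<theta> < 0 then 1 else 0) * (if k dvd e then 1 else 0)"
  have "0 \<le> t \<and> t < 1"
  proof (cases "k dvd e")
    case True
    then have f0: "frac (of_int (h * e) / real_of_int k) = 0" using fr r0 by simp
    have "t = (if \<theta> < 0 then 1 else 0) + \<theta> * of_int e" unfolding t_def f0 using True by simp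
    moreover have "\<theta> < 0 \<longleftrightarrow> \<theta> * of_int e < 0" using e by (simp add: mult_less_0_iff)
    ultimately show ?thesis using \<theta> k1 by auto
  next
    case False
    then have "1 \<le> r" "r \<le> k - 1" using r r0 by auto
    then have "1 / real_of_int k \<le> of_int r / of_int k" "of_int r / of_int k \<le> (real_of_int k - 1) / of_int k"
      using k by (auto intro!: divide_right_mono)
    moreover have "(real_of_int k - 1) / of_int k = 1 - 1 / of_int k" using k by (simp add: field_simps)
    ultimately show ?thesis using \<theta> False unfolding t_def fr by auto
  qed
  moreover have "of_int (h * e) / real_of_int k + \<theta> * of_int e - t \<in> \<int>"
    by (auto simp: t_def frac_def)
  ultimately show ?thesis unfolding t_def[symmetric] frac_unique_iff by simp
qed

text \<open>Dirichlet approximation with bound \<open>Q\<close> gives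
  \<open>\<bar>\<theta>\<bar> * Q < 1 / k\<close>, so \<open>frac_near_rational\<close> holds for
  all \<open>e <= Q\<close> at once. The linear correction costs
  \<open>\<bar>\<theta>\<bar> * 2 * Q ^ 2 <= 2 * Q\<close> and the jumps cost 1, which explains
  \<open>A + 3\<close>.\<close>

lemma farey_sum_bound:
  assumes m: "m \<ge> 1"
  shows "\<exists>A\<ge>0. \<forall>Q c \<alpha>. coprime c (int m) \<longrightarrow> \<bar>farey_sum m (\<lambda>e. frac (\<alpha> * of_int e)) Q c\<bar> \<le> A * real Q"
proof -
  obtain A where A: "A \<ge> 0" "\<And>Q c p q. coprime c (int m) \<Longrightarrow> coprime p q \<Longrightarrow> 0 < q \<Longrightarrow> q \<le> int Q \<Longrightarrow>
    \<bar>farey_sum m (\<lambda>e. frac (of_int (p * e) / of_int q)) Q c\<bar> \<le> A * real Q"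
    using farey_sum_rational_bound[OF m] by blast
  show ?thesis
  proof (intro exI[of _ "A + 3"] conjI allI impI)
    show "0 \<le> A + 3" using A(1) by simp
    fix Q :: nat and c :: int and \<alpha> :: real
    assume c: "coprime c (int m)"
    show "\<bar>farey_sum m (\<lambda>e. frac (\<alpha> * of_int e)) Q c\<bar> \<le> (A + 3) * real Q"
    proof (cases "Q = 0")
      case True
      then show ?thesis by (simp add: farey_sum_def)
    next
      case False
      then obtain h k where hk: "coprime h k" "0 < k" "k \<le> int Q" "\<bar>of_int k * \<alpha> - of_int h\<bar> < 1 / real Q"
        using Dirichlet_approx_coprime[of Q \<alpha>] by auto
      define \<theta> where "\<theta> = \<alpha> - of_int h / of_int k"
      have k: "real_of_int k \<ge> 1" using hk by simp
      have \<theta>: "\<bar>\<theta>\<bar> * real Q < 1 / of_int k"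
      proof -
        have "\<bar>\<theta>\<bar> * of_int k = \<bar>of_int k * \<alpha> - of_int h\<bar>"
          unfolding \<theta>_def using hk(2) by (simp add: abs_mult[symmetric, of _ "of_int k", simplified] field_simps)
        then have "\<bar>\<theta>\<bar> * of_int k * real Q < 1" using hk(4) False by (simp add: field_simps)
        then show ?thesis using k by (simp add: field_simps)
      qed
      define \<epsilon> :: real where "\<epsilon> = (if \<theta> < 0 then 1 else 0)"
      have "farey_sum m (\<lambda>e. frac (\<alpha> * of_int e)) Q c =
        farey_sum m (\<lambda>e. frac (of_int (h * e) / of_int k) + \<theta> * of_int e + \<epsilon> * (if k dvd e then 1 else 0)) Q c"
      proof (rule farey_sum_cong)
        fix e :: int assume e: "1 \<le> e" "e \<le> int Q"
        have "\<bar>\<theta> * of_int e\<bar> \<le> \<bar>\<theta>\<bar> * real Q" using e by (auto simp: abs_mult intro!: mult_left_mono) 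
        then have "\<bar>\<theta> * of_int e\<bar> < 1 / of_int k" using \<theta> by linarith
        moreover have "\<alpha> * of_int e = of_int (h * e) / real_of_int k + \<theta> * of_int e"
          using hk(2) by (simp add: \<theta>_def field_simps)
        ultimately show "frac (\<alpha> * of_int e) = frac (of_int (h * e) / of_int k) + \<theta> * of_int e + \<epsilon> * (if k dvd e then 1 else 0)"
          unfolding \<epsilon>_def using frac_near_rational[OF hk(2,1), of e \<theta>] e by simp
      qed
      also have "\<dots> = farey_sum m (\<lambda>e. frac (of_int (h * e) / of_int k)) Q c + \<theta> * farey_sum m of_int Q c
          + \<epsilon> * farey_sum m (\<lambda>e. if k dvd e then 1 else 0) Q c"
        by (simp only: farey_sum_add farey_sum_scale)
      also have "\<bar>\<dots>\<bar> \<le> A * real Q + 2 * real Q + 1"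
      proof -
        have "\<bar>farey_sum m of_int Q c\<bar> \<le> 2 * real Q ^ 2"
        proof -
          have "\<bar>farey_sum m of_int Q c\<bar> \<le> (\<Sum>d | d \<in> {1..Q} \<and> coprime d m. real Q ^ 2 * (1 / real d ^ 2))"
            unfolding farey_sum_eq[OF m c]
          proof (rule order_trans[OF sum_abs], rule sum_mono)
            fix d assume "d \<in> {d. d \<in> {1..Q} \<and> coprime d m}"
            then have d: "d > 0" by auto
            have x: "real (Q div d) \<le> real Q / real d"
              using floor_divide_of_nat_eq[of Q d, where 'a = real] of_int_floor_le[of "real Q / real d"] by auto
            have "\<bar>apsum (int m) of_int (int (Q div d)) (c * modinv m d)\<bar> \<le> of_int (int (Q div d)) * real (Q div d)"
              by (rule abs_apsum_le) auto
            also have "\<dots> \<le> (real Q / real d) * (real Q / real d)" using mult_mono[OF x x] by simp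
            finally have "\<bar>moebius d\<bar> * \<bar>apsum (int m) of_int (int (Q div d)) (c * modinv m d)\<bar> \<le> 1 * ((real Q / real d) * (real Q / real d))"
              using abs_moebius_le by (intro mult_mono) auto
            then show "\<bar>moebius d * apsum (int m) of_int (int (Q div d)) (c * modinv m d)\<bar> \<le> real Q ^ 2 * (1 / real d ^ 2)"
              by (simp add: abs_mult power2_eq_square)
          qed
          also have "\<dots> \<le> (\<Sum>d\<in>{0<..Q}. real Q ^ 2 * (1 / real d ^ 2))" by (intro sum_mono2) auto
          also have "\<dots> = real Q ^ 2 * (\<Sum>d\<in>{0<..Q}. 1 / real d ^ 2)" by (simp only: sum_distrib_left)
          also have "\<dots> \<le> real Q ^ 2 * 2" using sum_inverse_squares_tail[of 0 Q] by (intro mult_left_mono) auto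
          finally show ?thesis by simp
        qed
        then have "\<bar>\<theta> * farey_sum m of_int Q c\<bar> \<le> \<bar>\<theta>\<bar> * (2 * real Q ^ 2)"
          unfolding abs_mult by (rule mult_left_mono) simp
        also have "\<dots> = 2 * real Q * (\<bar>\<theta>\<bar> * real Q)" by (simp add: power2_eq_square)
        also have "\<dots> \<le> 2 * real Q * 1"
        proof (intro mult_left_mono)
          have "1 / real_of_int k \<le> 1" using k by simp
          then show "\<bar>\<theta>\<bar> * real Q \<le> 1" using \<theta> by linarith
        qed simp
        finally have 1: "\<bar>\<theta> * farey_sum m of_int Q c\<bar> \<le> 2 * real Q" by simp
        have "\<bar>\<epsilon> * farey_sum m (\<lambda>e. if k dvd e then 1 else 0) Q c\<bar> \<le> 1 * 1"
          unfolding abs_mult using farey_sum_dvd_bound[OF hk(2), of m Q c]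
          by (intro mult_mono) (auto simp: \<epsilon>_def)
        then show ?thesis using 1 A(2)[OF c hk(1-3)] by linarith
      qed
      also have "\<dots> \<le> (A + 3) * real Q" using False by (simp add: algebra_simps)
      finally show ?thesis .
    qed
  qed
qed

subsection \<open>Sieving out the k-th powers\<close>

definition rho :: "real \<Rightarrow> nat \<Rightarrow> real" where
  "rho \<beta> n = (\<Sum>d | d dvd n. moebius d * frac (\<beta> * real (n div d)))"

text \<open>Multiplying \<open>n\<close> by a power of \<open>p\<close> leaves the index set
  unchanged and only dilates \<open>\<beta>\<close>; \<open>rho\<close> itself does not behave like
  this.\<close>

definition rho_sifted :: "nat \<Rightarrow> real \<Rightarrow> nat \<Rightarrow> real" where
  "rho_sifted p \<beta> n = (\<Sum>d | d dvd n \<and> \<not> p dvd d. moebius d * frac (\<beta> * real (n div d)))"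

lemma rho_eq:
  assumes "prime p" "n > 0"
  shows "rho \<beta> n = rho_sifted p \<beta> n - (if p dvd n then rho_sifted p \<beta> (n div p) else 0)"
proof -
  have "rho \<beta> n = (\<Sum>d\<in>{d\<in>{d. d dvd n}. \<not> p dvd d}. moebius d * frac (\<beta> * real (n div d)))
     - (\<Sum>d\<in>{d. p * d \<in> {d. d dvd n} \<and> \<not> p dvd d}. moebius d * frac (\<beta> * real (n div (p * d))))"
    unfolding rho_def by (rule sum_moebius_split_prime) (use assms in auto)
  also have "(\<Sum>d\<in>{d. p * d \<in> {d. d dvd n} \<and> \<not> p dvd d}. moebius d * frac (\<beta> * real (n div (p * d)))) =
     (if p dvd n then rho_sifted p \<beta> (n div p) else 0)"
  proof (cases "p dvd n")
    case True
    then obtain n' where n': "n = p * n'" by blast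
    have "p > 0" using assms(1) prime_gt_0_nat by blast
    then show ?thesis using True by (simp add: rho_sifted_def n' div_mult2_eq)
  next
    case False
    then have "{d. p * d \<in> {d. d dvd n} \<and> \<not> p dvd d} = {}" by (auto dest: dvd_mult_left)
    then show ?thesis using False by (simp only: sum.empty if_False)
  qed
  finally show ?thesis by (simp add: rho_sifted_def)
qed

lemma rho_sifted_prime_power:
  assumes "prime p" "n > 0"
  shows "rho_sifted p \<beta> (p ^ j * n) = rho_sifted p (\<beta> * real (p ^ j)) n"
proof -
  have iff: "d dvd p ^ j * n \<longleftrightarrow> d dvd n" if "\<not> p dvd d" for d
  proof -
    have "coprime (p ^ j) d" using that assms(1) by (simp add: prime_imp_coprime)
    then have "coprime d (p ^ j)" by (rule coprime_imp_coprime) auto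
    then show ?thesis using coprime_dvd_mult_right_iff by blast
  qed
  then have "{d. d dvd p ^ j * n \<and> \<not> p dvd d} = {d. d dvd n \<and> \<not> p dvd d}" by blast
  moreover have "frac (\<beta> * real (p ^ j * n div d)) = frac (\<beta> * real (p ^ j) * real (n div d))" if "d dvd n" for d
    using that by (simp add: div_mult_swap[symmetric] mult.assoc)
  ultimately show ?thesis unfolding rho_sifted_def by (intro sum.cong) auto
qed

lemma sum_multiples:
  fixes f :: "nat \<Rightarrow> real"
  assumes r: "r > 0" "coprime r m" and P: "\<And>n. P (r * n) \<longleftrightarrow> P n"
  shows "(\<Sum>n | n \<in> {1..X} \<and> [int n = c] (mod int m) \<and> P n \<and> r dvd n. f n) =
    (\<Sum>n | n \<in> {1..X div r} \<and> [int n = c * modinv m r] (mod int m) \<and> P n. f (r * n))"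
proof -
  note inv = modinv[OF r(2)]
  have iff: "[int (r * n) = c] (mod int m) \<longleftrightarrow> [int n = c * modinv m r] (mod int m)" for n
  proof
    assume "[int (r * n) = c] (mod int m)"
    then have "[modinv m r * (int r * int n) = modinv m r * c] (mod int m)"
      by (intro cong_scalar_left) simp
    moreover have "[int r * modinv m r * int n = 1 * int n] (mod int m)" using inv by (rule cong_scalar_right)
    ultimately show "[int n = c * modinv m r] (mod int m)"
      by (metis cong_sym cong_trans mult.assoc mult.commute mult_1)
  next
    assume "[int n = c * modinv m r] (mod int m)"
    then have "[int r * int n = int r * (c * modinv m r)] (mod int m)" by (rule cong_scalar_left)
    moreover have "[int r * modinv m r * c = 1 * c] (mod int m)" using inv by (rule cong_scalar_right)
    ultimately show "[int (r * n) = c] (mod int m)"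
      by (metis cong_trans mult.assoc mult.commute mult_1 of_nat_mult)
  qed
  have P': "P (n * r) \<longleftrightarrow> P n" for n using P[of n] by (simp add: mult.commute)
  show ?thesis
    by (rule sum.reindex_bij_witness[of _ "\<lambda>n. r * n" "\<lambda>n. n div r"])
       (use r in \<open>auto simp: iff[symmetric] P' div_le_mono less_eq_div_iff_mult_less_eq mult.commute Suc_le_eq elim!: dvdE\<close>)
qed

lemma coprime_modinv:
  assumes "coprime c (int m)" "coprime r m"
  shows "coprime (c * modinv m r) (int m)"
proof -
  have "coprime (modinv m r) (int m)"
    using modinv[OF assms(2)] coprime_iff_invertible_int[of "modinv m r" "int m"] by (auto simp: mult.commute)
  then show ?thesis using assms(1) by simp
qed

text \<open>
  Adding a prime to the sieve costs a factor \<open>1 + 4 / p ^ 2\<close>, and the product of these factors converges.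
\<close>

lemma sifted_sum_bound:
  fixes m k :: nat
  assumes m: "m \<ge> 1" and k: "k \<ge> 2" and A: "A \<ge> 0"
    and base: "\<And>X c \<beta>. coprime c (int m) \<Longrightarrow> \<bar>\<Sum>n | n \<in> {1..X} \<and> [int n = c] (mod int m). rho \<beta> n\<bar> \<le> A * real X"
    and S: "finite S" "\<And>p. p \<in> S \<Longrightarrow> prime p \<and> \<not> p dvd m"
    and c: "coprime c (int m)"
  shows "\<bar>\<Sum>n | n \<in> {1..X} \<and> [int n = c] (mod int m) \<and> (\<forall>p\<in>S. \<not> p ^ k dvd n). rho \<beta> n\<bar>
    \<le> A * (\<Prod>p\<in>S. 1 + 4 / real p ^ 2) * real X"
  using S c
proof (induction S arbitrary: X c \<beta> rule: finite_induct)
  case empty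
  then show ?case using base by simp
next
  case (insert p S)
  define C where "C = A * (\<Prod>p\<in>S. 1 + 4 / real p ^ 2)"
  have C: "C \<ge> 0" unfolding C_def using A by (intro mult_nonneg_nonneg prod_nonneg) auto
  have p: "prime p" "p \<ge> 2" "p > 0" "coprime p m"
    using insert.prems(1)[of p] by (auto simp: prime_ge_2_nat prime_gt_0_nat prime_imp_coprime)
  define P where "P n \<longleftrightarrow> (\<forall>r\<in>S. \<not> r ^ k dvd n)" for n
  have P: "P (p ^ j * n) \<longleftrightarrow> P n" for j n
  proof -
    have "r ^ k dvd p ^ j * n \<longleftrightarrow> r ^ k dvd n" if "r \<in> S" for r
    proof -
      have "prime r" "r \<noteq> p" using that insert by auto
      then have "coprime (r ^ k) (p ^ j)" using p(1) by (simp add: primes_coprime)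
      then show ?thesis using coprime_dvd_mult_right_iff by blast
    qed
    then show ?thesis unfolding P_def by blast
  qed
  have IH: "\<bar>\<Sum>n | n \<in> {1..X} \<and> [int n = c] (mod int m) \<and> P n. rho \<beta> n\<bar> \<le> C * real X"
    if "coprime c (int m)" for X c \<beta>
    unfolding P_def C_def using insert that by blast
  define R' where "R' X c \<beta> = (\<Sum>n | n \<in> {1..X} \<and> [int n = c] (mod int m) \<and> P n. rho_sifted p \<beta> n)" for X c \<beta>
  have fin: "finite {n. n \<in> {1..X} \<and> Q n}" for X :: nat and Q
    by (rule finite_subset[of _ "{1..X}"]) auto
  have rec: "(\<Sum>n | n \<in> {1..X} \<and> [int n = c] (mod int m) \<and> P n. rho \<beta> n) = R' X c \<beta> - R' (X div p) (c * modinv m p) \<beta>"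
    for X c \<beta>
  proof -
    have "(\<Sum>n | n \<in> {1..X} \<and> [int n = c] (mod int m) \<and> P n. rho \<beta> n) =
       (\<Sum>n | n \<in> {1..X} \<and> [int n = c] (mod int m) \<and> P n. rho_sifted p \<beta> n - (if p dvd n then rho_sifted p \<beta> (n div p) else 0))"
      by (intro sum.cong refl rho_eq) (use p in auto)
    also have "\<dots> = R' X c \<beta> - (\<Sum>n\<in>{n \<in> {n. n \<in> {1..X} \<and> [int n = c] (mod int m) \<and> P n}. p dvd n}. rho_sifted p \<beta> (n div p))"
      unfolding sum_subtractf R'_def using fin by (simp only: sum.inter_filter)
    also have "{n \<in> {n. n \<in> {1..X} \<and> [int n = c] (mod int m) \<and> P n}. p dvd n} = {n. n \<in> {1..X} \<and> [int n = c] (mod int m) \<and> P n \<and> p dvd n}"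
      by auto
    also have "(\<Sum>n | n \<in> {1..X} \<and> [int n = c] (mod int m) \<and> P n \<and> p dvd n. rho_sifted p \<beta> (n div p)) = R' (X div p) (c * modinv m p) \<beta>"
      unfolding R'_def using sum_multiples[where r = p and m = m and P = P and X = X and c = c and f = "\<lambda>n. rho_sifted p \<beta> (n div p)"] p P[of 1] by simp
    finally show ?thesis .
  qed
  \<comment> \<open>Solving \<open>rec\<close> for \<open>R' X\<close> leaves an error at
    \<open>X div p <= X / 2\<close>, so \<open>C * X + 2 * C * X / 2 = 2 * C * X\<close> closes the
    induction. The class changes on the way, hence the uniformity in \<open>c\<close>.\<close>
  have R': "\<bar>R' X c \<beta>\<bar> \<le> 2 * C * real X" if "coprime c (int m)" for X c \<beta>
    using that
  proof (induction X arbitrary: c rule: less_induct)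
    case (less X)
    show ?case
    proof (cases "X = 0")
      case True
      then show ?thesis by (simp add: R'_def)
    next
      case False
      then have "\<bar>R' (X div p) (c * modinv m p) \<beta>\<bar> \<le> 2 * C * real (X div p)"
        using p by (intro less.IH coprime_modinv less.prems) auto
      also have "\<dots> \<le> 2 * C * (real X / 2)"
      proof -
        have "X div p \<le> X div 2" using p(2) by (intro div_le_mono2) auto
        then have "real (X div p) \<le> real X / 2" by linarith
        then show ?thesis using C by (intro mult_left_mono) auto
      qed
      finally show ?thesis using IH[OF less.prems, where X = X and \<beta> = \<beta>] rec[where X = X and c = c and \<beta> = \<beta>] by (simp add: field_simps)
    qed
  qed
  let ?r = "p ^ k"
  have r: "?r > 0" "coprime ?r m" using p by simp_all
  have k': "k = Suc (k - 1)" using k by simp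
  have "(\<Sum>n | n \<in> {1..X} \<and> [int n = c] (mod int m) \<and> P n. rho \<beta> n) =
     (\<Sum>n | n \<in> {1..X} \<and> [int n = c] (mod int m) \<and> P n \<and> \<not> ?r dvd n. rho \<beta> n)
     + (\<Sum>n | n \<in> {1..X} \<and> [int n = c] (mod int m) \<and> P n \<and> ?r dvd n. rho \<beta> n)"
    using fin by (subst sum.union_disjoint[symmetric]) (auto intro!: sum.cong)
  \<comment> \<open>At a multiple of \<open>p ^ k\<close>, \<open>rho\<close> is a difference of two
    sifted values with dilated \<open>\<beta>\<close>. Each of the two sums is at most
    \<open>2 * C * X / p ^ 2\<close> because \<open>k >= 2\<close>; this is the origin of the 4 in
    the factor.\<close>
  moreover have "(\<Sum>n | n \<in> {1..X} \<and> [int n = c] (mod int m) \<and> P n \<and> ?r dvd n. rho \<beta> n) =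
     R' (X div ?r) (c * modinv m ?r) (\<beta> * real (p ^ k)) - R' (X div ?r) (c * modinv m ?r) (\<beta> * real (p ^ (k - 1)))"
  proof -
    have "(\<Sum>n | n \<in> {1..X} \<and> [int n = c] (mod int m) \<and> P n \<and> ?r dvd n. rho \<beta> n) =
       (\<Sum>n | n \<in> {1..X div ?r} \<and> [int n = c * modinv m ?r] (mod int m) \<and> P n. rho \<beta> (?r * n))"
      using r P by (rule sum_multiples)
    also have "\<dots> = (\<Sum>n | n \<in> {1..X div ?r} \<and> [int n = c * modinv m ?r] (mod int m) \<and> P n.
        rho_sifted p (\<beta> * real (p ^ k)) n - rho_sifted p (\<beta> * real (p ^ (k - 1))) n)"
    proof (intro sum.cong refl)
      fix n assume "n \<in> {n. n \<in> {1..X div ?r} \<and> [int n = c * modinv m ?r] (mod int m) \<and> P n}"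
      then have n: "n > 0" by auto
      have e: "p ^ k * n = p * (p ^ (k - 1) * n)" by (subst k') simp
      have "p dvd p ^ k * n" unfolding e by simp
      moreover have "p ^ k * n div p = p ^ (k - 1) * n" unfolding e using p by simp
      ultimately show "rho \<beta> (?r * n) = rho_sifted p (\<beta> * real (p ^ k)) n - rho_sifted p (\<beta> * real (p ^ (k - 1))) n"
        using rho_eq[OF p(1), of "?r * n" \<beta>] n p rho_sifted_prime_power[OF p(1) n] by simp
    qed
    finally show ?thesis by (simp only: sum_subtractf R'_def)
  qed
  moreover have R'k: "\<bar>R' (X div ?r) (c * modinv m ?r) \<gamma>\<bar> \<le> 2 * C * (real X / real p ^ 2)" for \<gamma>
  proof -
    have "\<bar>R' (X div ?r) (c * modinv m ?r) \<gamma>\<bar> \<le> 2 * C * real (X div ?r)"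
      using r insert.prems by (intro R' coprime_modinv) auto
    also have "\<dots> \<le> 2 * C * (real X / real p ^ 2)"
    proof (intro mult_left_mono)
      have "p ^ 2 \<le> ?r" using p k by (intro power_increasing) auto
      then have "X div ?r \<le> X div p ^ 2" using p by (intro div_le_mono2) auto
      then have "real (X div ?r) \<le> real (X div p ^ 2)" by simp
      also have "\<dots> \<le> real X / real (p ^ 2)"
        using floor_divide_of_nat_eq[of X "p ^ 2", where 'a = real] of_int_floor_le[of "real X / real (p ^ 2)"] by auto
      finally show "real (X div ?r) \<le> real X / real p ^ 2" by simp
    qed (use C in auto)
    finally show ?thesis .
  qed
  ultimately have "\<bar>\<Sum>n | n \<in> {1..X} \<and> [int n = c] (mod int m) \<and> P n \<and> \<not> ?r dvd n. rho \<beta> n\<bar> \<le> C * real X + 2 * (2 * C * (real X / real p ^ 2))"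
    using IH[OF insert.prems(2), where X = X and \<beta> = \<beta>] R'k[of "\<beta> * real (p ^ k)"] R'k[of "\<beta> * real (p ^ (k - 1))"] by linarith
  also have "\<dots> = A * (\<Prod>p\<in>insert p S. 1 + 4 / real p ^ 2) * real X"
    using insert by (simp add: C_def algebra_simps)
  also have "{n. n \<in> {1..X} \<and> [int n = c] (mod int m) \<and> P n \<and> \<not> ?r dvd n} = {n. n \<in> {1..X} \<and> [int n = c] (mod int m) \<and> (\<forall>p\<in>insert p S. \<not> p ^ k dvd n)}"
    by (auto simp: P_def)
  finally show ?case .
qed

lemma coprime_cong_nat_int:
  assumes "[int n = c] (mod int m)" "coprime c (int m)"
  shows "coprime n m"
proof -
  have "coprime (int n) (int m)" using assms cong_imp_coprime cong_sym by blast
  then show ?thesis by simp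
qed

lemma k_free_sum_bound:
  assumes m: "m \<ge> 1"
  shows "\<exists>A\<ge>0. \<forall>k c X \<beta>. k \<ge> 2 \<longrightarrow> coprime c (int m) \<longrightarrow>
    \<bar>\<Sum>n | n \<in> {1..X} \<and> [int n = c] (mod int m) \<and> k_free k n. rho \<beta> n\<bar> \<le> A * real X"
proof -
  obtain A where A: "A \<ge> 0" "\<And>Q c \<alpha>. coprime c (int m) \<Longrightarrow> \<bar>farey_sum m (\<lambda>e. frac (\<alpha> * of_int e)) Q c\<bar> \<le> A * real Q"
    using farey_sum_bound[OF m] by blast
  have base: "\<bar>\<Sum>n | n \<in> {1..X} \<and> [int n = c] (mod int m). rho \<beta> n\<bar> \<le> A * real X" if "coprime c (int m)" for X c \<beta>
    using A(2)[OF that, where Q = X and \<alpha> = \<beta>] by (simp add: farey_sum_def rho_def)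
  show ?thesis
  \<comment> \<open>The product is at most the exponential of the sum of \<open>4 / d ^ 2\<close>,
    and the inverse squares add up to at most 2.\<close>
  proof (intro exI[of _ "A * exp 8"] conjI allI impI)
    show "0 \<le> A * exp 8" using A by simp
    fix k X :: nat and c :: int and \<beta> :: real
    assume k: "2 \<le> k" and c: "coprime c (int m)"
    \<comment> \<open>A prime dividing \<open>m\<close> cannot divide an \<open>n\<close> in a unit
      class, and a prime beyond \<open>X\<close> cannot divide an \<open>n <= X\<close>.\<close>
    define S where "S = {p. prime p \<and> p \<le> X \<and> \<not> p dvd m}"
    have S: "finite S" "\<And>p. p \<in> S \<Longrightarrow> prime p \<and> \<not> p dvd m"
      by (auto simp: S_def intro: finite_subset[of _ "{..X}"])
    have kf: "k_free k n \<longleftrightarrow> (\<forall>p\<in>S. \<not> p ^ k dvd n)" if n: "n \<in> {1..X}" "[int n = c] (mod int m)" for n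
    proof -
      have "p \<in> S" if "prime p" "p ^ k dvd n" for p
      proof -
        have pn: "p dvd n" using that(2) k dvd_power[of k p] by (auto intro: dvd_trans)
        then have "p \<le> X" using n(1) by (auto dest: dvd_imp_le)
        moreover have "\<not> p dvd m"
          using coprime_common_divisor[OF coprime_cong_nat_int[OF n(2) c] pn] not_prime_unit that(1) by blast
        ultimately show ?thesis using that(1) by (simp add: S_def)
      qed
      then show ?thesis using n(1) S(2) unfolding k_free_def by auto
    qed
    have "(\<Prod>p\<in>S. 1 + 4 / real p ^ 2) \<le> (\<Prod>p\<in>S. exp (4 / real p ^ 2))"
      by (intro prod_mono) (auto simp: exp_ge_add_one_self)
    also have "\<dots> = exp (\<Sum>p\<in>S. 4 / real p ^ 2)" using S(1) by (simp add: exp_sum)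
    also have "(\<Sum>p\<in>S. 4 / real p ^ 2) \<le> (\<Sum>d\<in>{0<..X}. 4 / real d ^ 2)"
      using S(2) by (intro sum_mono2) (auto simp: S_def prime_gt_0_nat)
    also have "\<dots> = 4 * (\<Sum>d\<in>{0<..X}. 1 / real d ^ 2)" by (simp add: sum_distrib_left)
    also have "\<dots> \<le> 8" using sum_inverse_squares_tail[of 0 X] by simp
    finally have prod: "(\<Prod>p\<in>S. 1 + 4 / real p ^ 2) \<le> exp 8" by simp
    have "{n. n \<in> {1..X} \<and> [int n = c] (mod int m) \<and> k_free k n} = {n. n \<in> {1..X} \<and> [int n = c] (mod int m) \<and> (\<forall>p\<in>S. \<not> p ^ k dvd n)}"
      using kf by blast
    then have "\<bar>\<Sum>n | n \<in> {1..X} \<and> [int n = c] (mod int m) \<and> k_free k n. rho \<beta> n\<bar> \<le> A * (\<Prod>p\<in>S. 1 + 4 / real p ^ 2) * real X"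
      using sifted_sum_bound[OF m k A(1) base S c] by simp
    also have "\<dots> \<le> A * exp 8 * real X" using prod A(1) by (intro mult_right_mono mult_left_mono) auto
    finally show "\<bar>\<Sum>n | n \<in> {1..X} \<and> [int n = c] (mod int m) \<and> k_free k n. rho \<beta> n\<bar> \<le> A * exp 8 * real X" .
  qed
qed

subsection \<open>Counting fractions\<close>

lemma card_multiples: "d > 0 \<Longrightarrow> card {a. a \<in> {1..t} \<and> d dvd a} = t div d"
proof -
  assume d: "d > 0"
  have "bij_betw (\<lambda>e. d * e) {1..t div d} {a. a \<in> {1..t} \<and> d dvd a}"
    by (rule bij_betwI[where g = "\<lambda>a. a div d"])
       (use d in \<open>auto simp: less_eq_div_iff_mult_less_eq mult.commute Suc_le_eq div_le_mono elim!: dvdE\<close>)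
  then show ?thesis using bij_betw_same_card by fastforce
qed

lemma card_coprime_upto:
  assumes "n > 0"
  shows "real (card {a. a \<in> {1..t} \<and> coprime a n}) = (\<Sum>d | d dvd n. moebius d * real (t div d))"
proof -
  have fin: "finite {d. d dvd n}" using assms by simp
  have "real (card {a. a \<in> {1..t} \<and> coprime a n}) = (\<Sum>a\<in>{a \<in> {1..t}. coprime a n}. 1)" by simp
  also have "\<dots> = (\<Sum>a\<in>{1..t}. if coprime a n then 1 else 0)" by (rule sum.inter_filter) simp
  also have "\<dots> = (\<Sum>a\<in>{1..t}. \<Sum>d | d dvd n. if d dvd a then moebius d else 0)"
  proof (intro sum.cong refl)
    fix a
    have "(\<Sum>d | d dvd n. if d dvd a then moebius d else 0) = (\<Sum>d\<in>{d \<in> {d. d dvd n}. d dvd a}. moebius d)"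
      by (rule sum.inter_filter[symmetric]) (rule fin)
    also have "{d \<in> {d. d dvd n}. d dvd a} = {d. d dvd gcd a n}" by auto
    also have "(\<Sum>d | d dvd gcd a n. moebius d) = (if gcd a n = 1 then 1 else 0)"
      using assms by (intro sum_moebius_divisors) (simp add: gcd_pos_nat)
    finally show "(if coprime a n then 1 else 0) = (\<Sum>d | d dvd n. if d dvd a then moebius d else 0)"
      unfolding coprime_iff_gcd_eq_1 by simp
  qed
  also have "\<dots> = (\<Sum>d | d dvd n. \<Sum>a\<in>{1..t}. if d dvd a then moebius d else 0)" by (rule sum.swap)
  also have "\<dots> = (\<Sum>d | d dvd n. moebius d * real (t div d))"
  proof (intro sum.cong refl)
    fix d assume "d \<in> {d. d dvd n}"
    then have d: "d > 0" using assms by (auto intro: Nat.gr0I)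
    have "(\<Sum>a\<in>{1..t}. if d dvd a then moebius d else 0) = (\<Sum>a\<in>{a \<in> {1..t}. d dvd a}. moebius d)"
      by (rule sum.inter_filter[symmetric]) simp
    also have "\<dots> = real (card {a. a \<in> {1..t} \<and> d dvd a}) * moebius d" by simp
    finally show "(\<Sum>a\<in>{1..t}. if d dvd a then moebius d else 0) = moebius d * real (t div d)"
      unfolding card_multiples[OF d] by (simp only: mult.commute)
  qed
  finally show ?thesis .
qed

lemma card_totatives_le:
  assumes n: "n > 0" and \<alpha>: "0 \<le> \<alpha>" "\<alpha> \<le> 1"
  shows "real (card {a \<in> totatives n. real a \<le> \<alpha> * real n}) = \<alpha> * real (totient n) - rho \<alpha> n"
proof -
  have *: "real (card {a \<in> totatives n. real a \<le> \<alpha> * real n}) = \<alpha> * (\<Sum>d | d dvd n. moebius d * real (n div d)) - rho \<alpha> n"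
    if \<alpha>: "0 \<le> \<alpha>" "\<alpha> \<le> 1" for \<alpha>
  proof -
    define t where "t = nat \<lfloor>\<alpha> * real n\<rfloor>"
    have t: "int t = \<lfloor>\<alpha> * real n\<rfloor>" using \<alpha> by (simp add: t_def)
    have "\<alpha> * real n \<le> real n" using \<alpha> by (simp add: mult_left_le_one_le)
    then have tn: "t \<le> n" unfolding t_def by linarith
    have iff: "real a \<le> \<alpha> * real n \<longleftrightarrow> a \<le> t" for a :: nat
    proof -
      have "real a \<le> \<alpha> * real n \<longleftrightarrow> int a \<le> \<lfloor>\<alpha> * real n\<rfloor>" by (simp add: le_floor_iff)
      then show ?thesis unfolding t[symmetric] by simp
    qed
    have "{a \<in> totatives n. real a \<le> \<alpha> * real n} = {a. a \<in> {1..t} \<and> coprime a n}"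
      using tn unfolding iff by (auto simp: totatives_def)
    then have "real (card {a \<in> totatives n. real a \<le> \<alpha> * real n}) = (\<Sum>d | d dvd n. moebius d * real (t div d))"
      using card_coprime_upto[OF n, of t] by simp
    also have "\<dots> = (\<Sum>d | d dvd n. moebius d * (\<alpha> * real (n div d) - frac (\<alpha> * real (n div d))))"
    proof (intro sum.cong refl arg_cong2[of _ _ _ _ "(*)"])
      fix d assume "d \<in> {d. d dvd n}"
      then obtain e where e: "n = d * e" by auto
      have d: "d > 0" using e n by (auto intro: Nat.gr0I)
      have "int (t div d) = \<lfloor>\<alpha> * real n\<rfloor> div int d" unfolding t[symmetric] by (simp add: zdiv_int)
      also have "\<dots> = \<lfloor>\<alpha> * real n / real d\<rfloor>" using floor_divide_real_eq_div[of "int d" "\<alpha> * real n"] by simp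
      also have "\<alpha> * real n / real d = \<alpha> * real (n div d)" using d by (simp add: e)
      finally have "real (t div d) = of_int \<lfloor>\<alpha> * real (n div d)\<rfloor>" by (metis of_int_of_nat_eq)
      then show "real (t div d) = \<alpha> * real (n div d) - frac (\<alpha> * real (n div d))" by (simp add: frac_def)
    qed
    also have "\<dots> = \<alpha> * (\<Sum>d | d dvd n. moebius d * real (n div d)) - rho \<alpha> n"
      by (simp add: rho_def right_diff_distrib sum_subtractf sum_distrib_left mult_ac)
    finally show ?thesis .
  qed
  \<comment> \<open>At \<open>\<alpha> = 1\<close> all totatives are counted and \<open>rho\<close>
    vanishes, so the formula itself identifies the main term as \<open>totient n\<close>.\<close>
  have "{a \<in> totatives n. real a \<le> 1 * real n} = totatives n" by (auto simp: totatives_def)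
  moreover have "rho 1 n = 0" by (simp add: rho_def frac_def)
  ultimately have "real (totient n) = (\<Sum>d | d dvd n. moebius d * real (n div d))"
    using *[of 1] by (simp add: totient_def)
  then show ?thesis using *[OF \<alpha>] by simp
qed

definition denominators :: "nat \<Rightarrow> nat \<Rightarrow> int \<Rightarrow> nat \<Rightarrow> nat set" where
  "denominators k m b Q = {n. n \<in> {1..Q} \<and> [int n = b] (mod int m) \<and> k_free k n}"

lemma finite_denominators: "finite (denominators k m b Q)"
  unfolding denominators_def by (rule finite_subset[of _ "{1..Q}"]) auto

lemma farey_kfree_eq:
  "farey_kfree k m b Q = (\<lambda>(n, a). real a / real n) ` (SIGMA n:denominators k m b Q. totatives n)"
  unfolding farey_kfree_def denominators_def totatives_def by (force simp: Suc_le_eq)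

lemma inj_on_fractions: "inj_on (\<lambda>(n, a). real a / real n) (SIGMA n:denominators k m b Q. totatives n)"
proof (rule inj_onI, clarsimp)
  fix n a n' a'
  assume n: "n \<in> denominators k m b Q" "a \<in> totatives n" "n' \<in> denominators k m b Q" "a' \<in> totatives n'"
    and eq: "real a / real n = real a' / real n'"
  have pos: "n > 0" "n' > 0" using n by (auto simp: denominators_def)
  then have "real (a * n') = real (a' * n)" using eq by (simp add: field_simps)
  then have "a * n' = a' * n" by (simp only: of_nat_eq_iff)
  moreover have "coprime a n" "coprime a' n'" using n by (auto simp: totatives_def)
  ultimately show "n = n' \<and> a = a'" using coprime_crossproduct_nat[where a = a and d = n and b = a' and c = n'] by auto
qed

lemma card_farey_filter:
  "card {x \<in> farey_kfree k m b Q. R x} = (\<Sum>n\<in>denominators k m b Q. card {a \<in> totatives n. R (real a / real n)})"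
proof -
  let ?f = "\<lambda>(n, a). real a / real n"
  let ?S = "SIGMA n:denominators k m b Q. {a \<in> totatives n. R (real a / real n)}"
  have "{x \<in> farey_kfree k m b Q. R x} = ?f ` ?S" unfolding farey_kfree_eq by force
  moreover have "inj_on ?f ?S" by (rule inj_on_subset[OF inj_on_fractions]) auto
  ultimately have "card {x \<in> farey_kfree k m b Q. R x} = card ?S" by (simp add: card_image)
  also have "\<dots> = (\<Sum>n\<in>denominators k m b Q. card {a \<in> totatives n. R (real a / real n)})"
    using finite_denominators by (intro card_SigmaI) auto
  finally show ?thesis .
qed

lemma finite_farey_kfree: "finite (farey_kfree k m b Q)"
  unfolding farey_kfree_eq by (intro finite_imageI finite_SigmaI finite_denominators finite_totatives)

lemma card_farey_kfree: "card (farey_kfree k m b Q) = (\<Sum>n\<in>denominators k m b Q. totient n)"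
  using card_farey_filter[of k m b Q "\<lambda>_. True"] by (simp add: totient_def)

text \<open>Reduction modulo one matters only for the denominator 1: the fraction 1 becomes 0 and is
  counted for every \<open>\<alpha> >= 0\<close>, although \<open>1 > \<alpha>\<close>. This is the
  extra 1.\<close>

lemma count_upto_farey_kfree:
  assumes \<alpha>: "0 \<le> \<alpha>" "\<alpha> < 1"
  shows "real (count_upto (farey_kfree k m b Q) \<alpha>) =
    \<alpha> * real (card (farey_kfree k m b Q)) - (\<Sum>n\<in>denominators k m b Q. rho \<alpha> n) + (if 1 \<in> denominators k m b Q then 1 else 0)"
proof -
  have each: "real (card {a \<in> totatives n. frac (real a / real n) \<le> \<alpha>}) = \<alpha> * real (totient n) - rho \<alpha> n + (if n = 1 then 1 else 0)"
    if n: "n \<in> denominators k m b Q" for n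
  proof (cases "n = 1")
    case True
    have "{a \<in> totatives n. frac (real a / real n) \<le> \<alpha>} = {1}" using True \<alpha> by (auto simp: totatives_def)
    moreover have "frac \<alpha> = \<alpha>" using \<alpha> by (simp add: frac_eq)
    ultimately show ?thesis using True by (simp add: rho_def)
  next
    case False
    then have n1: "n > 1" using n by (auto simp: denominators_def)
    have "frac (real a / real n) \<le> \<alpha> \<longleftrightarrow> real a \<le> \<alpha> * real n" if "a \<in> totatives n" for a
    proof -
      have "a < n"
      proof -
        have "a \<le> n" "coprime a n" using that by (auto simp: totatives_def)
        moreover have "a \<noteq> n" using \<open>coprime a n\<close> n1 by auto
        ultimately show ?thesis by simp
      qed
      then have "frac (real a / real n) = real a / real n" using n1 by (simp add: frac_eq)
      then show ?thesis using n1 by (simp add: pos_divide_le_eq)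
    qed
    then have "{a \<in> totatives n. frac (real a / real n) \<le> \<alpha>} = {a \<in> totatives n. real a \<le> \<alpha> * real n}" by blast
    then show ?thesis using card_totatives_le[of n \<alpha>] n1 \<alpha> False by simp
  qed
  have "real (count_upto (farey_kfree k m b Q) \<alpha>) = (\<Sum>n\<in>denominators k m b Q. \<alpha> * real (totient n) - rho \<alpha> n + (if n = 1 then 1 else 0))"
    unfolding count_upto_def card_farey_filter of_nat_sum by (intro sum.cong refl each)
  also have "\<dots> = \<alpha> * real (card (farey_kfree k m b Q)) - (\<Sum>n\<in>denominators k m b Q. rho \<alpha> n) + (\<Sum>n\<in>denominators k m b Q. if n = 1 then 1 else 0)"
    by (simp add: sum.distrib sum_subtractf sum_distrib_left card_farey_kfree)
  also have "(\<Sum>n\<in>denominators k m b Q. if n = 1 then 1 else 0) = (if 1 \<in> denominators k m b Q then 1 else (0 :: real))"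
    using finite_denominators by (rule sum.delta)
  finally show ?thesis .
qed

section \<open>Bounds for the discrepancy from the counts\<close>

lemma count_upto_le_card:
  assumes "finite F" shows "count_upto F \<alpha> \<le> card F"
  unfolding count_upto_def using assms by (intro card_mono) auto

lemma ratio_bounds:
  assumes "finite F"
  shows "0 \<le> real (count_upto F \<alpha>) / real (card F)" "real (count_upto F \<alpha>) / real (card F) \<le> 1"
  using count_upto_le_card[OF assms, of \<alpha>] by (auto simp: divide_le_eq_1)

lemma discrepancy_ge:
  assumes "finite F" "0 \<le> \<alpha>" "\<alpha> \<le> 1"
  shows "\<bar>real (count_upto F \<alpha>) / real (card F) - \<alpha>\<bar> \<le> discrepancy F"
  unfolding discrepancy_def
proof (rule cSUP_upper)
  show "bdd_above ((\<lambda>\<alpha>. \<bar>real (count_upto F \<alpha>) / real (card F) - \<alpha>\<bar>) ` {0..1})"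
  proof (rule bdd_aboveI2)
    fix \<alpha> :: real assume "\<alpha> \<in> {0..1}"
    then have "0 \<le> \<alpha>" "\<alpha> \<le> 1" by auto
    then show "\<bar>real (count_upto F \<alpha>) / real (card F) - \<alpha>\<bar> \<le> 1"
      using ratio_bounds[OF assms(1), of \<alpha>] by linarith
  qed
qed (use assms in auto)

lemma discrepancy_le:
  assumes "\<And>\<alpha>. 0 \<le> \<alpha> \<Longrightarrow> \<alpha> \<le> 1 \<Longrightarrow> \<bar>real (count_upto F \<alpha>) / real (card F) - \<alpha>\<bar> \<le> B"
  shows "discrepancy F \<le> B"
  unfolding discrepancy_def using assms by (intro cSUP_least) auto

text \<open>The counts at 0 and at \<open>1 / (2 * Q)\<close> coincide while the expected
  proportions differ by \<open>1 / (2 * Q)\<close>, so one of the two deviations is at least half of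
  that. The argument covers the empty set as well.\<close>

lemma discrepancy_lower_bound:
  assumes Q: "Q \<ge> 1"
  shows "1 / 4 * (1 / real Q) \<le> discrepancy (farey_kfree k m b Q)"
proof -
  define F where "F = farey_kfree k m b Q"
  define \<alpha> where "\<alpha> = 1 / (2 * real Q)"
  have fin: "finite F" by (simp add: F_def finite_farey_kfree)
  have \<alpha>: "0 < \<alpha>" "\<alpha> \<le> 1" "\<alpha> < 1 / real Q" using Q by (auto simp: \<alpha>_def divide_simps)
  have small: "frac x \<le> 0" if x: "x \<in> F" "frac x \<le> \<alpha>" for x
  proof -
    obtain a q where aq: "x = real a / real q" "1 \<le> a" "a \<le> q" "q \<le> Q"
      using x(1) unfolding F_def farey_kfree_def by blast
    show ?thesis
    proof (cases "a = q")
      case True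
      then show ?thesis using aq by simp
    next
      case False
      then have "a < q" using aq by simp
      then have "frac x = real a / real q" using aq by (simp add: frac_eq)
      moreover have "1 / real Q \<le> real a / real q" using aq by (intro frac_le) auto
      ultimately show ?thesis using x \<alpha> by linarith
    qed
  qed
  have "{x \<in> F. frac x \<le> \<alpha>} = {x \<in> F. frac x \<le> 0}"
    using small \<alpha> by (auto intro: order_trans)
  then have eq: "count_upto F \<alpha> = count_upto F 0" by (simp add: count_upto_def)
  define t where "t = real (count_upto F 0) / real (card F)"
  have "\<bar>t - 0\<bar> \<le> discrepancy F" unfolding t_def using discrepancy_ge[OF fin, of 0] by simp
  moreover have "\<bar>t - \<alpha>\<bar> \<le> discrepancy F" unfolding t_def eq[symmetric] using discrepancy_ge[OF fin, of \<alpha>] \<alpha> by simp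
  ultimately have "\<alpha> / 2 \<le> discrepancy F" by linarith
  then show ?thesis by (simp add: \<alpha>_def F_def)
qed

section \<open>A lower bound for the number of fractions\<close>

text \<open>A union bound over the prime factors. It is linear in the \<open>1 / p\<close>, so it
  can be summed over \<open>n\<close> by interchanging sums.\<close>

lemma totient_ge:
  assumes n: "n > 0"
  shows "real n * (1 - (\<Sum>p\<in>prime_factors n. 1 / real p)) \<le> real (totient n)"
proof -
  let ?M = "\<lambda>p. {a. a \<in> {1..n} \<and> p dvd a}"
  have "{1..n} \<subseteq> totatives n \<union> (\<Union>p\<in>prime_factors n. ?M p)"
  proof
    fix a assume a: "a \<in> {1..n}"
    show "a \<in> totatives n \<union> (\<Union>p\<in>prime_factors n. ?M p)"
      using a coprime_iff_prime_factors[of n a] n by (auto simp: totatives_def)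
  qed
  then have "card {1..n} \<le> card (totatives n \<union> (\<Union>p\<in>prime_factors n. ?M p))"
    by (intro card_mono) (auto intro: finite_subset[of _ "{1..n}"])
  also have "\<dots> \<le> card (totatives n) + card (\<Union>p\<in>prime_factors n. ?M p)" by (rule card_Un_le)
  also have "card (\<Union>p\<in>prime_factors n. ?M p) \<le> (\<Sum>p\<in>prime_factors n. card (?M p))"
    by (intro card_UN_le) simp
  finally have "n \<le> totient n + (\<Sum>p\<in>prime_factors n. card (?M p))" by (simp add: totient_def)
  then have "real n \<le> real (totient n + (\<Sum>p\<in>prime_factors n. card (?M p)))" by (simp only: of_nat_le_iff)
  also have "\<dots> = real (totient n) + (\<Sum>p\<in>prime_factors n. real (card (?M p)))" by simp
  also have "(\<Sum>p\<in>prime_factors n. real (card (?M p))) = (\<Sum>p\<in>prime_factors n. real n * (1 / real p))"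
  proof (intro sum.cong refl)
    fix p assume p: "p \<in> prime_factors n"
    then have "p dvd n" "p > 0" by (auto simp: in_prime_factors_iff prime_gt_0_nat)
    then show "real (card (?M p)) = real n * (1 / real p)" using card_multiples[of p n] by (simp add: real_of_nat_div)
  qed
  finally show ?thesis by (simp add: right_diff_distrib sum_distrib_left)
qed

text \<open>If \<open>b\<close> is even then \<open>m\<close> is odd, and \<open>b + m\<close>
  serves. The class modulo \<open>2 * m\<close> contains only odd numbers.\<close>

lemma odd_class_lift:
  assumes b: "coprime b (int m)"
  obtains b' where "[b' = b] (mod int m)" "coprime b' (int (2 * m))"
proof (cases "odd b")
  case True
  then have "coprime b (2 * int m)" using b by simp
  then show ?thesis using that[of b] by simp
next
  case False
  then have "odd (int m)" using b coprime_common_divisor[of b "int m" 2] by auto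
  then have "odd (b + int m)" using False by simp
  moreover have "coprime (b + int m) (int m)"
    using b cong_imp_coprime[of b "b + int m" "int m"] by (simp add: cong_iff_dvd_diff)
  ultimately have "coprime (b + int m) (2 * int m)" by simp
  then show ?thesis using that[of "b + int m"] by (simp add: cong_iff_dvd_diff)
qed

text \<open>A common factor of \<open>j\<close> and \<open>M\<close> would divide \<open>b\<close>
  and leaves no \<open>n\<close>; otherwise the two conditions form a single class modulo
  \<open>j * M\<close>.\<close>

lemma card_class_multiples_le:
  fixes A B j M :: nat
  assumes AB: "A \<le> B" and j: "j > 0" and M: "M > 0" and b: "coprime b (int M)"
  shows "real (card {n. n \<in> {A<..B} \<and> [int n = b] (mod int M) \<and> j dvd n}) \<le> real (B - A) / (real M * real j) + 1"
proof -
  let ?S = "{n. n \<in> {A<..B} \<and> [int n = b] (mod int M) \<and> j dvd n}"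
  let ?T = "{e. e \<in> {int A<..int B} \<and> [e = 0] (mod int j) \<and> [e = b] (mod int M)}"
  have img: "int ` ?S = ?T"
  proof (intro equalityI subsetI)
    fix e assume e: "e \<in> ?T"
    then have "e \<ge> 0" by auto
    then obtain n where n: "e = int n" using nonneg_int_cases by blast
    then show "e \<in> int ` ?S" using e by (auto simp: cong_iff_dvd_diff)
  qed (auto simp: cong_iff_dvd_diff)
  have card: "card ?S = card ?T"
    unfolding img[symmetric] by (rule card_image[symmetric]) (simp add: inj_on_def)
  show ?thesis
  proof (cases rule: cong_gcd_cases[of 0 b "int j" "int M"])
    case none
    then have empty: "?T = {}" by blast
    show ?thesis unfolding card empty by simp
  next
    case (one e0)
    have "coprime (int j) (int M)"
    proof -
      have "gcd (int j) (int M) dvd b" using one(1) by (simp add: cong_iff_dvd_diff)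
      then have "is_unit (gcd (int j) (int M))" by (rule coprime_common_divisor[OF b]) simp
      then show ?thesis using is_unit_gcd by blast
    qed
    then have "gcd j M = 1" by simp
    then have "lcm j M = j * M" using prod_gcd_lcm_nat[of j M] by simp
    then have l: "lcm (int j) (int M) = int (j * M)" by (simp only: lcm_int_int_eq)
    have "?T = {e. e \<in> {int A<..int B} \<and> [e = e0] (mod int (j * M))}" unfolding one(2) l ..
    then have "real (card ?T) \<le> of_int (int B - int A) / of_int (int (j * M)) + 1"
      using card_cong_Ioc_bound[of "int (j * M)" "int A" "int B" e0] j M AB by simp
    then show ?thesis unfolding card using AB by (simp add: of_nat_diff mult.commute)
  qed
qed

text \<open>Write \<open>j = 2 * i + 1\<close> with \<open>i >= 1\<close>; then
  \<open>j ^ 2 > 4 * i * (i + 1)\<close>, and the reciprocals of the right side telescope to at most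
  1/4.\<close>

lemma sum_odd_inverse_squares:
  "(\<Sum>j | j \<in> {3..Q} \<and> odd j. 1 / real j ^ 2) \<le> 1 / 4"
proof -
  have "(\<Sum>j | j \<in> {3..Q} \<and> odd j. 1 / real j ^ 2) \<le> (\<Sum>j\<in>(\<lambda>i. 2 * i + 1) ` {1..Q}. 1 / real j ^ 2)"
    by (intro sum_mono2) (auto elim!: oddE)
  also have "\<dots> = (\<Sum>i=1..Q. 1 / real (2 * i + 1) ^ 2)" by (subst sum.reindex) (auto simp: inj_on_def)
  also have "\<dots> \<le> 1 / 4 - 1 / (4 * (real Q + 1))"
  proof (induction Q)
    case (Suc Q)
    have "1 / real (2 * Suc Q + 1) ^ 2 \<le> 1 / (4 * (real Q + 1) * (real Q + 2))"
    proof (rule frac_le)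
      show "4 * (real Q + 1) * (real Q + 2) \<le> real (2 * Suc Q + 1) ^ 2"
        by (simp add: power2_eq_square algebra_simps)
    qed auto
    also have "\<dots> = 1 / (4 * (real Q + 1)) - 1 / (4 * (real Q + 2))" by (simp add: divide_simps)
    finally show ?case using Suc by (simp add: add.commute)
  qed simp
  also have "\<dots> \<le> 1 / 4" by simp
  finally show ?thesis .
qed

lemma card_squares_le: "real (card {j. j \<in> {3..Q} \<and> j ^ 2 \<le> Q}) \<le> sqrt (real Q)"
proof -
  define s where "s = nat \<lfloor>sqrt (real Q)\<rfloor>"
  have "{j. j \<in> {3..Q} \<and> j ^ 2 \<le> Q} \<subseteq> {1..s}"
  proof
    fix j assume j: "j \<in> {j. j \<in> {3..Q} \<and> j ^ 2 \<le> Q}"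
    then have "real (j ^ 2) \<le> real Q" by (simp only: mem_Collect_eq of_nat_le_iff)
    then have "real j \<le> sqrt (real Q)" by (intro real_le_rsqrt) simp
    then have "j \<le> s" unfolding s_def by (simp add: le_nat_floor)
    then show "j \<in> {1..s}" using j by auto
  qed
  then have "card {j. j \<in> {3..Q} \<and> j ^ 2 \<le> Q} \<le> card {1..s}" by (intro card_mono) auto
  then have "real (card {j. j \<in> {3..Q} \<and> j ^ 2 \<le> Q}) \<le> real s" by simp
  also have "real s \<le> sqrt (real Q)" unfolding s_def by simp
  finally show ?thesis .
qed

text \<open>
  Restricting to odd denominators leaves only odd \<open>j \<ge> 3\<close> in the union bounds for square divisors and for
  common factors with numerators; each bound removes at most a quarter of the fractions since
  \<open>\<Sum>j. 1 / j ^ 2 \<le> 1 / 4\<close>.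
\<close>

lemma card_farey_kfree_ge:
  assumes m: "m \<ge> 1" and b: "coprime b (int m)" and k: "k \<ge> 2" and Q: "Q \<ge> (64 * m) ^ 2"
  shows "real Q ^ 2 / (32 * real m) \<le> real (card (farey_kfree k m b Q))"
proof -
  obtain b' where b': "[b' = b] (mod int m)" "coprime b' (int (2 * m))" using odd_class_lift[OF b] by blast
  \<comment> \<open>Only denominators in the upper half are used, so \<open>n >= Q / 2\<close> turns
    a bound for \<open>totient n / n\<close> into one of order \<open>Q\<close>.\<close>
  define A where "A = Q div 2"
  define L where "L = real (Q - A)"
  define T where "T = {n. n \<in> {A<..Q} \<and> [int n = b'] (mod int (2 * m))}"
  define J where "J = {j. j \<in> {3..Q} \<and> odd j}"
  \<comment> \<open>One expression for both losses: it is at most 0 if \<open>n\<close> is not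
    \<open>k\<close>-free, since then some \<open>p ^ 2\<close> divides \<open>n\<close>, and
    otherwise at most the factor in \<open>totient_ge\<close>. Summing over all \<open>j\<close> in
    \<open>J\<close> instead of primes only makes it smaller.\<close>
  define br where "br n = 1 - (\<Sum>j\<in>J. if j dvd n then 1 / real j else 0) - (\<Sum>j\<in>J. if j ^ 2 dvd n then 1 else (0 :: real))" for n
  have finT: "finite T" unfolding T_def by (rule finite_subset[of _ "{A<..Q}"]) auto
  have finJ: "finite J" unfolding J_def by (rule finite_subset[of _ "{3..Q}"]) auto
  have AQ: "A \<le> Q" by (simp add: A_def)
  have L: "real Q / 2 \<le> L" unfolding L_def A_def by linarith
  have Tn: "n > 0" "n \<le> Q" "real Q / 2 \<le> real n" "odd n" "[int n = b] (mod int m)" if "n \<in> T" for n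
  proof -
    show "n > 0" "n \<le> Q" using that by (auto simp: T_def)
    have "Q div 2 < n" using that by (simp add: T_def A_def)
    then show "real Q / 2 \<le> real n" by linarith
    have cong: "[int n = b'] (mod int (2 * m))" using that by (simp add: T_def)
    have "coprime n (2 * m)" by (rule coprime_cong_nat_int[OF cong b'(2)])
    then show "odd n" by simp
    have "[int n = b'] (mod int m)" by (rule cong_dvd_modulus[OF cong]) simp
    then show "[int n = b] (mod int m)" using b'(1) by (rule cong_trans)
  qed
  have primeJ: "p \<in> J" if "prime p" "p dvd n" "n \<in> T" for p n
  proof -
    have "p \<le> n" using that Tn(1)[OF that(3)] by (auto dest: dvd_imp_le)
    moreover have "odd p" using that(2) Tn(4)[OF that(3)] by (meson dvd_trans)
    moreover have "p \<ge> 2" using that(1) by (rule prime_ge_2_nat)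
    moreover have "p \<noteq> 2" using \<open>odd p\<close> by auto
    ultimately show ?thesis using Tn(2)[OF that(3)] by (simp add: J_def)
  qed
  have each: "real Q / 2 * br n \<le> (if n \<in> denominators k m b Q then real (totient n) else 0)" if n: "n \<in> T" for n
  proof (cases "n \<in> denominators k m b Q")
    case False
    then have "\<not> k_free k n" using Tn[OF n] by (simp add: denominators_def)
    then obtain p where p: "prime p" "p ^ k dvd n" using Tn(1)[OF n] by (auto simp: k_free_def)
    have p2: "p ^ 2 dvd n" using p(2) k le_imp_power_dvd dvd_trans by blast
    then have "p dvd n" by (metis dvd_trans dvd_triv_left power2_eq_square)
    then have pJ: "p \<in> J" using primeJ p n by blast
    have "(if p ^ 2 dvd n then 1 else (0 :: real)) \<le> (\<Sum>j\<in>J. if j ^ 2 dvd n then 1 else 0)"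
      using finJ pJ by (intro member_le_sum) auto
    moreover have "0 \<le> (\<Sum>j\<in>J. if j dvd n then 1 / real j else 0)" by (intro sum_nonneg) auto
    ultimately have "br n \<le> 0" using p2 by (simp add: br_def)
    then show ?thesis using False by (simp add: mult_nonneg_nonpos)
  next
    case True
    have "(\<Sum>p\<in>prime_factors n. 1 / real p) = (\<Sum>p\<in>prime_factors n. if p dvd n then 1 / real p else 0)"
      by (intro sum.cong) (auto simp: in_prime_factors_iff)
    also have "\<dots> \<le> (\<Sum>j\<in>J. if j dvd n then 1 / real j else 0)"
      using finJ primeJ n by (intro sum_mono2) (auto simp: in_prime_factors_iff)
    finally have "(\<Sum>p\<in>prime_factors n. 1 / real p) \<le> (\<Sum>j\<in>J. if j dvd n then 1 / real j else 0)" .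
    moreover have "0 \<le> (\<Sum>j\<in>J. if j ^ 2 dvd n then 1 else (0 :: real))" by (intro sum_nonneg) auto
    ultimately have le: "br n \<le> 1 - (\<Sum>p\<in>prime_factors n. 1 / real p)" unfolding br_def by linarith
    show ?thesis
    proof (cases "br n \<le> 0")
      case brn: True
      then have "real Q / 2 * br n \<le> 0" by (simp add: mult_nonneg_nonpos)
      then show ?thesis using True by simp
    next
      case False
      then have "real Q / 2 * br n \<le> real n * (1 - (\<Sum>p\<in>prime_factors n. 1 / real p))"
        using Tn(3)[OF n] le by (intro mult_mono) auto
      then show ?thesis using True totient_ge[of n] Tn(1)[OF n] by simp
    qed
  qed
  have c1: "L / (2 * real m) - 1 \<le> real (card T)"
  proof -
    have img: "int ` T = {e. e \<in> {int A<..int Q} \<and> [e = b'] (mod int (2 * m))}"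
    proof (intro equalityI subsetI)
      fix e assume e: "e \<in> {e. e \<in> {int A<..int Q} \<and> [e = b'] (mod int (2 * m))}"
      then have "e \<ge> 0" by auto
      then obtain n where n: "e = int n" using nonneg_int_cases by blast
      then show "e \<in> int ` T" using e by (auto simp: T_def)
    qed (auto simp: T_def)
    have "card T = card {e. e \<in> {int A<..int Q} \<and> [e = b'] (mod int (2 * m))}"
      unfolding img[symmetric] by (rule card_image[symmetric]) (simp add: inj_on_def)
    then show ?thesis using card_cong_Ioc_bound[of "int (2 * m)" "int A" "int Q" b'] m AQ
      by (simp add: L_def of_nat_diff)
  qed
  have cj: "real (card {n \<in> T. j dvd n}) \<le> L / (2 * real m) * (1 / real j) + 1" if "j > 0" for j
  proof -
    have "{n \<in> T. j dvd n} = {n. n \<in> {A<..Q} \<and> [int n = b'] (mod int (2 * m)) \<and> j dvd n}"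
      by (auto simp: T_def)
    then show ?thesis using card_class_multiples_le[OF AQ that _ b'(2)] m by (simp add: L_def)
  qed
  have "(\<Sum>n\<in>T. \<Sum>j\<in>J. if j dvd n then 1 / real j else 0) \<le> L / (2 * real m) * (1 / 4) + 2 * sqrt (real Q)"
  proof -
    have "(\<Sum>n\<in>T. \<Sum>j\<in>J. if j dvd n then 1 / real j else 0) = (\<Sum>j\<in>J. \<Sum>n\<in>T. if j dvd n then 1 / real j else 0)"
      by (rule sum.swap)
    also have "\<dots> = (\<Sum>j\<in>J. \<Sum>n\<in>{n \<in> T. j dvd n}. 1 / real j)"
      by (intro sum.cong refl sum.inter_filter[symmetric] finT)
    also have "\<dots> = (\<Sum>j\<in>J. real (card {n \<in> T. j dvd n}) * (1 / real j))" by (simp only: sum_constant)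
    also have "\<dots> \<le> (\<Sum>j\<in>J. L / (2 * real m) * (1 / real j ^ 2) + 1 / real j)"
    proof (intro sum_mono)
      fix j assume "j \<in> J"
      then have "j > 0" by (simp add: J_def)
      from cj[OF this] have "real (card {n \<in> T. j dvd n}) * (1 / real j) \<le> (L / (2 * real m) * (1 / real j) + 1) * (1 / real j)"
        by (rule mult_right_mono) simp
      then show "real (card {n \<in> T. j dvd n}) * (1 / real j) \<le> L / (2 * real m) * (1 / real j ^ 2) + 1 / real j"
        by (simp add: algebra_simps power2_eq_square)
    qed
    also have "\<dots> = L / (2 * real m) * (\<Sum>j\<in>J. 1 / real j ^ 2) + (\<Sum>j\<in>J. 1 / real j)"
      by (simp only: sum.distrib sum_distrib_left)
    also have "\<dots> \<le> L / (2 * real m) * (1 / 4) + 2 * sqrt (real Q)"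
    proof (intro add_mono mult_left_mono)
      show "(\<Sum>j\<in>J. 1 / real j ^ 2) \<le> 1 / 4" unfolding J_def by (rule sum_odd_inverse_squares)
      have "(\<Sum>j\<in>J. 1 / real j) \<le> (\<Sum>j\<in>J. 1 / sqrt (real j))"
      proof (intro sum_mono)
        fix j assume j: "j \<in> J"
        then have "1 \<le> sqrt (real j)" by (simp add: J_def)
        then have "sqrt (real j) * 1 \<le> sqrt (real j) * sqrt (real j)" by (intro mult_left_mono) auto
        then have "sqrt (real j) \<le> real j" by simp
        then show "1 / real j \<le> 1 / sqrt (real j)" using \<open>1 \<le> sqrt (real j)\<close> by (intro divide_left_mono) auto
      qed
      also have "\<dots> \<le> (\<Sum>j=1..Q. 1 / sqrt (real j))" by (intro sum_mono2) (auto simp: J_def)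
      also have "\<dots> \<le> 2 * sqrt (real Q)" by (rule sum_inverse_sqrt)
      finally show "(\<Sum>j\<in>J. 1 / real j) \<le> 2 * sqrt (real Q)" .
    qed (simp add: L_def)
    finally show ?thesis .
  qed
  moreover have "(\<Sum>n\<in>T. \<Sum>j\<in>J. if j ^ 2 dvd n then 1 else (0 :: real)) \<le> L / (2 * real m) * (1 / 4) + sqrt (real Q)"
  proof -
    have "(\<Sum>n\<in>T. \<Sum>j\<in>J. if j ^ 2 dvd n then 1 else (0 :: real)) = (\<Sum>j\<in>J. \<Sum>n\<in>T. if j ^ 2 dvd n then 1 else 0)"
      by (rule sum.swap)
    also have "\<dots> = (\<Sum>j\<in>J. \<Sum>n\<in>{n \<in> T. j ^ 2 dvd n}. 1)"
      by (intro sum.cong refl sum.inter_filter[symmetric] finT)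
    also have "\<dots> = (\<Sum>j\<in>J. real (card {n \<in> T. j ^ 2 dvd n}))" by simp
    \<comment> \<open>The rounding term 1 is kept only for \<open>j ^ 2 <= Q\<close>, since for
      larger \<open>j\<close> no \<open>n <= Q\<close> is divisible by \<open>j ^ 2\<close>. Kept
      for every \<open>j\<close> in \<open>J\<close>, it would add up to order
      \<open>Q\<close>.\<close>
    also have "\<dots> \<le> (\<Sum>j\<in>J. L / (2 * real m) * (1 / real j ^ 2) + (if j ^ 2 \<le> Q then 1 else 0))"
    proof (intro sum_mono)
      fix j assume "j \<in> J"
      then have j: "j ^ 2 > 0" by (simp add: J_def)
      show "real (card {n \<in> T. j ^ 2 dvd n}) \<le> L / (2 * real m) * (1 / real j ^ 2) + (if j ^ 2 \<le> Q then 1 else 0)"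
      proof (cases "j ^ 2 \<le> Q")
        case True
        then show ?thesis using cj[OF j] by simp
      next
        case False
        have "\<not> j ^ 2 dvd n" if "n \<in> T" for n
          using Tn(1,2)[OF that] False by (auto dest: dvd_imp_le)
        then have none: "{n \<in> T. j ^ 2 dvd n} = {}" by blast
        show ?thesis unfolding none using False by (simp add: L_def)
      qed
    qed
    also have "\<dots> = L / (2 * real m) * (\<Sum>j\<in>J. 1 / real j ^ 2) + (\<Sum>j\<in>J. if j ^ 2 \<le> Q then 1 else 0)"
      by (simp only: sum.distrib sum_distrib_left)
    also have "\<dots> \<le> L / (2 * real m) * (1 / 4) + sqrt (real Q)"
    proof (intro add_mono mult_left_mono)
      show "(\<Sum>j\<in>J. 1 / real j ^ 2) \<le> 1 / 4" unfolding J_def by (rule sum_odd_inverse_squares)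
      have "(\<Sum>j\<in>J. if j ^ 2 \<le> Q then 1 else (0 :: real)) \<le> (\<Sum>j\<in>{3..Q}. if j ^ 2 \<le> Q then 1 else 0)"
        by (intro sum_mono2) (auto simp: J_def)
      also have "\<dots> = (\<Sum>j\<in>{j \<in> {3..Q}. j ^ 2 \<le> Q}. 1)" by (rule sum.inter_filter[symmetric]) simp
      also have "\<dots> = real (card {j. j \<in> {3..Q} \<and> j ^ 2 \<le> Q})" by (simp only: sum_constant mult_1_right)
      also have "\<dots> \<le> sqrt (real Q)" by (rule card_squares_le)
      finally show "(\<Sum>j\<in>J. if j ^ 2 \<le> Q then 1 else (0 :: real)) \<le> sqrt (real Q)" .
    qed (simp add: L_def)
    finally show ?thesis .
  qed
  moreover have "(\<Sum>n\<in>T. br n) = real (card T) - (\<Sum>n\<in>T. \<Sum>j\<in>J. if j dvd n then 1 / real j else 0)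
      - (\<Sum>n\<in>T. \<Sum>j\<in>J. if j ^ 2 dvd n then 1 else (0 :: real))"
    unfolding br_def by (simp only: sum_subtractf sum_constant mult_1_right)
  ultimately have "L / (2 * real m) - 1 - (L / (2 * real m) * (1 / 4) + 2 * sqrt (real Q)) - (L / (2 * real m) * (1 / 4) + sqrt (real Q)) \<le> (\<Sum>n\<in>T. br n)"
    using c1 by linarith
  moreover have "L / (2 * real m) - 1 - (L / (2 * real m) * (1 / 4) + 2 * sqrt (real Q)) - (L / (2 * real m) * (1 / 4) + sqrt (real Q))
     = L / (4 * real m) - 1 - 3 * sqrt (real Q)"
    using m by (simp add: field_simps)
  moreover have "real Q / 2 / (4 * real m) \<le> L / (4 * real m)" using L by (intro divide_right_mono) auto
  \<comment> \<open>The rounding errors are at most \<open>4 * sqrt Q\<close>, which is below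
    \<open>Q / (16 * m)\<close> exactly when \<open>sqrt Q >= 64 * m\<close>: the origin of the
    threshold. Half of the main term \<open>Q / (8 * m)\<close> survives.\<close>
  moreover have "1 + 3 * sqrt (real Q) \<le> real Q / (16 * real m)"
  proof -
    have "real ((64 * m) ^ 2) \<le> real Q" using Q by (simp only: of_nat_le_iff)
    then have s: "64 * real m \<le> sqrt (real Q)" by (intro real_le_rsqrt) simp
    have "1 + 3 * sqrt (real Q) \<le> 4 * sqrt (real Q)" using s m by linarith
    also have "\<dots> = 64 * real m * sqrt (real Q) / (16 * real m)" using m by simp
    also have "\<dots> \<le> sqrt (real Q) * sqrt (real Q) / (16 * real m)" using s by (intro divide_right_mono mult_right_mono) auto
    finally show ?thesis by simp
  qed
  moreover have "real Q / 2 / (4 * real m) = 2 * (real Q / (16 * real m))" by simp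
  ultimately have "real Q / (16 * real m) \<le> (\<Sum>n\<in>T. br n)" by linarith
  then have "real Q / 2 * (real Q / (16 * real m)) \<le> real Q / 2 * (\<Sum>n\<in>T. br n)" by (rule mult_left_mono) simp
  also have "\<dots> = (\<Sum>n\<in>T. real Q / 2 * br n)" by (simp only: sum_distrib_left)
  also have "\<dots> \<le> (\<Sum>n\<in>T. if n \<in> denominators k m b Q then real (totient n) else 0)" by (rule sum_mono) (rule each)
  also have "\<dots> = (\<Sum>n\<in>{n \<in> T. n \<in> denominators k m b Q}. real (totient n))" using finT by (rule sum.inter_filter[symmetric])
  also have "\<dots> \<le> (\<Sum>n\<in>denominators k m b Q. real (totient n))"
    by (intro sum_mono2 finite_denominators) auto
  also have "\<dots> = real (card (farey_kfree k m b Q))" by (simp add: card_farey_kfree)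
  finally show ?thesis by (simp add: power2_eq_square)
qed

lemma discrepancy_upper_bound:
  assumes m: "m \<ge> 1"
  shows "\<exists>C>0. \<forall>k b Q. k \<ge> 2 \<longrightarrow> coprime b (int m) \<longrightarrow> Q \<ge> 1 \<longrightarrow> discrepancy (farey_kfree k m b Q) \<le> C * (1 / real Q)"
proof -
  obtain A where A: "A \<ge> 0" "\<And>k c X \<beta>. k \<ge> 2 \<Longrightarrow> coprime c (int m) \<Longrightarrow>
    \<bar>\<Sum>n | n \<in> {1..X} \<and> [int n = c] (mod int m) \<and> k_free k n. rho \<beta> n\<bar> \<le> A * real X"
    using k_free_sum_bound[OF m] by blast
  \<comment> \<open>The first summand makes the trivial bound 1 sufficient for \<open>Q\<close>
    below \<open>(64 * m) ^ 2\<close>, where the set may be empty. The second is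
    \<open>(A + 1) * Q\<close> divided by the lower bound \<open>Q ^ 2 / (32 * m)\<close> for the
    number of fractions; its 1 stands for the fraction 0.\<close>
  define C where "C = real ((64 * m) ^ 2) + 32 * real m * (A + 1)"
  show ?thesis
  proof (intro exI[of _ C] conjI allI impI)
    show "C > 0" using m A(1) by (auto simp: C_def intro!: add_pos_nonneg)
    fix k Q :: nat and b :: int
    assume k: "k \<ge> 2" and b: "coprime b (int m)" and Q: "Q \<ge> 1"
    define F where "F = farey_kfree k m b Q"
    have fin: "finite F" by (simp add: F_def finite_farey_kfree)
    show "discrepancy (farey_kfree k m b Q) \<le> C * (1 / real Q)"
      unfolding F_def[symmetric]
    proof (rule discrepancy_le)
      fix \<alpha> :: real assume \<alpha>: "0 \<le> \<alpha>" "\<alpha> \<le> 1"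
      show "\<bar>real (count_upto F \<alpha>) / real (card F) - \<alpha>\<bar> \<le> C * (1 / real Q)"
      proof (cases "Q \<ge> (64 * m) ^ 2")
        case False
        have "\<bar>real (count_upto F \<alpha>) / real (card F) - \<alpha>\<bar> \<le> 1"
          using ratio_bounds[OF fin, of \<alpha>] \<alpha> by linarith
        also have "1 \<le> real ((64 * m) ^ 2) * (1 / real Q)"
          using False Q by (simp add: divide_simps) (metis of_nat_le_iff of_nat_mult of_nat_numeral of_nat_power nat_le_linear)
        also have "\<dots> \<le> C * (1 / real Q)" using A(1) by (intro mult_right_mono) (auto simp: C_def)
        finally show ?thesis .
      next
        case True
        define N where "N = real (card F)"
        have N: "real Q ^ 2 / (32 * real m) \<le> N" unfolding N_def F_def by (rule card_farey_kfree_ge[OF m b k True])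
        moreover have N1: "0 < real Q ^ 2 / (32 * real m)" using Q m by simp
        ultimately have N0: "N > 0" by linarith
        have "\<bar>real (count_upto F \<alpha>) - \<alpha> * N\<bar> \<le> (A + 1) * real Q"
        \<comment> \<open>At \<open>\<alpha> = 1\<close> everything is counted and the deviation is
          0; the formula for \<open>\<alpha> < 1\<close> would count the fraction with denominator 1
          twice.\<close>
        proof (cases "\<alpha> = 1")
          case True
          have "{x \<in> F. frac x \<le> 1} = F" using frac_lt_1 less_imp_le by blast
          then show ?thesis using True A(1) by (simp add: count_upto_def N_def)
        next
          case False
          then have "real (count_upto F \<alpha>) = \<alpha> * N - (\<Sum>n\<in>denominators k m b Q. rho \<alpha> n) + (if 1 \<in> denominators k m b Q then 1 else 0)"
            unfolding F_def N_def using \<alpha> by (intro count_upto_farey_kfree) auto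
          moreover have "\<bar>\<Sum>n\<in>denominators k m b Q. rho \<alpha> n\<bar> \<le> A * real Q"
            unfolding denominators_def by (rule A(2)[OF k b])
          moreover have "\<bar>if 1 \<in> denominators k m b Q then 1 else (0 :: real)\<bar> \<le> 1 * real Q" using Q by auto
          ultimately show ?thesis unfolding distrib_right by linarith
        qed
        then have "\<bar>real (count_upto F \<alpha>) - \<alpha> * N\<bar> / N \<le> (A + 1) * real Q / (real Q ^ 2 / (32 * real m))"
          using N N1 A(1) by (intro frac_le) auto
        also have "\<dots> = 32 * real m * (A + 1) * (1 / real Q)" using Q m by (simp add: field_simps power2_eq_square)
        also have "\<dots> \<le> C * (1 / real Q)" by (intro mult_right_mono) (auto simp: C_def)
        also have "\<bar>real (count_upto F \<alpha>) - \<alpha> * N\<bar> / N = \<bar>real (count_upto F \<alpha>) / real (card F) - \<alpha>\<bar>"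
        proof -
          have "real (count_upto F \<alpha>) / N - \<alpha> = (real (count_upto F \<alpha>) - \<alpha> * N) / N" using N0 by (simp add: field_simps)
          then show ?thesis using N0 by (simp add: N_def abs_divide)
        qed
        finally show ?thesis .
      qed
    qed
  qed
qed

theorem theorem1p5:
  fixes m :: nat
  assumes "m \<ge> 1"
  shows "\<exists>C1 C2 :: real. C1 > 0 \<and> C2 > 0 \<and>
    (\<forall>(k::nat) (b::int) (Q::nat). k \<ge> 2 \<longrightarrow> coprime b (int m) \<longrightarrow> Q \<ge> 1 \<longrightarrow>
       C1 * (1 / real Q) \<le> discrepancy (farey_kfree k m b Q) \<and>
       discrepancy (farey_kfree k m b Q) \<le> C2 * (1 / real Q))"
proof -
  obtain C where "C > 0" "\<And>k b Q. k \<ge> 2 \<Longrightarrow> coprime b (int m) \<Longrightarrow> Q \<ge> 1 \<Longrightarrow>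
      discrepancy (farey_kfree k m b Q) \<le> C * (1 / real Q)"
    using discrepancy_upper_bound[OF assms] by blast
  then show ?thesis
    using discrepancy_lower_bound by (intro exI[of _ "1 / 4"] exI[of _ C]) auto
qed

end
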